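(* Let $f\colon \mathbb{H}^2\to\mathbb{H}^2$ be the function $$ f(z,w) := f_{p,\alpha,\beta,\lambda}(z,w) := \left( z\cdot\alpha + w^p\cdot\lambda,\; w\cdot\beta \right), $$ where $p\in\mathbb{N}\setminus\{0\}$ and $\alpha,\beta,\lambda\in\mathbb{H}$ are such that $$ 0<|\alpha|\le|\beta|<1 \qquad\text{and}\qquad (\alpha-\beta^p)\cdot\lambda=0. $$ Consider the following cases. Case A, consisting of the sub-cases: - Case A.1: $\lambda=0$, $\alpha=\beta\in\mathbb{H}$ with $0<|\alpha|<1$; - Case A.2: $\lambda=0$, $\alpha,\beta\in\mathbb{H}$ with $0<|\alpha|\le|\beta|<1$ and $\alpha\ne\beta$; - Case A.3: $\lambda\in\mathbb{H}$ with $\lambda\neq0$, $p=1$, $\alpha=\beta\in\mathbb{H}$ with $0<|\alpha|<1$. Case B: $\lambda\in\mathbb{H}$ with $\lambda\ne0$, $p\in\mathbb{N}$ with $p>1$, $\alpha=\beta^p\in\mathbb{H}$ with $0<|\beta|<1$, and moreover $\beta\in\mathbb{R}$. In each of these cases set $$ \Gamma := \{ f^{\circ k} : k\in\mathbb{Z} \} \subseteq \mathrm{Aut}(\mathbb{H}^2\setminus\{(0,0)\}). $$ Then $$ X := X_{p,\alpha,\beta,\lambda} := \left(\mathbb{H}^2\setminus\{(0,0)\}\right)/\Gamma $$ is a slice-quaternionic Hopf surface. More precisely, $X$ (with this slice-quaternionic structure) admits affine structures if and only if it belongs to Case A.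
   Context: $\mathbb{H}$ denotes the quaternions; $\mathbb{S}_{\mathbb{H}}=\{q\in\mathbb{H}: q^2=-1\}$ and $\mathbb{C}_J=\mathbb{R}\oplus\mathbb{R}J$ for $J\in\mathbb{S}_{\mathbb{H}}$. $f^{\circ k}$ is the $k$-fold composition of $f$ (of the inverse of $f$ if $k<0$). Slice regular functions of two quaternionic variables. Let $D\subseteq\mathbb{C}^2$ be open and invariant under complex conjugation in each of the variables $z_1,z_2$. Let $\mathbb{R}_2$ be the real Clifford algebra (isomorphic to $\mathbb{H}$) with basic units $e_1,e_2$ and $e_{12}=e_1e_2$. A continuous function $F=F_0+e_1F_1+e_2F_2+e_{12}F_{12}\colon D\to\mathbb{H}\otimes\mathbb{R}_2$, with $F_K\colon D\to\mathbb{H}$, is a stem function if $F_0,F_1,F_2,F_{12}$ are respectively even-even, odd-even, even-odd, odd-odd with respect to $(\beta_1,\beta_2)=(\mathrm{Im}\,z_1,\mathrm{Im}\,z_2)$. The circular set associated to $D$ is $$\Omega_D=\{(x_1,x_2)\in\mathbb{H}^2 : x_h=\alpha_h+\beta_hJ_h\in\mathbb{C}_{J_h},\ J_h\in\mathbb{S}_{\mathbb{H}},\ (\alpha_1+i\beta_1,\alpha_2+i\beta_2)\in D\}.$$ The (left) slice function $\mathcal{I}(F)\colon\Omega_D\to\mathbb{H}$ induced by $F$ is $\mathcal{I}(F)(x)=F_0(z_1,z_2)+J_1F_1(z_1,z_2)+J_2F_2(z_1,z_2)+J_1J_2F_{12}(z_1,z_2)$ for $x=(\alpha_1+J_1\beta_1,\alpha_2+J_2\beta_2)$,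 $z_h=\alpha_h+i\beta_h$. If $F$ is of class $C^1$ and $\overline\partial_1F=\overline\partial_2F=0$ on $D$, where $\overline\partial_1F=\frac12\left(\frac{\partial F}{\partial\alpha_1}+e_1\frac{\partial F}{\partial\beta_1}\right)$ and $\overline\partial_2F=\frac12\left(\frac{\partial F}{\partial\alpha_2}+\frac{\partial F}{\partial\beta_2}e_2\right)$, then $\mathcal{I}(F)$ is called (left) slice regular on $\Omega_D$. An $\mathbb{H}^2$-valued map is slice regular if its components are. A slice-quaternionic manifold is a differentiable manifold endowed with a slice-quaternionic structure, i.e. a differentiable structure (charts with values in $\mathbb{H}^n$; here $n=2$) whose changes of charts are slice regular (in particular, domains of definition of transition functions are circular). A slice-quaternionic map between slice-quaternionic manifolds is a map that is slice regular in local coordinates (the condition being checked on any charts). An automorphism is a slice-quaternionic map from a slice-quaternionic manifold to itself whose inverse is also slice-quaternionic; $\mathrm{Aut}(\cdot)$ denotes the set of automorphisms. The quotient $X$ is considered with the slice-quaternionic structure induced from $\mathbb{H}^2\setminus\{(0,0)\}$, for which the projection $\mathbb{H}^2\setminus\{(0,0)\}\to X$ is a slice-quaternionic map. A slice-quaternionic (primary) Hopf surface is a slice-quaternionic manifold whose universal covering is $\mathbb{H}^2\setminus\{(0,0)\}$ and whose fundamental group is the infinite cyclic group $\mathbb{Z}$. An affine structure is a slice-quaternionic structure given by an atlas whose changes of charts are (restrictions of) affine transformations of $\mathbb{H}^2$, i.e. maps $(z,w)\mapsto(z\cdot a+w\cdot b+c,\; z\cdot a'+w\cdot b'+c')$ with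 quaternionic coefficients acting on the right. That $X$ admits an affine structure refers to the slice-quaternionic structure of $X$ obtained as the quotient.
   Formalization: Chart images are circular, but domains of changes of charts need not be (impossible in Case A.3, e.g. f(z,w)=(z/2+w,w/2)); maps on them are slice regular if locally restrictions of slice regular maps on circular sets; affine changes of charts are likewise required locally. *)

theory Defs
  imports "HOL-Analysis.Analysis" "HOL-Algebra.Elementary_Groups"
begin

section \<open>Quaternions\<close>

datatype quat = Quat (qre: real) (qi: real) (qj: real) (qk: real)

lemma quat_eq_iff: "x = y \<longleftrightarrow> qre x = qre y \<and> qi x = qi y \<and> qj x = qj y \<and> qk x = qk y"
  by (cases x; cases y) auto

instantiation quat :: ring_1
begin

definition "0 = Quat 0 0 0 0"
definition "1 = Quat 1 0 0 0"
definition "x + y = Quat (qre x + qre y) (qi x + qi y) (qj x + qj y) (qk x + qk y)"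
definition "- x = Quat (- qre x) (- qi x) (- qj x) (- qk x)"
definition "x - y = Quat (qre x - qre y) (qi x - qi y) (qj x - qj y) (qk x - qk y)"
definition "x * y = Quat
  (qre x * qre y - qi x * qi y - qj x * qj y - qk x * qk y)
  (qre x * qi y + qi x * qre y + qj x * qk y - qk x * qj y)
  (qre x * qj y - qi x * qk y + qj x * qre y + qk x * qi y)
  (qre x * qk y + qi x * qj y - qj x * qi y + qk x * qre y)"

instance
  by standard
    (simp_all add: zero_quat_def one_quat_def plus_quat_def uminus_quat_def minus_quat_def
      times_quat_def quat_eq_iff algebra_simps)

end

lemma quat_sel_simps [simp]:
  "qre 0 = 0" "qi 0 = 0" "qj 0 = 0" "qk 0 = 0"
  "qre 1 = 1" "qi 1 = 0" "qj 1 = 0" "qk 1 = 0"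
  "qre (x + y) = qre x + qre y" "qi (x + y) = qi x + qi y"
  "qj (x + y) = qj x + qj y" "qk (x + y) = qk x + qk y"
  "qre (- x) = - qre x" "qi (- x) = - qi x" "qj (- x) = - qj x" "qk (- x) = - qk x"
  "qre (x - y) = qre x - qre y" "qi (x - y) = qi x - qi y"
  "qj (x - y) = qj x - qj y" "qk (x - y) = qk x - qk y"
  "qre (x * y) = qre x * qre y - qi x * qi y - qj x * qj y - qk x * qk y"
  "qi (x * y) = qre x * qi y + qi x * qre y + qj x * qk y - qk x * qj y"
  "qj (x * y) = qre x * qj y - qi x * qk y + qj x * qre y + qk x * qi y"
  "qk (x * y) = qre x * qk y + qi x * qj y - qj x * qi y + qk x * qre y"
  by (simp_all add: zero_quat_def one_quat_def plus_quat_def uminus_quat_def minus_quat_def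
      times_quat_def)

instantiation quat :: real_algebra_1
begin

definition "scaleR r x = Quat (r * qre x) (r * qi x) (r * qj x) (r * qk x)"

instance
  by standard (simp_all add: scaleR_quat_def quat_eq_iff algebra_simps)

end

lemma quat_scaleR_sel [simp]:
  "qre (r *\<^sub>R x) = r * qre x" "qi (r *\<^sub>R x) = r * qi x"
  "qj (r *\<^sub>R x) = r * qj x" "qk (r *\<^sub>R x) = r * qk x"
  by (simp_all add: scaleR_quat_def)

lemma quat_of_real_sel [simp]:
  "qre (of_real r) = r" "qi (of_real r) = 0" "qj (of_real r) = 0" "qk (of_real r) = 0"
  by (simp_all add: of_real_def)

instantiation quat :: real_inner
begin

definition "inner x y = qre x * qre y + qi x * qi y + qj x * qj y + qk x * qk y" for x y :: quat
definition "norm x = sqrt (inner x x)" for x :: quat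
definition "sgn x = x /\<^sub>R norm x" for x :: quat
definition "dist x y = norm (x - y)" for x y :: quat
definition uniformity_quat_def:
  "(uniformity :: (quat \<times> quat) filter) = (INF e\<in>{0 <..}. principal {(x, y). dist x y < e})"
definition open_quat_def:
  "open (U :: quat set) \<longleftrightarrow> (\<forall>x\<in>U. eventually (\<lambda>(x', y). x' = x \<longrightarrow> y \<in> U) uniformity)"

instance
proof
  fix x y z :: quat and r :: real
  show "inner x y = inner y x" "inner (x + y) z = inner x z + inner y z"
    "inner (scaleR r x) y = r * inner x y"
    by (simp_all add: inner_quat_def algebra_simps)
  show "0 \<le> inner x x"
    by (simp add: inner_quat_def)
  have "inner x x = 0 \<longleftrightarrow> qre x = 0 \<and> qi x = 0 \<and> qj x = 0 \<and> qk x = 0"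
    unfolding inner_quat_def by (simp add: add_nonneg_eq_0_iff)
  then show "(inner x x = 0) = (x = 0)"
    by (simp add: quat_eq_iff[of x 0])
qed (rule sgn_quat_def dist_quat_def open_quat_def uniformity_quat_def norm_quat_def)+

end

instantiation quat :: real_normed_div_algebra
begin

definition "inverse x = Quat (qre x) (- qi x) (- qj x) (- qk x) /\<^sub>R (norm x)\<^sup>2" for x :: quat
definition "x div y = x * inverse y" for x y :: quat

instance
proof
  fix x y :: quat
  have sq: "(norm u)\<^sup>2 = qre u * qre u + qi u * qi u + qj u * qj u + qk u * qk u" for u :: quat
    by (simp add: norm_quat_def inner_quat_def)
  have "(norm (x * y))\<^sup>2 = (norm x * norm y)\<^sup>2"
    unfolding power_mult_distrib sq by (simp add: algebra_simps)
  then show "norm (x * y) = norm x * norm y"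
    by (simp add: power2_eq_iff_nonneg)
  show "x div y = x * inverse y"
    by (simp add: divide_quat_def)
  show "inverse (0 :: quat) = 0"
    by (simp add: inverse_quat_def quat_eq_iff)

  assume "x \<noteq> 0"
  then have nz: "(norm x)\<^sup>2 \<noteq> 0"
    by simp
  let ?c = "Quat (qre x) (- qi x) (- qj x) (- qk x)"
  have "?c * x = of_real ((norm x)\<^sup>2)" "x * ?c = of_real ((norm x)\<^sup>2)"
    by (simp_all add: quat_eq_iff sq)
  with nz show "inverse x * x = 1" "x * inverse x = 1"
    by (simp_all add: inverse_quat_def of_real_def)
qed

end

instantiation quat :: euclidean_space
begin

definition "Basis = {Quat 1 0 0 0, Quat 0 1 0 0, Quat 0 0 1 0, Quat 0 0 0 1}"

instance
proof
  show "(Basis :: quat set) \<noteq> {}" "finite (Basis :: quat set)"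
    by (simp_all add: Basis_quat_def)
  show "inner u v = (if u = v then 1 else 0)" if "u \<in> Basis" "v \<in> Basis" for u v :: quat
    using that unfolding Basis_quat_def by (elim insertE emptyE) (simp_all add: inner_quat_def)
  show "(\<forall>u\<in>Basis. inner x u = 0) \<longleftrightarrow> x = 0" for x :: quat
    by (simp add: Basis_quat_def inner_quat_def quat_eq_iff[of x 0])
qed

end

definition imag_units :: "quat set" where
  "imag_units = {J. J\<^sup>2 = -1}"


section \<open>Slice regular functions of two quaternionic variables\<close>

definition conj_invariant :: "(complex \<times> complex) set \<Rightarrow> bool" where
  "conj_invariant D \<longleftrightarrow> (\<forall>(z1, z2)\<in>D. (cnj z1, z2) \<in> D \<and> (z1, cnj z2) \<in> D)"

definition circular_set :: "(complex \<times> complex) set \<Rightarrow> (quat \<times> quat) set" where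
  "circular_set D =
    {(of_real a1 + of_real b1 * J1, of_real a2 + of_real b2 * J2) | a1 b1 J1 a2 b2 J2.
      J1 \<in> imag_units \<and> J2 \<in> imag_units \<and> (Complex a1 b1, Complex a2 b2) \<in> D}"

definition circular :: "(quat \<times> quat) set \<Rightarrow> bool" where
  "circular V \<longleftrightarrow> (\<exists>D. open D \<and> conj_invariant D \<and> V = circular_set D)"

text \<open>
  The algebra \<open>\<bbbH> \<otimes> \<real>\<^sub>2\<close> is modelled on quadruples: \<open>(a\<^sub>0, a\<^sub>1, a\<^sub>2, a\<^sub>1\<^sub>2)\<close> stands for
  \<open>a\<^sub>0 + e\<^sub>1 a\<^sub>1 + e\<^sub>2 a\<^sub>2 + e\<^sub>1\<^sub>2 a\<^sub>1\<^sub>2\<close>. Quaternions commute with the Clifford units, and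
  \<open>e\<^sub>1\<^sup>2 = e\<^sub>2\<^sup>2 = -1\<close>, \<open>e\<^sub>1 e\<^sub>2 = - e\<^sub>2 e\<^sub>1 = e\<^sub>1\<^sub>2\<close>.
\<close>

type_synonym hcl2 = "quat \<times> quat \<times> quat \<times> quat"

fun cl_mult :: "hcl2 \<Rightarrow> hcl2 \<Rightarrow> hcl2" (infixl \<open>\<star>\<close> 70) where
  "(a0, a1, a2, a12) \<star> (b0, b1, b2, b12) =
    (a0 * b0 - a1 * b1 - a2 * b2 - a12 * b12,
     a0 * b1 + a1 * b0 + a2 * b12 - a12 * b2,
     a0 * b2 - a1 * b12 + a2 * b0 + a12 * b1,
     a0 * b12 + a1 * b2 - a2 * b1 + a12 * b0)"

definition e1 :: hcl2 where "e1 = (0, 1, 0, 0)"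
definition e2 :: hcl2 where "e2 = (0, 0, 1, 0)"

type_synonym stem = "complex \<times> complex \<Rightarrow> hcl2"

definition F0 :: "stem \<Rightarrow> complex \<times> complex \<Rightarrow> quat" where "F0 F z = fst (F z)"
definition F1 :: "stem \<Rightarrow> complex \<times> complex \<Rightarrow> quat" where "F1 F z = fst (snd (F z))"
definition F2 :: "stem \<Rightarrow> complex \<times> complex \<Rightarrow> quat" where "F2 F z = fst (snd (snd (F z)))"
definition F12 :: "stem \<Rightarrow> complex \<times> complex \<Rightarrow> quat" where "F12 F z = snd (snd (snd (F z)))"

definition stem_function :: "(complex \<times> complex) set \<Rightarrow> stem \<Rightarrow> bool" where
  "stem_function D F \<longleftrightarrow> continuous_on D F \<and>
    (\<forall>(z1, z2)\<in>D.
      F0 F (cnj z1, z2) = F0 F (z1, z2) \<and> F0 F (z1, cnj z2) = F0 F (z1, z2) \<and>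
      F1 F (cnj z1, z2) = - F1 F (z1, z2) \<and> F1 F (z1, cnj z2) = F1 F (z1, z2) \<and>
      F2 F (cnj z1, z2) = F2 F (z1, z2) \<and> F2 F (z1, cnj z2) = - F2 F (z1, z2) \<and>
      F12 F (cnj z1, z2) = - F12 F (z1, z2) \<and> F12 F (z1, cnj z2) = - F12 F (z1, z2))"

definition C1_on :: "(complex \<times> complex) set \<Rightarrow> stem \<Rightarrow> bool" where
  "C1_on D F \<longleftrightarrow>
    (\<exists>F'. (\<forall>z\<in>D. (F has_derivative blinfun_apply (F' z)) (at z)) \<and> continuous_on D F')"

text \<open>Partial derivatives are the values of the Frechet derivative on the coordinate directions
  \<open>(1, 0)\<close>, \<open>(\<i>, 0)\<close>, \<open>(0, 1)\<close>, \<open>(0, \<i>)\<close>. Note that \<open>e\<^sub>1\<close> acts from the left, \<open>e\<^sub>2\<close> from the right.\<close>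

definition dbar1 :: "stem \<Rightarrow> stem" where
  "dbar1 F z = (1/2) *\<^sub>R
    (frechet_derivative F (at z) (1, 0) + e1 \<star> frechet_derivative F (at z) (\<i>, 0))"

definition dbar2 :: "stem \<Rightarrow> stem" where
  "dbar2 F z = (1/2) *\<^sub>R
    (frechet_derivative F (at z) (0, 1) + frechet_derivative F (at z) (0, \<i>) \<star> e2)"

definition is_slice_function ::
    "(complex \<times> complex) set \<Rightarrow> stem \<Rightarrow> (quat \<times> quat \<Rightarrow> quat) \<Rightarrow> bool" where
  "is_slice_function D F g \<longleftrightarrow>
    (\<forall>a1 b1 J1 a2 b2 J2. J1 \<in> imag_units \<longrightarrow> J2 \<in> imag_units \<longrightarrow>
      (Complex a1 b1, Complex a2 b2) \<in> D \<longrightarrow>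
      (let z = (Complex a1 b1, Complex a2 b2) in
        g (of_real a1 + of_real b1 * J1, of_real a2 + of_real b2 * J2) =
          F0 F z + J1 * F1 F z + J2 * F2 F z + J1 * J2 * F12 F z))"

definition slice_regular :: "(complex \<times> complex) set \<Rightarrow> (quat \<times> quat \<Rightarrow> quat) \<Rightarrow> bool" where
  "slice_regular D g \<longleftrightarrow> open D \<and> conj_invariant D \<and>
    (\<exists>F. stem_function D F \<and> C1_on D F \<and> (\<forall>z\<in>D. dbar1 F z = 0 \<and> dbar2 F z = 0) \<and>
      is_slice_function D F g)"

definition slice_regular_map ::
    "(complex \<times> complex) set \<Rightarrow> (quat \<times> quat \<Rightarrow> quat \<times> quat) \<Rightarrow> bool" where
  "slice_regular_map D g \<longleftrightarrow> slice_regular D (fst \<circ> g) \<and> slice_regular D (snd \<circ> g)"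

text \<open>
  Slice regularity on an arbitrary open set \<open>V\<close>: near each of its points the map is a restriction of
  a slice regular map, the latter being defined on an (open) circular set. If \<open>V\<close> is itself circular,
  this is the same as being slice regular on \<open>V\<close>: by the identity principle the local stem functions
  agree along the connected sets of all \<open>(\<alpha>\<^sub>1 + \<beta>\<^sub>1 J\<^sub>1, \<alpha>\<^sub>2 + \<beta>\<^sub>2 J\<^sub>2)\<close> with \<open>\<alpha>\<close>, \<open>\<beta>\<close> fixed.
  Changes of charts and coordinate expressions of maps have to be considered on
  non-circular sets: a slice regular automorphism need not map circular sets to circular ones. For
  example, let \<open>h (z, w) = (z/2 + w, w/2)\<close>, let \<open>W\<close> be a circular neighbourhood of
  \<open>(J, 0)\<close>, \<open>J\<^sup>2 = -1\<close>, and let \<open>w\<close> be a non-real quaternion close to \<open>0\<close>. If \<open>h\<close> maps \<open>W\<close> onto a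
  circular set, then \<open>W\<close> contains \<open>(J + q, w)\<close> for all purely imaginary \<open>q\<close>. Consequently
  the quotient of \<open>\<bbbH>\<^sup>2 \<setminus> {(0, 0)}\<close> by \<open>h\<close> is not covered by local sections whose overlaps are all
  circular.
\<close>

definition slice_regular_on ::
    "(quat \<times> quat) set \<Rightarrow> (quat \<times> quat \<Rightarrow> quat \<times> quat) \<Rightarrow> bool" where
  "slice_regular_on V g \<longleftrightarrow>
    (\<forall>x\<in>V. \<exists>N D h. open N \<and> x \<in> N \<and> N \<subseteq> V \<and>
      slice_regular_map D h \<and> N \<subseteq> circular_set D \<and> (\<forall>y\<in>N. g y = h y))"


section \<open>Slice-quaternionic manifolds of dimension two\<close>

type_synonym 'a chart = "'a set \<times> ('a \<Rightarrow> quat \<times> quat)"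

definition chart_on :: "'a topology \<Rightarrow> 'a chart \<Rightarrow> bool" where
  "chart_on X c \<longleftrightarrow> (case c of (U, \<phi>) \<Rightarrow> openin X U \<and> open (\<phi> ` U) \<and>
    homeomorphic_map (subtopology X U) (top_of_set (\<phi> ` U)) \<phi>)"

definition slice_atlas :: "'a topology \<Rightarrow> 'a chart set \<Rightarrow> bool" where
  "slice_atlas X A \<longleftrightarrow>
    (\<forall>(U, \<phi>)\<in>A. chart_on X (U, \<phi>) \<and> circular (\<phi> ` U)) \<and>
    (\<Union>(U, \<phi>)\<in>A. U) = topspace X \<and>
    (\<forall>(U, \<phi>)\<in>A. \<forall>(V, \<psi>)\<in>A. slice_regular_on (\<phi> ` (U \<inter> V)) (\<psi> \<circ> inv_into U \<phi>))"

definition slice_manifold :: "'a topology \<Rightarrow> 'a chart set \<Rightarrow> bool" where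
  "slice_manifold X A \<longleftrightarrow> Hausdorff_space X \<and> second_countable X \<and> slice_atlas X A"

definition slice_map ::
    "'a topology \<Rightarrow> 'a chart set \<Rightarrow> 'b topology \<Rightarrow> 'b chart set \<Rightarrow> ('a \<Rightarrow> 'b) \<Rightarrow> bool" where
  "slice_map X A Y B g \<longleftrightarrow> continuous_map X Y g \<and>
    (\<forall>(U, \<phi>)\<in>A. \<forall>(V, \<psi>)\<in>B.
      slice_regular_on (\<phi> ` (U \<inter> g -` V)) (\<psi> \<circ> g \<circ> inv_into U \<phi>))"

definition slice_Aut :: "'a topology \<Rightarrow> 'a chart set \<Rightarrow> ('a \<Rightarrow> 'a) set" where
  "slice_Aut X A = {g. bij_betw g (topspace X) (topspace X) \<and> slice_map X A X A g \<and>
    slice_map X A X A (inv_into (topspace X) g)}"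

text \<open>Two atlases define the same structure if the identity is slice-quaternionic both ways.\<close>

definition same_slice_structure :: "'a topology \<Rightarrow> 'a chart set \<Rightarrow> 'a chart set \<Rightarrow> bool" where
  "same_slice_structure X A B \<longleftrightarrow> slice_map X A X B id \<and> slice_map X B X A id"

definition affine_transformation :: "(quat \<times> quat \<Rightarrow> quat \<times> quat) \<Rightarrow> bool" where
  "affine_transformation T \<longleftrightarrow> (\<exists>a b c a' b' c'. \<forall>z w.
    T (z, w) = (z * a + w * b + c, z * a' + w * b' + c'))"

text \<open>As overlaps of charts need not be connected, the affine transformation may depend on the
  connected component, i.e. it is required locally.\<close>

definition affine_atlas :: "'a topology \<Rightarrow> 'a chart set \<Rightarrow> bool" where
  "affine_atlas X A \<longleftrightarrow> slice_atlas X A \<and>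
    (\<forall>(U, \<phi>)\<in>A. \<forall>(V, \<psi>)\<in>A. \<forall>x\<in>\<phi> ` (U \<inter> V).
      \<exists>N T. open N \<and> x \<in> N \<and> N \<subseteq> \<phi> ` (U \<inter> V) \<and> affine_transformation T \<and>
        (\<forall>y\<in>N. (\<psi> \<circ> inv_into U \<phi>) y = T y))"

definition admits_affine_structure :: "'a topology \<Rightarrow> 'a chart set \<Rightarrow> bool" where
  "admits_affine_structure X A \<longleftrightarrow> (\<exists>B. affine_atlas X B \<and> same_slice_structure X A B)"


section \<open>Coverings and the fundamental group\<close>

text \<open>The library notions \<^const>\<open>covering_space\<close> and \<^const>\<open>homotopic_paths\<close> concern subsets of a type
  that is a topological space; these are their versions for abstract topologies, as needed
  for quotients.\<close>

definition covering_map :: "'a topology \<Rightarrow> 'b topology \<Rightarrow> ('a \<Rightarrow> 'b) \<Rightarrow> bool" where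
  "covering_map E X p \<longleftrightarrow> continuous_map E X p \<and> p ` topspace E = topspace X \<and>
    (\<forall>x\<in>topspace X. \<exists>T. x \<in> T \<and> openin X T \<and>
      (\<exists>\<V>. \<Union>\<V> = topspace E \<inter> p -` T \<and> (\<forall>U\<in>\<V>. openin E U) \<and> pairwise disjnt \<V> \<and>
        (\<forall>U\<in>\<V>. homeomorphic_map (subtopology E U) (subtopology X T) p)))"

definition loops_at :: "'a topology \<Rightarrow> 'a \<Rightarrow> (real \<Rightarrow> 'a) set" where
  "loops_at X x = {p. pathin X p \<and> p 0 = x \<and> p 1 = x}"

definition loop_homotopic :: "'a topology \<Rightarrow> 'a \<Rightarrow> (real \<Rightarrow> 'a) \<Rightarrow> (real \<Rightarrow> 'a) \<Rightarrow> bool" where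
  "loop_homotopic X x p q \<longleftrightarrow>
    homotopic_with (\<lambda>h. h 0 = x \<and> h 1 = x) (top_of_set {0..1}) X p q"

definition loop_join :: "(real \<Rightarrow> 'a) \<Rightarrow> (real \<Rightarrow> 'a) \<Rightarrow> real \<Rightarrow> 'a" where
  "loop_join p q t = (if t \<le> 1/2 then p (2 * t) else q (2 * t - 1))"

definition loop_class :: "'a topology \<Rightarrow> 'a \<Rightarrow> (real \<Rightarrow> 'a) \<Rightarrow> (real \<Rightarrow> 'a) set" where
  "loop_class X x p = {q \<in> loops_at X x. loop_homotopic X x p q}"

definition fundamental_group :: "'a topology \<Rightarrow> 'a \<Rightarrow> (real \<Rightarrow> 'a) set monoid" where
  "fundamental_group X x =
    \<lparr>carrier = loop_class X x ` loops_at X x,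
     mult = (\<lambda>P Q. \<Union>p\<in>P. \<Union>q\<in>Q. loop_class X x (loop_join p q)),
     one = loop_class X x (\<lambda>_. x)\<rparr>"


section \<open>Hopf surfaces\<close>

definition punctured :: "(quat \<times> quat) set" where
  "punctured = - {(0, 0)}"

abbreviation punctured_top :: "(quat \<times> quat) topology" where
  "punctured_top \<equiv> top_of_set punctured"

definition punctured_atlas :: "(quat \<times> quat) chart set" where
  "punctured_atlas = {(punctured, id)}"

text \<open>A covering by the punctured space for which both the covering map and its local inverses
  are slice-quaternionic.\<close>

definition slice_covering :: "'a topology \<Rightarrow> 'a chart set \<Rightarrow> (quat \<times> quat \<Rightarrow> 'a) \<Rightarrow> bool" where
  "slice_covering X A p \<longleftrightarrow> covering_map punctured_top X p \<and>
    slice_map punctured_top punctured_atlas X A p \<and>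
    (\<forall>U. open U \<and> U \<subseteq> punctured \<and> inj_on p U \<longrightarrow>
      (\<forall>(V, \<psi>)\<in>A. slice_regular_on (\<psi> ` (V \<inter> p ` U)) (inv_into U p \<circ> inv_into V \<psi>)))"

definition slice_Hopf_surface :: "'a topology \<Rightarrow> 'a chart set \<Rightarrow> bool" where
  "slice_Hopf_surface X A \<longleftrightarrow> slice_manifold X A \<and>
    simply_connected punctured \<and> (\<exists>p. slice_covering X A p) \<and>
    (\<forall>x\<in>topspace X. fundamental_group X x \<cong> integer_group)"


section \<open>Quotients\<close>

definition quotient_topology :: "'a topology \<Rightarrow> ('a \<Rightarrow> 'b) \<Rightarrow> 'b topology" where
  "quotient_topology T p =
    topology (\<lambda>U. U \<subseteq> p ` topspace T \<and> openin T {x \<in> topspace T. p x \<in> U})"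

lemma openin_quotient_topology:
  "openin (quotient_topology T p) U \<longleftrightarrow>
    U \<subseteq> p ` topspace T \<and> openin T {x \<in> topspace T. p x \<in> U}"
proof -
  have "istopology (\<lambda>U. U \<subseteq> p ` topspace T \<and> openin T {x \<in> topspace T. p x \<in> U})"
    unfolding istopology_def
  proof (intro conjI allI impI)
    fix S S' assume *: "S \<subseteq> p ` topspace T \<and> openin T {x \<in> topspace T. p x \<in> S}"
      "S' \<subseteq> p ` topspace T \<and> openin T {x \<in> topspace T. p x \<in> S'}"
    have "{x \<in> topspace T. p x \<in> S \<inter> S'} =
        {x \<in> topspace T. p x \<in> S} \<inter> {x \<in> topspace T. p x \<in> S'}"
      by auto
    with * show "openin T {x \<in> topspace T. p x \<in> S \<inter> S'}"
      by auto
    show "S \<inter> S' \<subseteq> p ` topspace T"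
      using * by auto
  next
    fix K assume *: "\<forall>S\<in>K. S \<subseteq> p ` topspace T \<and> openin T {x \<in> topspace T. p x \<in> S}"
    have "{x \<in> topspace T. p x \<in> \<Union>K} = (\<Union>S\<in>K. {x \<in> topspace T. p x \<in> S})"
      by auto
    with * show "openin T {x \<in> topspace T. p x \<in> \<Union>K}"
      by auto
    show "\<Union>K \<subseteq> p ` topspace T"
      using * by auto
  qed
  then show ?thesis
    by (simp add: quotient_topology_def)
qed

lemma topspace_quotient_topology: "topspace (quotient_topology T p) = p ` topspace T"
proof
  show "topspace (quotient_topology T p) \<subseteq> p ` topspace T"
    using openin_quotient_topology openin_topspace by metis
  have "{x \<in> topspace T. p x \<in> p ` topspace T} = topspace T"
    by auto
  then have "openin (quotient_topology T p) (p ` topspace T)"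
    by (simp add: openin_quotient_topology)
  then show "p ` topspace T \<subseteq> topspace (quotient_topology T p)"
    by (rule openin_subset)
qed

lemma quotient_map_quotient_topology: "quotient_map T (quotient_topology T p) p"
  unfolding quotient_map_def by (auto simp: topspace_quotient_topology openin_quotient_topology)

definition orbit_proj :: "(quat \<times> quat \<Rightarrow> quat \<times> quat) set \<Rightarrow> quat \<times> quat \<Rightarrow> (quat \<times> quat) set" where
  "orbit_proj G x = {g x | g. g \<in> G}"

definition orbit_space :: "(quat \<times> quat \<Rightarrow> quat \<times> quat) set \<Rightarrow> (quat \<times> quat) set topology" where
  "orbit_space G = quotient_topology punctured_top (orbit_proj G)"

text \<open>The induced structure: its charts are the local inverses of the projection.\<close>

definition orbit_atlas :: "(quat \<times> quat \<Rightarrow> quat \<times> quat) set \<Rightarrow> (quat \<times> quat) set chart set" where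
  "orbit_atlas G =
    {(orbit_proj G ` V, inv_into V (orbit_proj G)) | V.
      V \<subseteq> punctured \<and> circular V \<and> inj_on (orbit_proj G) V}"


section \<open>The contractions\<close>

definition hopf_map :: "nat \<Rightarrow> quat \<Rightarrow> quat \<Rightarrow> quat \<Rightarrow> quat \<times> quat \<Rightarrow> quat \<times> quat" where
  "hopf_map p \<alpha> \<beta> l = (\<lambda>(z, w). (z * \<alpha> + w ^ p * l, w * \<beta>))"

definition int_iterate :: "('a \<Rightarrow> 'a) \<Rightarrow> int \<Rightarrow> 'a \<Rightarrow> 'a" where
  "int_iterate f k = (if 0 \<le> k then f ^^ nat k else inv_into UNIV f ^^ nat (- k))"

definition hopf_group :: "nat \<Rightarrow> quat \<Rightarrow> quat \<Rightarrow> quat \<Rightarrow> (quat \<times> quat \<Rightarrow> quat \<times> quat) set" where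
  "hopf_group p \<alpha> \<beta> l = range (int_iterate (hopf_map p \<alpha> \<beta> l))"

definition case_A1 :: "nat \<Rightarrow> quat \<Rightarrow> quat \<Rightarrow> quat \<Rightarrow> bool" where
  "case_A1 p \<alpha> \<beta> l \<longleftrightarrow> l = 0 \<and> \<alpha> = \<beta> \<and> 0 < norm \<alpha> \<and> norm \<alpha> < 1"

definition case_A2 :: "nat \<Rightarrow> quat \<Rightarrow> quat \<Rightarrow> quat \<Rightarrow> bool" where
  "case_A2 p \<alpha> \<beta> l \<longleftrightarrow> l = 0 \<and> 0 < norm \<alpha> \<and> norm \<alpha> \<le> norm \<beta> \<and> norm \<beta> < 1 \<and> \<alpha> \<noteq> \<beta>"

definition case_A3 :: "nat \<Rightarrow> quat \<Rightarrow> quat \<Rightarrow> quat \<Rightarrow> bool" where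
  "case_A3 p \<alpha> \<beta> l \<longleftrightarrow> l \<noteq> 0 \<and> p = 1 \<and> \<alpha> = \<beta> \<and> 0 < norm \<alpha> \<and> norm \<alpha> < 1"

definition case_A :: "nat \<Rightarrow> quat \<Rightarrow> quat \<Rightarrow> quat \<Rightarrow> bool" where
  "case_A p \<alpha> \<beta> l \<longleftrightarrow> case_A1 p \<alpha> \<beta> l \<or> case_A2 p \<alpha> \<beta> l \<or> case_A3 p \<alpha> \<beta> l"

definition case_B :: "nat \<Rightarrow> quat \<Rightarrow> quat \<Rightarrow> quat \<Rightarrow> bool" where
  "case_B p \<alpha> \<beta> l \<longleftrightarrow>
    l \<noteq> 0 \<and> p > 1 \<and> \<alpha> = \<beta> ^ p \<and> 0 < norm \<beta> \<and> norm \<beta> < 1 \<and> \<beta> \<in> \<real>"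

end

theory Submission
  imports Defs "HOL-Complex_Analysis.Complex_Analysis"
begin

text \<open>
  All iterates of \<open>f\<close> have the form \<open>(z a + w\<^sup>p c, w b)\<close>, and \<open>N (z, w) = |z| + M |w|\<^sup>p\<close> with \<open>M\<close> large
  satisfies \<open>N (f x) \<le> c N x\<close> for some \<open>c < 1\<close>. Hence the circular shells \<open>r < N x < R\<close> with
  \<open>c R \<le> r\<close> are disjoint from their translates: the action is free and properly discontinuous, and the
  quotient has the required structure; its charts change by iterates of \<open>f\<close>, which are affine in
  Case A.

  In Case B, continuing a chart of an affine atlas along the simply connected covering gives a
  developing map \<open>g\<close> with \<open>g \<circ> f = T \<circ> g\<close>, \<open>T\<close> affine, \<open>g\<close> locally injective and holomorphic on every
  slice. Fix a slice \<open>\<complex>\<^sub>J\<close> containing \<open>\<lambda>\<close>. Expanding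
  \<open>g (t\<^sup>p z, t w) = \<Sum>\<^sub>d t\<^sup>d a\<^sub>d(z, w)\<close>, the linear part \<open>L\<close> of \<open>T\<close> satisfies
  \<open>L a\<^sub>d(z, w) = \<beta>\<^sup>d a\<^sub>d(z + \<mu> w\<^sup>p, w)\<close> with \<open>\<mu> = \<lambda> / \<alpha>\<close>, while homogeneity bounds
  \<open>a\<^sub>d(z + k \<mu> w\<^sup>p, w)\<close> polynomially in \<open>k\<close>. Local injectivity yields some \<open>a\<^sub>e \<noteq> 0\<close> with \<open>p\<close> not
  dividing \<open>e\<close> and a nonzero coefficient \<open>A\<close> of \<open>z\<^sup>m\<close> on the axis \<open>w = 0\<close>, so the left
  \<open>\<bbbH>\<close>-linear map \<open>L\<close> of \<open>\<bbbH>\<^sup>2\<close> has eigenvalues of moduli \<open>|\<beta>|\<^sup>e\<close> and \<open>|\<beta>|\<^bsup>pm\<^esup>\<close>, there is room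
  for no other, and \<open>m = 1\<close> as \<open>z\<^sup>m\<close> is not locally injective otherwise. Then \<open>a\<^sub>p\<close> is an eigenvector,
  so \<open>a\<^sub>p(k \<mu>, 1)\<close> does not depend on \<open>k\<close>, although \<open>a\<^sub>p(k \<mu>, 1) / k\<close> tends to \<open>\<mu> A \<noteq> 0\<close>.
\<close>

section \<open>Quaternions, circular sets and slice regular functions\<close>

text \<open>Paths and homotopies in the quotient have to be lifted, and charts of an affine atlas
  have to be continued. Both are instances of gluing local sections that are unique up to a freely
  acting group: the deck group for lifts, the affine bijections for developments.
  \<open>torsor_sheaf\<close> treats them together. Noncommutativity decides the sides. Affine maps
  have their coefficients on the right, while slice regularity becomes, on one slice, complex
  linearity of the derivative for multiplication by J from the left. Hence the linear part of
  \<open>T\<close> commutes with the scalars of the slice and can be applied to a power series term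
  by term. The weights p and 1 are those for which, as \<alpha> = \<beta>^p, the map f sends the
  curve (t^p z, t w) to a curve of the same kind, with t replaced by \<beta> t and z by z + \<mu>
  w^p. The map g is given only off the origin, so its expansion at t = 0 rests on a bound near the
  origin. Coefficients are compared along real t, and the real line lies in every slice; this also
  relates different slices to each other.\<close>

definition emb :: "quat \<Rightarrow> complex \<Rightarrow> quat" where
  "emb J z = of_real (Re z) + of_real (Im z) * J"

text \<open>The signs of J and of the imaginary part can be changed together, so a quaternion
  determines its complex coordinate only up to conjugation; this picks the one in the closed upper
  half-plane.\<close>

definition modulus_proj :: "quat \<Rightarrow> complex" where
  "modulus_proj x = Complex (qre x) (norm (x - of_real (qre x)))"

lemma norm_quat_sq: "(norm x)\<^sup>2 = (qre x)\<^sup>2 + (qi x)\<^sup>2 + (qj x)\<^sup>2 + (qk x)\<^sup>2" for x :: quat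
  by (simp add: norm_quat_def inner_quat_def power2_eq_square)

lemma imag_units_iff: "J \<in> imag_units \<longleftrightarrow> qre J = 0 \<and> norm J = 1"
proof
  assume "J \<in> imag_units"
  then have J: "J * J = -1" by (simp add: imag_units_def power2_eq_square)
  have "(norm J)\<^sup>2 = 1" using arg_cong[OF J, of norm] by (simp add: norm_mult power2_eq_square)
  then have "norm J = 1" using norm_ge_zero[of J] by (auto simp: power2_eq_1_iff)
  have "qre J * qi J = 0" "qre J * qj J = 0" "qre J * qk J = 0"
    "qre J * qre J - qi J * qi J - qj J * qj J - qk J * qk J = -1"
    using arg_cong[OF J, of qi] arg_cong[OF J, of qj] arg_cong[OF J, of qk] arg_cong[OF J, of qre]
    by (simp_all add: algebra_simps)
  \<comment> \<open>If \<open>qre J\<close> were nonzero, the other components would vanish and its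
    square would be -1.\<close>
  then have "qre J = 0" using zero_le_square[of "qre J"] by (cases "qre J = 0") auto
  then show "qre J = 0 \<and> norm J = 1" using \<open>norm J = 1\<close> by simp
next
  assume J: "qre J = 0 \<and> norm J = 1"
  then have "qi J * qi J + qj J * qj J + qk J * qk J = 1"
    using norm_quat_sq[of J] by (simp add: power2_eq_square)
  with J show "J \<in> imag_units"
    by (simp add: imag_units_def power2_eq_square quat_eq_iff algebra_simps)
qed

lemma imag_units_sq: "J \<in> imag_units \<Longrightarrow> J * J = -1"
  by (simp add: imag_units_def power2_eq_square)

lemma imag_units_sq_left: "J \<in> imag_units \<Longrightarrow> J * (J * x) = - x"
  by (simp add: imag_units_sq mult.assoc[symmetric])

lemma quat_of_real_commute: "of_real r * x = x * of_real r" for x :: quat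
  by (simp add: quat_eq_iff)

lemma emb_simps:
  "emb J 0 = 0" "emb J 1 = 1" "emb J (of_real r) = of_real r"
  "emb J (z + w) = emb J z + emb J w" "emb J (z - w) = emb J z - emb J w" "emb J (- z) = - emb J z"
  by (simp_all add: emb_def quat_eq_iff algebra_simps)

lemma emb_mult: "J \<in> imag_units \<Longrightarrow> emb J (z * w) = emb J z * emb J w"
proof -
  assume "J \<in> imag_units"
  then have J: "J * J = -1" by (rule imag_units_sq)
  have "emb J z * emb J w = of_real (Re z * Re w) + of_real (Re z * Im w + Im z * Re w) * J
      + of_real (Im z * Im w) * (J * J)"
    by (simp add: emb_def quat_eq_iff algebra_simps)
  then show ?thesis by (simp add: J emb_def quat_eq_iff algebra_simps)
qed

lemma emb_power: "J \<in> imag_units \<Longrightarrow> emb J (z ^ n) = emb J z ^ n"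
  by (induction n) (simp_all add: emb_mult emb_simps)

lemma norm_emb: "J \<in> imag_units \<Longrightarrow> norm (emb J z) = cmod z"
proof -
  assume "J \<in> imag_units"
  then have "qre J = 0" "norm J = 1" by (auto simp: imag_units_iff)
  then have "(norm (emb J z))\<^sup>2 = (Re z)\<^sup>2 + (Im z)\<^sup>2 * (norm J)\<^sup>2"
    unfolding norm_quat_sq by (simp add: emb_def power2_eq_square algebra_simps)
  then show ?thesis using \<open>norm J = 1\<close> by (simp add: cmod_def real_sqrt_unique)
qed

lemma emb_eq_0_iff: "J \<in> imag_units \<Longrightarrow> emb J z = 0 \<longleftrightarrow> z = 0"
  using norm_emb by (metis norm_eq_zero)

lemma emb_inj: "J \<in> imag_units \<Longrightarrow> emb J z = emb J w \<longleftrightarrow> z = w"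
  using emb_eq_0_iff[of J "z - w"] by (simp add: emb_simps)

lemma linear_emb: "linear (emb J)"
  by (rule linearI) (simp_all add: emb_simps(4), simp add: emb_def quat_eq_iff algebra_simps)

lemma bounded_linear_emb: "bounded_linear (emb J)"
  using linear_emb by (simp add: linear_conv_bounded_linear)

lemmas continuous_on_emb [continuous_intros] = bounded_linear.continuous_on[OF bounded_linear_emb]

lemma quat_emb_exists: "\<exists>J\<in>imag_units. \<exists>z. x = emb J z"
proof (cases "x = of_real (qre x)")
  case True
  have "Quat 0 1 0 0 \<in> imag_units" by (simp add: imag_units_def power2_eq_square quat_eq_iff)
  moreover have "x = emb (Quat 0 1 0 0) (of_real (qre x))" using True by (simp add: emb_simps)
  ultimately show ?thesis by blast
next
  case False
  define v where "v = x - of_real (qre x)"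
  have v: "norm v \<noteq> 0" "qre v = 0" using False by (auto simp: v_def)
  then have "(1 / norm v) *\<^sub>R v \<in> imag_units" by (simp add: imag_units_iff)
  moreover have "x = emb ((1 / norm v) *\<^sub>R v) (Complex (qre x) (norm v))"
    using v by (simp add: emb_def v_def quat_eq_iff)
  ultimately show ?thesis by blast
qed

lemma modulus_proj_emb:
  assumes "J \<in> imag_units"
  shows "modulus_proj (emb J z) = z \<or> modulus_proj (emb J z) = cnj z"
proof -
  have J: "qre J = 0" "norm J = 1" using assms by (auto simp: imag_units_iff)
  have "emb J z - of_real (Re z) = of_real (Im z) * J" by (simp add: emb_def)
  then have "norm (emb J z - of_real (Re z)) = \<bar>Im z\<bar>" using J by (simp add: norm_mult)
  moreover have "qre (emb J z) = Re z" using J by (simp add: emb_def)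
  ultimately have "modulus_proj (emb J z) = Complex (Re z) \<bar>Im z\<bar>" by (simp add: modulus_proj_def)
  then show ?thesis by (cases "Im z \<ge> 0") (auto simp: complex_eq_iff)
qed

lemma emb_modulus_proj: "\<exists>J\<in>imag_units. x = emb J (modulus_proj x)"
proof -
  obtain J z where J: "J \<in> imag_units" "x = emb J z" using quat_emb_exists by blast
  show ?thesis
  proof (cases "modulus_proj x = z")
    case True
    then show ?thesis using J by auto
  next
    case False
    then have *: "modulus_proj x = cnj z" using modulus_proj_emb J by blast
    have "- J \<in> imag_units" using J by (auto simp: imag_units_iff)
    moreover have "x = emb (- J) (cnj z)" using J by (simp add: emb_def)
    ultimately show ?thesis using * by auto
  qed
qed

section \<open>Circular sets\<close>

lemma conj_invariantD:
  assumes "conj_invariant D" "(z1, z2) \<in> D"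
  shows "(cnj z1, z2) \<in> D" "(z1, cnj z2) \<in> D" "(cnj z1, cnj z2) \<in> D"
proof -
  have *: "(cnj z1, z2) \<in> D \<and> (z1, cnj z2) \<in> D" if "(z1, z2) \<in> D" for z1 z2
    using assms(1) that unfolding conj_invariant_def by auto
  then show "(cnj z1, z2) \<in> D" "(z1, cnj z2) \<in> D" "(cnj z1, cnj z2) \<in> D"
    using assms(2) by blast+
qed

text \<open>A conjugation invariant D contains all choices of conjugates or none, so one
  representative decides membership. This turns a circular set into the preimage of D under a
  continuous map.\<close>

lemma circular_set_alt:
  assumes "conj_invariant D"
  shows "circular_set D = {(x, y). (modulus_proj x, modulus_proj y) \<in> D}"
proof (intro equalityI subsetI)
  fix q assume "q \<in> circular_set D"
  then obtain a1 b1 J1 a2 b2 J2 where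
    q: "q = (of_real a1 + of_real b1 * J1, of_real a2 + of_real b2 * J2)"
    "J1 \<in> imag_units" "J2 \<in> imag_units" "(Complex a1 b1, Complex a2 b2) \<in> D"
    unfolding circular_set_def by blast
  then have "q = (emb J1 (Complex a1 b1), emb J2 (Complex a2 b2))" by (simp add: emb_def)
  then show "q \<in> {(x, y). (modulus_proj x, modulus_proj y) \<in> D}"
    using modulus_proj_emb[OF q(2), of "Complex a1 b1"] modulus_proj_emb[OF q(3), of "Complex a2 b2"]
      q(4) conj_invariantD[OF assms q(4)] by auto
next
  fix q assume "q \<in> {(x, y). (modulus_proj x, modulus_proj y) \<in> D}"
  then obtain x y where q: "q = (x, y)" "(modulus_proj x, modulus_proj y) \<in> D" by auto
  obtain J1 J2 where J: "J1 \<in> imag_units" "x = emb J1 (modulus_proj x)"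
    "J2 \<in> imag_units" "y = emb J2 (modulus_proj y)" using emb_modulus_proj by metis
  have "q = (of_real (Re (modulus_proj x)) + of_real (Im (modulus_proj x)) * J1,
      of_real (Re (modulus_proj y)) + of_real (Im (modulus_proj y)) * J2)"
    using q(1) J by (simp add: emb_def)
  then show "q \<in> circular_set D"
    unfolding circular_set_def using J q(2) complex_surj by (smt (verit, best) mem_Collect_eq)
qed

lemma linear_qre: "linear qre"
  by (rule linearI) simp_all

lemma continuous_on_qre [continuous_intros]:
  "continuous_on S f \<Longrightarrow> continuous_on S (\<lambda>x. qre (f x))"
  using bounded_linear.continuous_on linear_qre linear_conv_bounded_linear by blast

lemma continuous_on_modulus_proj [continuous_intros]:
  "continuous_on S f \<Longrightarrow> continuous_on S (\<lambda>x. modulus_proj (f x))"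
  unfolding modulus_proj_def by (intro continuous_intros)

lemma open_circular_set:
  assumes "open D" "conj_invariant D"
  shows "open (circular_set D)"
proof -
  have "circular_set D = (\<lambda>q. (modulus_proj (fst q), modulus_proj (snd q))) -` D"
    by (auto simp: circular_set_alt[OF assms(2)])
  then show ?thesis
    using assms(1) by (auto intro!: open_vimage continuous_intros)
qed

lemma circular_imp_open: "circular V \<Longrightarrow> open V"
  using open_circular_set by (auto simp: circular_def)

lemma cmod_modulus_proj: "cmod (modulus_proj x) = norm x"
  using emb_modulus_proj[of x] norm_emb by metis

text \<open>Each \<open>emb J\<close> is isometric, so norms depend only on the complex coordinates.
  This is why the shells are circular.\<close>

lemma circular_of_norms:
  fixes Q :: "real \<Rightarrow> real \<Rightarrow> bool"
  assumes "open {(z1 :: complex, z2 :: complex). Q (cmod z1) (cmod z2)}"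
  shows "circular {(x, y). Q (norm x) (norm y)}"
proof -
  have *: "conj_invariant {(z1, z2). Q (cmod z1) (cmod z2)}" by (auto simp: conj_invariant_def)
  show ?thesis unfolding circular_def
    by (intro exI[of _ "{(z1, z2). Q (cmod z1) (cmod z2)}"] conjI *)
      (use assms in \<open>auto simp: circular_set_alt[OF *] cmod_modulus_proj\<close>)
qed

lemma emb_in_circular_set:
  assumes "conj_invariant D" "J \<in> imag_units" "(emb J z1, emb J z2) \<in> circular_set D"
  shows "(z1, z2) \<in> D"
proof -
  have "(modulus_proj (emb J z1), modulus_proj (emb J z2)) \<in> D"
    using assms by (auto simp: circular_set_alt)
  then show ?thesis
    using modulus_proj_emb[OF assms(2)] conj_invariantD[OF assms(1)] complex_cnj_cnj by metis
qed

section \<open>Stem functions of Hopf maps, and slice regular maps restricted to one slice\<close>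

lemma slice_regular_affine_monomial:
  "slice_regular UNIV (\<lambda>(z, w). z * a + w ^ q * c)"
proof -
  \<comment> \<open>The polynomial with the imaginary unit replaced by \<open>e1\<close> in z and by
    \<open>e2\<close> in w; there is no \<open>e12\<close> component because no term mixes the
    variables.\<close>
  define F :: stem where "F z = (of_real (Re (fst z)) * a + of_real (Re (snd z ^ q)) * c,
    of_real (Im (fst z)) * a, of_real (Im (snd z ^ q)) * c, 0)" for z
  \<comment> \<open>With \<open>m\<close> the derivative of w^q, the derivative of \<open>F\<close>
    is \<open>A + Re m B + Im m C\<close>: \<open>B\<close> multiplies the second increment by c,
    \<open>C\<close> does so after a multiplication by the imaginary unit. In this form it depends
    continuously on z because \<open>m\<close> does.\<close>
  define A :: "complex \<times> complex \<Rightarrow> hcl2" where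
    "A v = (of_real (Re (fst v)) * a, of_real (Im (fst v)) * a, 0, 0)" for v
  define B :: "complex \<times> complex \<Rightarrow> hcl2" where
    "B v = (of_real (Re (snd v)) * c, 0, of_real (Im (snd v)) * c, 0)" for v
  define C :: "complex \<times> complex \<Rightarrow> hcl2" where
    "C v = (- of_real (Im (snd v)) * c, 0, of_real (Re (snd v)) * c, 0)" for v
  define m where "m z = of_nat q * snd z ^ (q - 1)" for z :: "complex \<times> complex"
  have "linear A" "linear B" "linear C"
    by (rule linearI; simp add: A_def B_def C_def algebra_simps scaleR_conv_of_real)+
  then have bl: "bounded_linear A" "bounded_linear B" "bounded_linear C"
    by (simp_all add: linear_conv_bounded_linear)
  define F' where "F' z = Blinfun A + Re (m z) *\<^sub>R Blinfun B + Im (m z) *\<^sub>R Blinfun C" for z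
  have F': "blinfun_apply (F' z) v = A v + Re (m z) *\<^sub>R B v + Im (m z) *\<^sub>R C v" for z v
    using bl by (simp add: F'_def blinfun.add_left blinfun.scaleR_left bounded_linear_Blinfun_apply)
  have pw: "((\<lambda>z. snd z ^ q) has_derivative (\<lambda>v. m z * snd v)) (at z)" for z :: "complex \<times> complex"
    unfolding m_def by (auto intro!: derivative_eq_intros simp: algebra_simps)
  have bre: "bounded_linear Re" "bounded_linear Im" by (rule bounded_linear_Re bounded_linear_Im)+
  have der: "(F has_derivative blinfun_apply (F' z)) (at z)" for z
  proof -
    have "(F has_derivative (\<lambda>v. (of_real (Re (fst v)) * a + of_real (Re (m z * snd v)) * c,
        of_real (Im (fst v)) * a, of_real (Im (m z * snd v)) * c, 0))) (at z)"
      unfolding F_def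
      by (intro has_derivative_Pair has_derivative_add has_derivative_const
          has_derivative_mult_left has_derivative_of_real bounded_linear.has_derivative[OF bre(1)]
          bounded_linear.has_derivative[OF bre(2)] pw has_derivative_fst has_derivative_ident)
    moreover have "(\<lambda>v. (of_real (Re (fst v)) * a + of_real (Re (m z * snd v)) * c,
        of_real (Im (fst v)) * a, of_real (Im (m z * snd v)) * c, 0)) = blinfun_apply (F' z)"
      by (rule ext) (simp add: F' A_def B_def C_def scaleR_conv_of_real[symmetric] algebra_simps)
    ultimately show ?thesis by simp
  qed
  have "continuous_on UNIV F'"
    unfolding F'_def m_def by (intro continuous_intros)
  then have "C1_on UNIV F" unfolding C1_on_def using der by blast
  have cF: "continuous_on UNIV F"
    by (intro continuous_at_imp_continuous_on ballI has_derivative_continuous[OF der])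
  have "stem_function UNIV F"
    using cF unfolding stem_function_def
    by (auto simp: F_def F0_def F1_def F2_def F12_def simp flip: complex_cnj_power)
  moreover have "dbar1 F z = 0 \<and> dbar2 F z = 0" for z
  proof -
    have "frechet_derivative F (at z) = blinfun_apply (F' z)"
      using frechet_derivative_at[OF der] by simp
    then show ?thesis
      by (simp add: dbar1_def dbar2_def F' A_def B_def C_def e1_def e2_def zero_prod_def)
  qed
  moreover have "is_slice_function UNIV F (\<lambda>(z, w). z * a + w ^ q * c)"
  proof -
    have "(of_real a1 + of_real b1 * J1) * a + (of_real a2 + of_real b2 * J2) ^ q * c =
        of_real a1 * a + of_real (Re (Complex a2 b2 ^ q)) * c + J1 * (of_real b1 * a)
        + J2 * (of_real (Im (Complex a2 b2 ^ q)) * c)"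
      if "J1 \<in> imag_units" "J2 \<in> imag_units" for a1 b1 J1 a2 b2 J2
    proof -
      have "(of_real a2 + of_real b2 * J2) ^ q = emb J2 (Complex a2 b2 ^ q)"
        using that by (simp add: emb_power) (simp add: emb_def)
      moreover have "of_real b * J * x = J * (of_real b * x)" for b and J x :: quat
        by (simp only: quat_of_real_commute[of b J] mult.assoc)
      ultimately show ?thesis by (simp only: emb_def distrib_right add_ac)
    qed
    then show ?thesis
      unfolding is_slice_function_def by (simp add: Let_def F_def F0_def F1_def F2_def F12_def)
  qed
  moreover have "conj_invariant UNIV" by (simp add: conj_invariant_def)
  ultimately show ?thesis using \<open>C1_on UNIV F\<close> unfolding slice_regular_def by auto
qed

lemma circular_set_UNIV: "circular_set UNIV = UNIV"
  by (subst circular_set_alt) (auto simp: conj_invariant_def)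

text \<open>When both variables lie in the slice of J, \<open>e1\<close> and \<open>e2\<close> are
  both evaluated at J, and the order of the units no longer matters. Thus the equation with
  \<open>e1\<close> on the left and the one with \<open>e2\<close> on the right both express
  linearity for left multiplication by J.\<close>

lemma slice_regular_on_derivative:
  assumes g: "slice_regular_on V g" and J: "J \<in> imag_units"
    and z: "(emb J (fst z), emb J (snd z)) \<in> V"
  shows "\<exists>L. ((\<lambda>z. g (emb J (fst z), emb J (snd z))) has_derivative L) (at z) \<and>
    (\<forall>v. L (\<i> * fst v, \<i> * snd v) = (J * fst (L v), J * snd (L v)))"
proof -
  obtain N D h where N: "open N" "(emb J (fst z), emb J (snd z)) \<in> N" "N \<subseteq> V"
    "slice_regular_map D h" "N \<subseteq> circular_set D" "\<forall>y\<in>N. g y = h y"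
    using bspec[OF g[unfolded slice_regular_on_def] z] by (elim exE conjE)
  have sc: "\<exists>L. ((\<lambda>z. k (emb J (fst z), emb J (snd z))) has_derivative L) (at z) \<and>
    (\<forall>v. L (\<i> * fst v, \<i> * snd v) = J * L v)" if k: "slice_regular D k" for k
  proof -
    obtain F where F: "open D" "conj_invariant D" "C1_on D F" "\<forall>z\<in>D. dbar1 F z = 0 \<and> dbar2 F z = 0"
      "is_slice_function D F k" using k unfolding slice_regular_def by blast
    have zD: "z \<in> D" using emb_in_circular_set[OF F(2) J] N(2,5) by (cases z) auto
    obtain F' where F': "(F has_derivative blinfun_apply F') (at z)"
      using F(3) zD unfolding C1_on_def by blast
    then have fd: "frechet_derivative F (at z) = blinfun_apply F'"
      using frechet_derivative_at by metis
    define K :: "hcl2 \<Rightarrow> quat" where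
      "K v = fst v + J * fst (snd v) + J * fst (snd (snd v)) + J * J * snd (snd (snd v))" for v
    have "linear K" by (rule linearI) (simp_all add: K_def algebra_simps)
    then have K: "bounded_linear K" by (simp add: linear_conv_bounded_linear)
    define L where "L v = K (blinfun_apply F' v)" for v
    have linL: "linear L"
      unfolding L_def using bounded_linear_compose[OF K blinfun.bounded_linear_right]
      by (simp add: linear_conv_bounded_linear)
    have "((\<lambda>z. K (F z)) has_derivative L) (at z)"
      unfolding L_def by (rule bounded_linear.has_derivative[OF K F'])
    moreover have "K (F y) = k (emb J (fst y), emb J (snd y))" if "y \<in> D" for y
    proof -
      have "(Complex (Re (fst y)) (Im (fst y)), Complex (Re (snd y)) (Im (snd y))) \<in> D"
        using that by simp
      with F(5) J have "k (of_real (Re (fst y)) + of_real (Im (fst y)) * J,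
          of_real (Re (snd y)) + of_real (Im (snd y)) * J) =
          F0 F y + J * F1 F y + J * F2 F y + J * J * F12 F y"
        unfolding is_slice_function_def Let_def by fastforce
      then show ?thesis by (simp add: K_def emb_def F0_def F1_def F2_def F12_def)
    qed
    ultimately have der: "((\<lambda>z. k (emb J (fst z), emb J (snd z))) has_derivative L) (at z)"
      by (rule has_derivative_transform_within_open[OF _ F(1) zD])
    obtain p0 p1 p2 p12 where p: "blinfun_apply F' (1, 0) = (p0, p1, p2, p12)" by (metis surj_pair)
    obtain q0 q1 q2 q12 where q: "blinfun_apply F' (\<i>, 0) = (q0, q1, q2, q12)" by (metis surj_pair)
    obtain r0 r1 r2 r12 where r: "blinfun_apply F' (0, 1) = (r0, r1, r2, r12)" by (metis surj_pair)
    obtain s0 s1 s2 s12 where s: "blinfun_apply F' (0, \<i>) = (s0, s1, s2, s12)" by (metis surj_pair)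
    have pq: "p0 = q1 \<and> p1 = - q0 \<and> p2 = q12 \<and> p12 = - q2"
      using bspec[OF F(4) zD, THEN conjunct1] unfolding dbar1_def fd p q e1_def
      by (simp add: zero_prod_def eq_neg_iff_add_eq_0)
    have rs: "r0 = s2 \<and> r1 = s12 \<and> r2 = - s0 \<and> r12 = - s1"
      using bspec[OF F(4) zD, THEN conjunct2] unfolding dbar2_def fd r s e2_def
      by (simp add: zero_prod_def eq_neg_iff_add_eq_0)
    have JJ: "J * J = -1" using J by (rule imag_units_sq)
    have 1: "L (\<i>, 0) = J * L (1, 0)" "L (0, \<i>) = J * L (0, 1)"
      using pq rs unfolding L_def p q r s K_def
      by (simp_all add: distrib_left right_diff_distrib mult.assoc[symmetric] JJ)
    have Lv: "L v = Re (fst v) *\<^sub>R L (1, 0) + Im (fst v) *\<^sub>R L (\<i>, 0) + Re (snd v) *\<^sub>R L (0, 1)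
        + Im (snd v) *\<^sub>R L (0, \<i>)" for v
    proof -
      have "v = Re (fst v) *\<^sub>R (1, 0) + Im (fst v) *\<^sub>R (\<i>, 0) + Re (snd v) *\<^sub>R (0, 1)
        + Im (snd v) *\<^sub>R (0, \<i>)" by (cases v) (auto simp: complex_eq_iff)
      then show ?thesis using linear_add[OF linL] linear_scale[OF linL] by metis
    qed
    have "L (\<i> * fst v, \<i> * snd v) = J * L v" for v
      unfolding Lv[of v] Lv[of "(\<i> * fst v, \<i> * snd v)"] 1
      by (simp add: algebra_simps mult.assoc[symmetric] JJ)
    then show ?thesis using der by blast
  qed
  obtain L1 where L1: "((\<lambda>z. fst (h (emb J (fst z), emb J (snd z)))) has_derivative L1) (at z)"
    "\<And>v. L1 (\<i> * fst v, \<i> * snd v) = J * L1 v"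
    using sc[of "fst \<circ> h"] N(4) unfolding slice_regular_map_def by auto
  obtain L2 where L2: "((\<lambda>z. snd (h (emb J (fst z), emb J (snd z)))) has_derivative L2) (at z)"
    "\<And>v. L2 (\<i> * fst v, \<i> * snd v) = J * L2 v"
    using sc[of "snd \<circ> h"] N(4) unfolding slice_regular_map_def by auto
  have "((\<lambda>z. h (emb J (fst z), emb J (snd z))) has_derivative (\<lambda>v. (L1 v, L2 v))) (at z)"
    using has_derivative_Pair[OF L1(1) L2(1)] by simp
  moreover have "open ((\<lambda>z. (emb J (fst z), emb J (snd z))) -` N)"
    using N(1) by (auto intro!: open_vimage continuous_intros)
  ultimately have "((\<lambda>z. g (emb J (fst z), emb J (snd z))) has_derivative (\<lambda>v. (L1 v, L2 v))) (at z)"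
    by (rule has_derivative_transform_within_open) (use N in auto)
  then show ?thesis using L1(2) L2(2) by (intro exI[of _ "\<lambda>v. (L1 v, L2 v)"]) auto
qed

section \<open>Gluing local sections of torsors under a group\<close>

lemma compact_Int_halfspace:
  fixes b :: "'a::euclidean_space"
  assumes "compact C"
  shows "compact (C \<inter> {x. x \<bullet> b \<le> c})" "compact (C \<inter> {x. c \<le> x \<bullet> b})"
  using assms closed_halfspace_le[of b c] closed_halfspace_ge[of c b]
  by (auto simp: inner_commute intro!: compact_Int_closed)

lemma convex_Int_halfspace:
  fixes b :: "'a::euclidean_space"
  assumes "convex C"
  shows "convex (C \<inter> {x. x \<bullet> b \<le> c})" "convex (C \<inter> {x. c \<le> x \<bullet> b})"
  using assms convex_halfspace_le[of b c] convex_halfspace_ge[of c b]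
  by (auto simp: inner_commute intro!: convex_Int)

text \<open>Compactness gives a Lebesgue number d: pieces smaller than d fall under
  \<open>loc\<close>. K is cut into slabs, one coordinate direction after the other, until all
  pieces are that small, and \<open>glue\<close> reassembles them. All pieces stay convex, which is
  what makes overlaps connected later.\<close>

lemma convex_cut_induct:
  fixes K :: "'a::euclidean_space set"
  assumes K: "compact K" "convex K" and "P {}"
    and loc: "\<And>x. x \<in> K \<Longrightarrow>
      \<exists>e>0. \<forall>C. compact C \<longrightarrow> convex C \<longrightarrow> C \<subseteq> K \<inter> ball x e \<longrightarrow> P C"
    and glue: "\<And>C b c. compact C \<Longrightarrow> convex C \<Longrightarrow> C \<subseteq> K \<Longrightarrow>
      P (C \<inter> {x. x \<bullet> b \<le> c}) \<Longrightarrow> P (C \<inter> {x. c \<le> x \<bullet> b}) \<Longrightarrow> P C"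
  shows "P K"
proof -
  define Q where "Q x e \<longleftrightarrow> e > 0 \<and>
    (\<forall>C. compact C \<longrightarrow> convex C \<longrightarrow> C \<subseteq> K \<inter> ball x e \<longrightarrow> P C)" for x and e :: real
  have "\<forall>x\<in>K. \<exists>e. Q x e" using loc unfolding Q_def by blast
  then obtain e where Q: "\<forall>x\<in>K. Q x (e x)" using bchoice by metis
  note Q' = bspec[OF Q, unfolded Q_def]
  have e: "e x > 0" if "x \<in> K" for x using Q'[OF that] by (rule conjunct1)
  have eP: "P C" if "x \<in> K" "compact C" "convex C" "C \<subseteq> K \<inter> ball x (e x)" for x C
    using Q'[OF that(1), THEN conjunct2, THEN spec, THEN mp, THEN mp, THEN mp, OF that(2-4)] .
  obtain d where d: "d > 0" "\<And>x. x \<in> K \<Longrightarrow> \<exists>G\<in>(\<lambda>x. ball x (e x)) ` K. ball x d \<subseteq> G"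
  proof (rule Heine_Borel_lemma[OF K(1), of "(\<lambda>x. ball x (e x)) ` K"])
    show "K \<subseteq> \<Union>((\<lambda>x. ball x (e x)) ` K)" using e by (auto intro!: bexI centre_in_ball[THEN iffD2])
  qed auto
  \<comment> \<open>Extent at most \<open>w\<close> in every direction bounds the distance of two
    points by the l1 norm, hence by \<open>d / 2\<close>.\<close>
  define w where "w = d / (2 * DIM('a))"
  have w: "w > 0" using d by (simp add: w_def)
  have small: "P C" if C: "compact C" "convex C" "C \<subseteq> K"
      "\<forall>b\<in>Basis. \<forall>x\<in>C. \<forall>y\<in>C. \<bar>(x - y) \<bullet> b\<bar> \<le> w" for C
  proof (cases "C = {}")
    case True
    then show ?thesis using \<open>P {}\<close> by simp
  next
    case False
    then obtain x where x: "x \<in> C" by blast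
    then obtain z where z: "z \<in> K" "ball x d \<subseteq> ball z (e z)" using d(2)[of x] C by auto
    have "y \<in> ball x d" if "y \<in> C" for y
    proof -
      have "norm (x - y) \<le> (\<Sum>b\<in>Basis. \<bar>(x - y) \<bullet> b\<bar>)" by (rule norm_le_l1)
      also have "\<dots> \<le> (\<Sum>b\<in>(Basis::'a set). w)" using C x that by (intro sum_mono) blast
      also have "\<dots> < d" using d(1) by (simp add: w_def)
      finally show ?thesis by (simp add: dist_norm)
    qed
    have "C \<subseteq> K \<inter> ball z (e z)" using \<open>\<And>y. y \<in> C \<Longrightarrow> y \<in> ball x d\<close> z(2) C(3) by blast
    then show ?thesis by (rule eP[OF z(1) C(1,2)])
  qed
  \<comment> \<open>S collects the directions in which C may still be wide: for the empty set the
    claim is \<open>small\<close>, for all of \<open>Basis\<close> it is the goal.\<close>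
  have "S \<subseteq> Basis \<Longrightarrow> \<forall>C. compact C \<longrightarrow> convex C \<longrightarrow> C \<subseteq> K \<longrightarrow>
      (\<forall>b\<in>Basis - S. \<forall>x\<in>C. \<forall>y\<in>C. \<bar>(x - y) \<bullet> b\<bar> \<le> w) \<longrightarrow> P C"
    if "finite S" for S :: "'a set"
    using that
  proof (induction S rule: finite_induct)
    case empty
    then show ?case using small by simp
  next
    case (insert b S)
    have IH: "P C" if "compact C" "convex C" "C \<subseteq> K"
      "\<forall>b'\<in>Basis - insert b S. \<forall>x\<in>C. \<forall>y\<in>C. \<bar>(x - y) \<bullet> b'\<bar> \<le> w"
      "\<forall>x\<in>C. \<forall>y\<in>C. \<bar>(x - y) \<bullet> b\<bar> \<le> w" for C
      using insert that by (metis Diff_iff insert_iff insert_subset)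
    \<comment> \<open>Inner induction on the number of slabs of width \<open>w\<close> that C
      occupies in direction b: the topmost slab is cut off and handled by \<open>IH\<close>.\<close>
    have slices: "P C" if "compact C" "convex C" "C \<subseteq> K"
      "\<forall>b'\<in>Basis - insert b S. \<forall>x\<in>C. \<forall>y\<in>C. \<bar>(x - y) \<bullet> b'\<bar> \<le> w"
      "\<forall>x\<in>C. u \<le> x \<bullet> b \<and> x \<bullet> b \<le> u + real n * w" for C u n
      using that
    proof (induction n arbitrary: C)
      case 0
      then have "\<forall>x\<in>C. x \<bullet> b = u" by force
      then show ?case using w by (intro IH 0) (auto simp: inner_diff_left)
    next
      case (Suc n)
      show ?case
      proof (rule glue[where b = b and c = "u + real n * w"])
        show "P (C \<inter> {x. x \<bullet> b \<le> u + real n * w})"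
          using Suc.prems
          by (intro Suc.IH compact_Int_halfspace convex_Int_halfspace) auto
        show "P (C \<inter> {x. u + real n * w \<le> x \<bullet> b})"
        proof (intro IH compact_Int_halfspace convex_Int_halfspace)
          have "\<bar>(x - y) \<bullet> b\<bar> \<le> w" if "x \<in> C" "y \<in> C" "u + real n * w \<le> x \<bullet> b" "u + real n * w \<le> y \<bullet> b" for x y
          proof -
            have "x \<bullet> b \<le> u + real n * w + w" "y \<bullet> b \<le> u + real n * w + w"
              using Suc.prems(5) that by (auto simp: algebra_simps)
            then show ?thesis using that by (auto simp: inner_diff_left)
          qed
          then show "\<forall>x\<in>C \<inter> {x. u + real n * w \<le> x \<bullet> b}. \<forall>y\<in>C \<inter> {x. u + real n * w \<le> x \<bullet> b}.
            \<bar>(x - y) \<bullet> b\<bar> \<le> w" by blast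
        qed (use Suc.prems in auto)
      qed (use Suc.prems in auto)
    qed
    show ?case
    proof (intro allI impI)
      fix C assume C: "compact C" "convex C" "C \<subseteq> K"
        "\<forall>b'\<in>Basis - insert b S. \<forall>x\<in>C. \<forall>y\<in>C. \<bar>(x - y) \<bullet> b'\<bar> \<le> w"
      obtain B where B: "\<And>x. x \<in> C \<Longrightarrow> norm x \<le> B"
        using compact_imp_bounded[OF C(1)] bounded_iff by blast
      have 1: "norm b = 1" using insert.prems by auto
      obtain n :: nat where n: "2 * B \<le> real n * w"
        using real_arch_simple[of "2 * B / w"] w by (auto simp: field_simps)
      have "\<bar>x \<bullet> b\<bar> \<le> B" if "x \<in> C" for x
        using B[OF that] Cauchy_Schwarz_ineq2[of x b] 1 by simp
      then show "P C" using n by (intro slices[OF C, of "- B" n]) fastforce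
    qed
  qed
  from this[of Basis] show ?thesis using K by simp
qed

text \<open>\<open>Adm U g\<close> reads: g is a section over U. Sections can be tested locally,
  exist locally, and two of them differ locally by an element of G. Freeness is stated for values on
  a nonempty open set, as an affine map other than the identity may have fixed points.\<close>

locale torsor_sheaf =
  fixes Adm :: "'a::euclidean_space set \<Rightarrow> ('a \<Rightarrow> 'b) \<Rightarrow> bool"
    and G :: "('b \<Rightarrow> 'b) set"
    and Om :: "'a set"
  assumes adm_local: "open U \<Longrightarrow> (\<And>x. x \<in> U \<Longrightarrow> \<exists>N. open N \<and> x \<in> N \<and> N \<subseteq> U \<and> Adm N g) \<Longrightarrow> Adm U g"
    and adm_restrict: "Adm U g \<Longrightarrow> open V \<Longrightarrow> V \<subseteq> U \<Longrightarrow> Adm V g"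
    and adm_cong: "Adm U g \<Longrightarrow> (\<And>x. x \<in> U \<Longrightarrow> g x = g' x) \<Longrightarrow> Adm U g'"
    and adm_act: "Adm U g \<Longrightarrow> T \<in> G \<Longrightarrow> Adm U (T \<circ> g)"
    and adm_uniq: "open U \<Longrightarrow> Adm U g \<Longrightarrow> Adm U g' \<Longrightarrow> x \<in> U \<Longrightarrow>
      \<exists>T\<in>G. \<exists>N. open N \<and> x \<in> N \<and> N \<subseteq> U \<and> (\<forall>y\<in>N. g' y = T (g y))"
    and adm_free: "open U \<Longrightarrow> U \<noteq> {} \<Longrightarrow> Adm U g \<Longrightarrow> S \<in> G \<Longrightarrow> T \<in> G \<Longrightarrow>
      (\<forall>y\<in>U. S (g y) = T (g y)) \<Longrightarrow> S = T"
    and adm_ex: "x \<in> Om \<Longrightarrow> \<exists>U g. open U \<and> x \<in> U \<and> Adm U g"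
begin

definition good :: "'a set \<Rightarrow> bool" where
  "good U \<longleftrightarrow> open U \<and> (\<exists>g. Adm U g)"

lemma good_subset:
  assumes "good U" "open V" "V \<subseteq> U"
  shows "good V"
proof -
  from assms(1) obtain g where "Adm U g" unfolding good_def by blast
  from adm_restrict[OF this assms(2,3)] show ?thesis using assms(2) unfolding good_def by blast
qed

text \<open>On overlapping neighbourhoods the local group elements agree by freeness, so the set
  where a given element works and the rest of U are both open.\<close>

lemma adm_connected:
  assumes "open U" "connected U" "Adm U g" "Adm U g'" "U \<noteq> {}"
  shows "\<exists>T\<in>G. \<forall>y\<in>U. g' y = T (g y)"
proof -
  obtain x0 where x0: "x0 \<in> U" using assms by blast
  obtain T N0 where T: "T \<in> G" "open N0" "x0 \<in> N0" "N0 \<subseteq> U" "\<forall>y\<in>N0. g' y = T (g y)"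
    using adm_uniq[OF assms(1,3,4) x0] by blast
  define S where "S = \<Union>{N. open N \<and> N \<subseteq> U \<and> (\<forall>y\<in>N. g' y = T (g y))}"
  define R where "R = \<Union>{N. open N \<and> N \<subseteq> U \<and> N \<inter> S = {}}"
  have "open S" "open R" by (auto simp: S_def R_def)
  moreover have "U \<subseteq> S \<union> R"
  proof
    fix x assume "x \<in> U"
    then obtain T' N where N: "T' \<in> G" "open N" "x \<in> N" "N \<subseteq> U" "\<forall>y\<in>N. g' y = T' (g y)"
      using adm_uniq[OF assms(1,3,4)] by blast
    show "x \<in> S \<union> R"
    proof (cases "N \<inter> S = {}")
      case True
      then show ?thesis using N by (auto simp: R_def)
    next
      case False
      then obtain M where M: "open M" "M \<subseteq> U" "\<forall>y\<in>M. g' y = T (g y)" "N \<inter> M \<noteq> {}"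
        by (auto simp: S_def)
      have "T' = T"
      proof (rule adm_free)
        show "Adm (N \<inter> M) g" using adm_restrict[OF assms(3)] N M by blast
      qed (use N M T in auto)
      then show ?thesis using N by (auto simp: S_def)
    qed
  qed
  moreover have "S \<inter> R \<inter> U = {}" by (auto simp: R_def)
  moreover have "S \<inter> U \<noteq> {}" using T x0 by (auto simp: S_def)
  ultimately have "R \<inter> U = {}" using assms(2) unfolding connected_def by blast
  with \<open>U \<subseteq> S \<union> R\<close> have "U \<subseteq> S" by blast
  then show ?thesis using T by (intro bexI[of _ T]) (auto simp: S_def)
qed

text \<open>One of the two sections is moved by the group element that relates them on the connected
  overlap; then they can be pasted.\<close>

lemma good_Un:
  assumes "good U" "good V" "connected (U \<inter> V)"
  shows "good (U \<union> V)"
proof -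
  obtain g1 g2 where g: "Adm U g1" "Adm V g2" and o: "open U" "open V"
    using assms by (auto simp: good_def)
  have "\<exists>g1'. Adm U g1' \<and> (\<forall>x\<in>U \<inter> V. g1' x = g2 x)"
  proof (cases "U \<inter> V = {}")
    case True
    then show ?thesis using g by blast
  next
    case False
    have "open (U \<inter> V)" "Adm (U \<inter> V) g1" "Adm (U \<inter> V) g2"
      using o by (auto intro: adm_restrict[OF g(1)] adm_restrict[OF g(2)])
    then obtain T where T: "T \<in> G" "\<forall>y\<in>U \<inter> V. g2 y = T (g1 y)"
      using adm_connected assms(3) False by blast
    then show ?thesis using adm_act[OF g(1) T(1)] by (intro exI[of _ "T \<circ> g1"]) auto
  qed
  then obtain g1' where g1': "Adm U g1'" "\<forall>x\<in>U \<inter> V. g1' x = g2 x" by blast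
  define g where "g = (\<lambda>x. if x \<in> U then g1' x else g2 x)"
  have "Adm (U \<union> V) g"
  proof (rule adm_local)
    fix x assume "x \<in> U \<union> V"
    moreover have "Adm U g" by (rule adm_cong[OF g1'(1)]) (simp add: g_def)
    moreover have "Adm V g" using g1'(2) by (intro adm_cong[OF \<open>Adm V g2\<close>]) (auto simp: g_def)
    ultimately show "\<exists>N. open N \<and> x \<in> N \<and> N \<subseteq> U \<union> V \<and> Adm N g" using o by blast
  qed (use o in auto)
  then show ?thesis using o by (auto simp: good_def)
qed

text \<open>Neighbourhoods of constant radius around convex sets are convex. So the neighbourhoods
  of the two halves of a cut meet in a convex set, and \<open>good_Un\<close> applies; for arbitrary
  open neighbourhoods the overlap might be disconnected.\<close>

lemma good_compact_convex:
  assumes K: "compact K" "convex K" "K \<subseteq> Om"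
  shows "\<exists>e>0. good (\<Union>x\<in>K. ball x e)"
proof -
  have mono: "good (\<Union>x\<in>C. ball x e')" if "good (\<Union>x\<in>C. ball x e)" "e' \<le> e" for C e e'
  proof -
    have "(\<Union>x\<in>C. ball x e') \<subseteq> (\<Union>x\<in>C. ball x e)" using that(2) by force
    then show ?thesis by (intro good_subset[OF that(1)]) auto
  qed
  have cvx: "convex (\<Union>x\<in>C. ball x e)" if "convex C" for C :: "'a set" and e
  proof -
    have "(\<Union>x\<in>C. ball x e) = (\<Union>x\<in>C. \<Union>y\<in>ball 0 e. {x + y})"
    proof (intro equalityI subsetI)
      fix z assume "z \<in> (\<Union>x\<in>C. ball x e)"
      then obtain x where "x \<in> C" "dist x z < e" by auto
      then show "z \<in> (\<Union>x\<in>C. \<Union>y\<in>ball 0 e. {x + y})"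
        by (intro UN_I[of x] UN_I[of "z - x"]) (simp_all add: dist_norm norm_minus_commute)
    next
      fix z assume "z \<in> (\<Union>x\<in>C. \<Union>y\<in>ball 0 e. {x + y})"
      then obtain x y where "x \<in> C" "norm y < e" "z = x + y" by auto
      then show "z \<in> (\<Union>x\<in>C. ball x e)" by (intro UN_I[of x]) (auto simp: dist_norm)
    qed
    then show ?thesis using convex_sums[OF that convex_ball[of 0 e]] by simp
  qed
  show ?thesis
  proof (rule convex_cut_induct[of K "\<lambda>C. \<exists>e>0. good (\<Union>x\<in>C. ball x e)", OF K(1,2)])
    show "\<exists>e>0. good (\<Union>x\<in>{}. ball x e)"
      using adm_local[of "{}"] by (intro exI[of _ 1]) (auto simp: good_def)
  next
    fix x assume "x \<in> K"
    then obtain U g where U: "open U" "x \<in> U" "Adm U g" using adm_ex K by blast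
    then obtain e where e: "e > 0" "ball x e \<subseteq> U" using open_contains_ball by blast
    show "\<exists>e>0. \<forall>C. compact C \<longrightarrow> convex C \<longrightarrow> C \<subseteq> K \<inter> ball x e \<longrightarrow> (\<exists>e>0. good (\<Union>x\<in>C. ball x e))"
    proof (rule exI[of _ "e/2"], intro conjI allI impI)
      fix C assume C: "C \<subseteq> K \<inter> ball x (e/2)"
      have "(\<Union>x\<in>C. ball x (e/2)) \<subseteq> U"
      proof
        fix z assume "z \<in> (\<Union>x\<in>C. ball x (e/2))"
        then obtain y where "y \<in> C" "dist y z < e/2" by auto
        then have "dist x z < e" using C dist_triangle[of x z y] by force
        then show "z \<in> U" using e by auto
      qed
      then have "good (\<Union>x\<in>C. ball x (e/2))"
        using adm_restrict[OF U(3), of "\<Union>x\<in>C. ball x (e/2)"] by (auto simp: good_def)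
      then show "\<exists>e>0. good (\<Union>x\<in>C. ball x e)" using e by (intro exI[of _ "e/2"]) auto
    qed (use e in auto)
  next
    fix C b c
    assume C: "compact C" "convex C" "C \<subseteq> K"
      and "\<exists>e>0. good (\<Union>x\<in>C \<inter> {x. x \<bullet> b \<le> c}. ball x e)"
        "\<exists>e>0. good (\<Union>x\<in>C \<inter> {x. c \<le> x \<bullet> b}. ball x e)"
    then obtain e1 e2 where e: "e1 > 0" "good (\<Union>x\<in>C \<inter> {x. x \<bullet> b \<le> c}. ball x e1)"
      "e2 > 0" "good (\<Union>x\<in>C \<inter> {x. c \<le> x \<bullet> b}. ball x e2)" by blast
    \<comment> \<open>A common radius makes the union of the two neighbourhoods the neighbourhood of
      the whole piece.\<close>
    define e where "e = min e1 e2"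
    let ?A = "C \<inter> {x. x \<bullet> b \<le> c}" and ?B = "C \<inter> {x. c \<le> x \<bullet> b}"
    have "good ((\<Union>x\<in>?A. ball x e) \<union> (\<Union>x\<in>?B. ball x e))"
    proof (rule good_Un)
      show "good (\<Union>x\<in>?A. ball x e)" "good (\<Union>x\<in>?B. ball x e)"
        using mono[OF e(2)] mono[OF e(4)] by (auto simp: e_def)
      have "convex ?A" "convex ?B" using convex_Int_halfspace[OF C(2)] by auto
      then show "connected ((\<Union>x\<in>?A. ball x e) \<inter> (\<Union>x\<in>?B. ball x e))"
        using cvx by (intro convex_connected convex_Int) auto
    qed
    moreover have "(\<Union>x\<in>?A. ball x e) \<union> (\<Union>x\<in>?B. ball x e) = (\<Union>x\<in>C. ball x e)"
    proof -
      have "?A \<union> ?B = C" by (auto simp: linear)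
      then show ?thesis by (metis UN_Un)
    qed
    ultimately show "\<exists>e>0. good (\<Union>x\<in>C. ball x e)"
      using e by (intro exI[of _ e]) (auto simp: e_def)
  qed
qed

text \<open>All sections are first normalised to coincide on \<open>U 0\<close>; by freeness they
  then coincide wherever two of them are defined.\<close>

lemma good_chain:
  fixes U :: "nat \<Rightarrow> 'a set"
  assumes good: "\<And>n. good (U n)" and con: "\<And>n. connected (U n)"
    and mono: "\<And>m n. m \<le> n \<Longrightarrow> U m \<subseteq> U n" and ne: "U 0 \<noteq> {}"
  shows "good (\<Union>n. U n)"
proof -
  have o: "open (U n)" for n using good by (simp add: good_def)
  obtain g where g: "\<And>n. Adm (U n) (g n)" using good unfolding good_def by metis
  have "\<exists>T\<in>G. \<forall>y\<in>U 0. g 0 y = T (g n y)" for n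
    using adm_connected[OF o con adm_restrict[OF g[of n] o] g ne] mono[of 0 n] by blast
  then obtain T where T: "\<And>n. T n \<in> G" "\<And>n y. y \<in> U 0 \<Longrightarrow> g 0 y = T n (g n y)" by metis
  define k where "k n = T n \<circ> g n" for n
  have k: "Adm (U n) (k n)" for n using adm_act[OF g T(1)] by (simp add: k_def)
  have k0: "k n y = g 0 y" if "y \<in> U 0" for n y using T(2)[OF that, of n] by (simp add: k_def)
  have eq: "k n y = k m y" if "m \<le> n" "y \<in> U m" for m n y
  proof -
    have kn: "Adm (U m) (k n)" using adm_restrict[OF k o mono[OF that(1)]] .
    have ne': "U m \<noteq> {}" using mono[of 0 m] ne by auto
    obtain S where S: "S \<in> G" "\<And>y. y \<in> U m \<Longrightarrow> k n y = S (k m y)"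
      using adm_connected[OF o con k kn ne'] by blast
    \<comment> \<open>\<open>S'\<close> plays the role of the identity on the values of
      \<open>k m\<close>: an element of G with this property comes from comparing the section with
      itself. Freeness on \<open>U 0\<close> then gives \<open>S = S'\<close>.\<close>
    obtain S' where S': "S' \<in> G" "\<And>y. y \<in> U m \<Longrightarrow> k m y = S' (k m y)"
      using adm_connected[OF o con k k ne'] by blast
    have "S = S'"
    proof (rule adm_free[OF o ne])
      show "Adm (U 0) (k m)" using adm_restrict[OF k o mono[of 0 m]] by simp
      show "\<forall>y\<in>U 0. S (k m y) = S' (k m y)"
      proof
        fix y assume y: "y \<in> U 0"
        then have "y \<in> U m" using mono[of 0 m] by auto
        then show "S (k m y) = S' (k m y)" using S(2)[of y] S'(2)[of y] k0[OF y] by simp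
      qed
    qed (use S S' in auto)
    then show ?thesis using S(2) S'(2) that by simp
  qed
  define h where "h y = k (LEAST n. y \<in> U n) y" for y
  have h: "h y = k n y" if "y \<in> U n" for y n
    using eq[of "LEAST n. y \<in> U n" n y] that LeastI[of "\<lambda>n. y \<in> U n"] Least_le[of "\<lambda>n. y \<in> U n"]
    by (simp add: h_def)
  have "Adm (\<Union>n. U n) h"
  proof (rule adm_local)
    fix x assume "x \<in> (\<Union>n. U n)"
    then obtain n where "x \<in> U n" by blast
    moreover have "Adm (U n) h" by (rule adm_cong[OF k]) (simp add: h)
    ultimately show "\<exists>N. open N \<and> x \<in> N \<and> N \<subseteq> (\<Union>n. U n) \<and> Adm N h" using o by blast
  qed (use o in auto)
  then show ?thesis using o by (auto simp: good_def)
qed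

lemma good_halfspace:
  assumes c: "norm c = 1" and Om: "{x. 0 < c \<bullet> x} \<subseteq> Om"
  shows "good {x. 0 < c \<bullet> x}"
proof -
  \<comment> \<open>An exhaustion by convex sets, each contained in a compact convex subset of the
    half-space. The summand 2 puts the unit vector c into \<open>U 0\<close>.\<close>
  define U where "U n = ball 0 (real n + 2) \<inter> {x. 1 / (real n + 2) < c \<bullet> x}" for n
  have gU: "good (U n)" for n
  proof -
    define K where "K = cball 0 (real n + 2) \<inter> {x. 1 / (real n + 2) \<le> c \<bullet> x}"
    have "0 < 1 / (real n + 2)" by simp
    then have "K \<subseteq> {x. 0 < c \<bullet> x}" unfolding K_def using less_le_trans by blast
    then have "K \<subseteq> Om" using Om by blast
    moreover have "compact K" "convex K"
      by (auto simp: K_def intro!: compact_Int_closed closed_halfspace_ge convex_Int convex_halfspace_ge)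
    ultimately obtain e where e: "e > 0" "good (\<Union>x\<in>K. ball x e)"
      using good_compact_convex by blast
    have "U n \<subseteq> (\<Union>x\<in>K. ball x e)" using e by (force simp: U_def K_def intro: less_imp_le)
    moreover have "open (U n)" by (auto simp: U_def intro!: open_halfspace_gt)
    ultimately show ?thesis using good_subset[OF e(2)] by blast
  qed
  have "good (\<Union>n. U n)"
  proof (rule good_chain[OF gU])
    show "connected (U n)" for n
      by (auto simp: U_def intro!: convex_connected convex_Int convex_halfspace_gt)
    show "U m \<subseteq> U n" if "m \<le> n" for m n
    proof -
      have "1 / (real n + 2) \<le> 1 / (real m + 2)" using that by (simp add: frac_le)
      then show ?thesis using that by (auto simp: U_def)
    qed
    have "c \<in> U 0" using c by (simp add: U_def power2_norm_eq_inner[symmetric])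
    then show "U 0 \<noteq> {}" by blast
  qed
  also have "(\<Union>n. U n) = {x. 0 < c \<bullet> x}"
  proof (intro equalityI subsetI)
    fix x assume "x \<in> (\<Union>n. U n)"
    then obtain n where "1 / (real n + 2) < c \<bullet> x" by (auto simp: U_def)
    moreover have "0 < 1 / (real n + 2)" by simp
    ultimately have "0 < c \<bullet> x" by (rule less_trans[rotated])
    then show "x \<in> {x. 0 < c \<bullet> x}" by simp
  next
    fix x assume "x \<in> {x. 0 < c \<bullet> x}"
    then have x: "0 < c \<bullet> x" by simp
    obtain n :: nat where n: "real n > max (norm x) (1 / (c \<bullet> x))" using reals_Archimedean2 by blast
    have "1 / (real n + 2) < 1 / (1 / (c \<bullet> x))"
      using n x by (intro divide_strict_left_mono mult_pos_pos) auto
    then have "1 / (real n + 2) < c \<bullet> x" by simp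
    then show "x \<in> (\<Union>n. U n)" using n by (auto simp: U_def intro!: exI[of _ n])
  qed
  finally show ?thesis .
qed

end

section \<open>Quotients by contractions\<close>

lemma int_iterate_Suc: "bij f \<Longrightarrow> int_iterate f (k + 1) x = f (int_iterate f k x)"
proof (cases "0 \<le> k")
  case True
  then have "nat (k + 1) = Suc (nat k)" by simp
  then show ?thesis using True by (simp add: int_iterate_def)
next
  case False
  assume "bij f"
  have "nat (- k) = Suc (nat (- (k + 1)))" using False by simp
  then have "int_iterate f k x = inv_into UNIV f ((inv_into UNIV f ^^ nat (- (k + 1))) x)"
    using False by (simp add: int_iterate_def)
  moreover have "int_iterate f (k + 1) x = (inv_into UNIV f ^^ nat (- (k + 1))) x"
    using False by (cases "k = -1") (auto simp: int_iterate_def)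
  ultimately show ?thesis using \<open>bij f\<close> by (simp add: bij_is_surj surj_f_inv_f)
qed

lemma int_iterate_0: "int_iterate f 0 x = x"
  by (simp add: int_iterate_def)

lemma int_iterate_pred:
  assumes "bij f"
  shows "int_iterate f (k - 1) x = inv_into UNIV f (int_iterate f k x)"
  using int_iterate_Suc[OF assms, of "k - 1" x] bij_is_inj[OF assms] by simp

lemma int_iterate_add:
  assumes "bij f"
  shows "int_iterate f (j + k) x = int_iterate f j (int_iterate f k x)"
proof (induction j rule: int_induct[where k = 0])
  case base
  then show ?case by (simp add: int_iterate_0)
next
  case (step1 i)
  then show ?case using int_iterate_Suc[OF assms, of "i + k"] int_iterate_Suc[OF assms, of i]
    by (simp add: algebra_simps)
next
  case (step2 i)
  then show ?case using int_iterate_pred[OF assms, of "i + k"] int_iterate_pred[OF assms, of i]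
    by (simp add: algebra_simps)
qed

section \<open>The free and properly discontinuous action of a contraction\<close>

lemma open_punctured: "open punctured"
  by (simp add: punctured_def open_Compl)

lemma openin_punctured_top: "openin punctured_top S \<longleftrightarrow> open S \<and> S \<subseteq> punctured"
  by (simp add: openin_open_eq open_punctured)

text \<open>\<open>N\<close> is a Lyapunov function rather than a norm: for Hopf maps it has to
  dominate \<open>w ^ p * l\<close> and therefore involves a power of |w|. Freeness, disjoint
  translates and separation of orbits all follow from the fixed factor c.\<close>

locale contraction =
  fixes f :: "quat \<times> quat \<Rightarrow> quat \<times> quat" and N :: "quat \<times> quat \<Rightarrow> real" and c :: real
  assumes bij: "bij f" and cont: "continuous_on UNIV f" "continuous_on UNIV (inv_into UNIV f)"
    and f0: "f (0, 0) = (0, 0)"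
    and N_cont: "continuous_on UNIV N" and N_pos: "x \<noteq> (0, 0) \<Longrightarrow> 0 < N x"
    and c: "0 < c" "c < 1" and N_f: "N (f x) \<le> c * N x"
begin

abbreviation "fk \<equiv> int_iterate f"
abbreviation "\<Gamma> \<equiv> range (int_iterate f)"
abbreviation "\<pi> \<equiv> orbit_proj \<Gamma>"
abbreviation "X \<equiv> orbit_space \<Gamma>"

lemmas fk_add = int_iterate_add[OF bij] and fk_0 = int_iterate_0[of f]

lemma fk_minus: "fk (- k) (fk k x) = x" "fk k (fk (- k) x) = x"
  using fk_add[of "- k" k x] fk_add[of k "- k" x] by (simp_all add: fk_0)

lemma fk_cont: "continuous_on S (fk k)"
proof -
  have "continuous_on UNIV (g ^^ n)" if "continuous_on UNIV g" for g :: "quat \<times> quat \<Rightarrow> quat \<times> quat" and n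
  proof (induction n)
    case (Suc n)
    then show ?case using continuous_on_compose[OF Suc] that continuous_on_subset
      by (metis funpow.simps(2) subset_UNIV)
  qed (simp add: continuous_on_id id_def)
  then have "continuous_on UNIV (fk k)"
    using cont by (auto simp: int_iterate_def[abs_def])
  then show ?thesis by (rule continuous_on_subset) simp
qed

lemma fk_image: "fk k ` U = fk (- k) -` U"
  using fk_minus by (auto simp: image_iff) metis

lemma fk_open: "open U \<Longrightarrow> open (fk k ` U)"
  unfolding fk_image by (rule open_vimage) (auto intro: fk_cont)

lemma fk_00: "fk k (0, 0) = (0, 0)"
proof -
  have "inv_into UNIV f (0, 0) = (0, 0)" using f0 bij by (metis bij_inv_eq_iff)
  then have "(inv_into UNIV f ^^ n) (0, 0) = (0, 0)" "(f ^^ n) (0, 0) = (0, 0)" for n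
    using f0 by (induction n) auto
  then show ?thesis by (simp add: int_iterate_def)
qed

lemma fk_punctured_iff: "fk k x \<in> punctured \<longleftrightarrow> x \<in> punctured"
  unfolding punctured_def using fk_00 fk_minus by (metis ComplD ComplI singleton_iff)

text \<open>At the origin the sign comes from continuity, as \<open>N\<close> is positive at all
  other points.\<close>

lemma N_nonneg: "0 \<le> N x"
proof (cases "x = (0, 0)")
  case True
  have "N (0, 0) \<le> c * N (0, 0)" using N_f[of "(0, 0)"] f0 by simp
  show ?thesis
  proof (rule ccontr)
    assume neg: "\<not> ?thesis"
    then have "N (0, 0) < 0" using True by simp
    then obtain e where e: "e > 0" "\<And>y. dist y (0, 0) < e \<Longrightarrow> dist (N y) (N (0, 0)) < - N (0, 0)"
      using N_cont unfolding continuous_on_iff by (metis UNIV_I neg_0_less_iff_less)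
    have "dist (of_real (e / 2), 0) (0 :: quat, 0 :: quat) < e" using e(1) by (simp add: dist_Pair_Pair del: of_real_divide)
    then have "dist (N (of_real (e / 2), 0)) (N (0, 0)) < - N (0, 0)" by (rule e(2))
    moreover have "0 < N (of_real (e / 2), 0)" using e(1) by (intro N_pos) simp
    ultimately show False unfolding dist_real_def by linarith
  qed
next
  case False
  then show ?thesis using N_pos[OF False] by simp
qed

lemma N_fk: "0 \<le> k \<Longrightarrow> N (fk k x) \<le> c ^ nat k * N x"
proof (induction k rule: int_ge_induct)
  case base
  then show ?case by (simp add: fk_0)
next
  case (step k)
  have "N (fk (k + 1) x) \<le> c * N (fk k x)"
    using N_f[of "fk k x"] by (simp add: int_iterate_Suc[OF bij])
  also have "\<dots> \<le> c * (c ^ nat k * N x)" using step c by simp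
  also have "\<dots> = c ^ nat (k + 1) * N x" using step by (simp add: nat_add_distrib)
  finally show ?case .
qed

lemma N_fk_less: "0 < k \<Longrightarrow> N (fk k x) \<le> c * N x"
proof -
  assume "0 < k"
  then have "N (fk k x) \<le> c ^ nat k * N x" by (intro N_fk) simp
  also have "c ^ nat k \<le> c ^ 1" using c \<open>0 < k\<close> by (intro power_decreasing) auto
  then have "c ^ nat k * N x \<le> c * N x" using N_nonneg[of x] by (intro mult_right_mono) auto
  finally show ?thesis .
qed

text \<open>An iterate with positive exponent strictly decreases \<open>N\<close>, so it has no
  fixed point off the origin.\<close>

lemma fk_free:
  assumes x: "x \<in> punctured" and eq: "fk j x = fk k x"
  shows "j = k"
proof -
  have *: False if "j < k" "fk j x = fk k x" for j k
  proof -
    define y where "y = fk j x"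
    have "y = fk (k - j) y" using that fk_add[of "k - j" j x] by (simp add: y_def)
    then have "N y \<le> c * N y" using N_fk_less[of "k - j" y] that by simp
    moreover have "0 < N y"
      using fk_punctured_iff[of j x] x by (auto simp: y_def punctured_def intro: N_pos)
    ultimately show False using c by simp
  qed
  show ?thesis using *[of j k] *[of k j] eq by (cases j k rule: linorder_cases) auto
qed

lemma proj_eq: "\<pi> x = \<pi> y \<longleftrightarrow> (\<exists>k. y = fk k x)"
proof
  assume "\<pi> x = \<pi> y"
  moreover have "y \<in> \<pi> y" unfolding orbit_proj_def using fk_0[of y] by (metis (mono_tags, lifting) mem_Collect_eq rangeI)
  ultimately show "\<exists>k. y = fk k x" unfolding orbit_proj_def by auto
next
  assume "\<exists>k. y = fk k x"
  then obtain k where k: "y = fk k x" ..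
  have "{g x | g. g \<in> \<Gamma>} = {g y | g. g \<in> \<Gamma>}"
  proof (intro equalityI subsetI)
    fix z assume "z \<in> {g x | g. g \<in> \<Gamma>}"
    then obtain j where "z = fk j x" by auto
    then have "z = fk (j - k) y" using fk_add[of "j - k" k x] k by simp
    then show "z \<in> {g y | g. g \<in> \<Gamma>}" by blast
  next
    fix z assume "z \<in> {g y | g. g \<in> \<Gamma>}"
    then obtain j where "z = fk j y" by auto
    then have "z = fk (j + k) x" using fk_add[of j k x] k by simp
    then show "z \<in> {g x | g. g \<in> \<Gamma>}" by blast
  qed
  then show "\<pi> x = \<pi> y" by (simp add: orbit_proj_def)
qed

lemma proj_fk [simp]: "\<pi> (fk k x) = \<pi> x"
  using proj_eq[of x "fk k x"] by auto

definition shell :: "real \<Rightarrow> real \<Rightarrow> (quat \<times> quat) set" where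
  "shell r R = {x. r < N x \<and> N x < R}"

lemma open_shell: "open (shell r R)"
  unfolding shell_def by (intro open_Collect_conj open_Collect_less N_cont continuous_intros)

lemma shell_disjoint:
  assumes "c * R \<le> r" "x \<in> shell r R" "fk k x \<in> shell r R"
  shows "k = 0"
proof -
  have *: False if "0 < k" "x \<in> shell r R" "fk k x \<in> shell r R" for k x
  proof -
    have "N (fk k x) \<le> c * N x" using N_fk_less that by simp
    also have "\<dots> \<le> c * R" using that c by (simp add: shell_def)
    finally show False using that assms(1) by (simp add: shell_def)
  qed
  show ?thesis
    using *[of k x] *[of "- k" "fk k x"] assms fk_minus(1)[of k x]
    by (cases k "0::int" rule: linorder_cases) simp_all
qed

lemma inj_on_shell: "c * R \<le> r \<Longrightarrow> inj_on \<pi> (shell r R)"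
proof (rule inj_onI)
  fix x y assume *: "c * R \<le> r" "x \<in> shell r R" "y \<in> shell r R" "\<pi> x = \<pi> y"
  then obtain k where "y = fk k x" using proj_eq by blast
  then show "x = y" using shell_disjoint[of R r x k] * fk_0 by simp
qed

lemma shell_punctured: "0 \<le> r \<Longrightarrow> shell r R \<subseteq> punctured"
proof
  fix x assume "0 \<le> r" "x \<in> shell r R"
  then have "N x > 0" by (simp add: shell_def)
  moreover have "N (0, 0) \<le> 0"
  proof -
    have "(1 - c) * N (0, 0) \<le> 0" using N_f[of "(0, 0)"] f0 by (simp add: algebra_simps)
    then show ?thesis using c by (simp add: mult_le_0_iff)
  qed
  ultimately show "x \<in> punctured" by (auto simp: punctured_def)
qed

lemma shell_exists:
  assumes "x \<in> punctured"
  shows "\<exists>r R. 0 < r \<and> c * R \<le> r \<and> x \<in> shell r R"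
proof -
  have Nx: "0 < N x" using assms N_pos by (auto simp: punctured_def)
  \<comment> \<open>The radii \<open>s * N x\<close> and \<open>N x / s\<close> lie on both sides of
    \<open>N x\<close> and have ratio exactly c, the largest ring that \<open>shell_disjoint\<close>
    admits.\<close>
  define s where "s = sqrt c"
  have s: "0 < s" "s < 1" "s * s = c" using c by (auto simp: s_def real_sqrt_lt_1_iff)
  have "s * N x < N x" using s Nx by simp
  moreover have "N x < N x / s" using s Nx by (simp add: field_simps)
  moreover have "c * (N x / s) = s * N x" using s by (simp add: s(3)[symmetric])
  ultimately show ?thesis
    using s Nx by (intro exI[of _ "s * N x"] exI[of _ "N x / s"]) (auto simp: shell_def)
qed

section \<open>Topology of the quotient and the covering map\<close>

lemma topspace_X: "topspace X = \<pi> ` punctured"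
  by (simp add: orbit_space_def topspace_quotient_topology)

lemma openin_X: "openin X U \<longleftrightarrow> U \<subseteq> \<pi> ` punctured \<and> open {x \<in> punctured. \<pi> x \<in> U}"
  by (auto simp: orbit_space_def openin_quotient_topology openin_punctured_top)

lemma preimage_image: "{x. \<pi> x \<in> \<pi> ` U} = (\<Union>k. fk k ` U)"
proof (intro equalityI subsetI)
  fix x assume "x \<in> {x. \<pi> x \<in> \<pi> ` U}"
  then obtain u where "u \<in> U" "\<pi> u = \<pi> x" by auto
  then show "x \<in> (\<Union>k. fk k ` U)" using proj_eq[of u x] by auto
qed auto

lemma open_preimage: "open U \<Longrightarrow> open {x. \<pi> x \<in> \<pi> ` U}"
  unfolding preimage_image using fk_open by blast

lemma open_image:
  assumes "open U" "U \<subseteq> punctured"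
  shows "openin X (\<pi> ` U)"
proof -
  have "{x \<in> punctured. \<pi> x \<in> \<pi> ` U} = punctured \<inter> {x. \<pi> x \<in> \<pi> ` U}" by auto
  then show ?thesis unfolding openin_X using open_preimage[OF assms(1)] assms open_punctured by auto
qed

lemma proj_continuous: "continuous_map punctured_top X \<pi>"
  unfolding orbit_space_def by (intro quotient_imp_continuous_map quotient_map_quotient_topology)

lemma proj_open_map: "open_map punctured_top X \<pi>"
  unfolding open_map_def by (auto simp: openin_punctured_top open_image)

lemma homeomorphic_proj:
  assumes V: "open V" "V \<subseteq> punctured" "inj_on \<pi> V"
  shows "homeomorphic_map (subtopology punctured_top V) (subtopology X (\<pi> ` V)) \<pi>"
proof -
  have s: "subtopology punctured_top V = top_of_set V"
    using V by (simp add: subtopology_subtopology Int_absorb1)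
  have t: "topspace (subtopology X (\<pi> ` V)) = \<pi> ` V"
    using V by (auto simp: topspace_X)
  show ?thesis unfolding s
  proof (rule bijective_open_imp_homeomorphic_map)
    have "continuous_map (top_of_set V) X \<pi>"
      using continuous_map_from_subtopology[OF proj_continuous, of V] s by simp
    then show "continuous_map (top_of_set V) (subtopology X (\<pi> ` V)) \<pi>"
      by (simp add: continuous_map_in_subtopology)
    show "open_map (top_of_set V) (subtopology X (\<pi> ` V)) \<pi>"
      unfolding open_map_def
    proof (intro allI impI)
      fix W assume "openin (top_of_set V) W"
      then have W: "open W" "W \<subseteq> V" using V by (auto simp: openin_open_eq)
      then have "openin X (\<pi> ` W)" using open_image V by blast
      then show "openin (subtopology X (\<pi> ` V)) (\<pi> ` W)"
        unfolding openin_subtopology using W by (intro exI[of _ "\<pi> ` W"]) auto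
    qed
  qed (use V t in auto)
qed

lemma homeomorphic_section:
  assumes V: "open V" "V \<subseteq> punctured" "inj_on \<pi> V"
  shows "homeomorphic_map (subtopology X (\<pi> ` V)) (top_of_set V) (inv_into V \<pi>)"
proof -
  have s: "subtopology punctured_top V = top_of_set V"
    using V by (simp add: subtopology_subtopology Int_absorb1)
  obtain g where g: "homeomorphic_maps (top_of_set V) (subtopology X (\<pi> ` V)) \<pi> g"
    using homeomorphic_proj[OF V] unfolding s homeomorphic_map_maps by blast
  then have "homeomorphic_map (subtopology X (\<pi> ` V)) (top_of_set V) g"
    using homeomorphic_maps_map by blast
  moreover have "g y = inv_into V \<pi> y" if y: "y \<in> topspace (subtopology X (\<pi> ` V))" for y
  proof -
    have "y \<in> \<pi> ` V" using y by simp
    then obtain v where v: "v \<in> V" "y = \<pi> v" by (rule imageE)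
    then show ?thesis using g V(3) by (auto simp: homeomorphic_maps_def)
  qed
  ultimately show ?thesis by (rule homeomorphic_map_eq)
qed

text \<open>The common source of the local formulas for changes of charts and for the projection. No
  continuity of g is assumed: as soon as \<open>fk k y\<close> lies in W, injectivity of the
  projection on W forces \<open>g y = fk k y\<close>.\<close>

lemma deck_local:
  assumes V: "open V" and W: "open W" "inj_on \<pi> W"
    and g: "\<And>y. y \<in> V \<Longrightarrow> g y \<in> W" "\<And>y. y \<in> V \<Longrightarrow> \<pi> (g y) = \<pi> y" and x: "x \<in> V"
  shows "\<exists>M k. open M \<and> x \<in> M \<and> M \<subseteq> V \<and> (\<forall>y\<in>M. g y = fk k y)"
proof -
  obtain k where k: "g x = fk k x" using g(2)[OF x] proj_eq by metis
  have "open (fk k -` W)" using W fk_cont by (intro open_vimage) auto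
  moreover have "g y = fk k y" if "y \<in> V" "fk k y \<in> W" for y
    using inj_onD[OF W(2), of "g y" "fk k y"] g that by simp
  ultimately show ?thesis
    using V x g(1)[OF x] k by (intro exI[of _ "V \<inter> fk k -` W"] exI[of _ k]) auto
qed

text \<open>Of the translates of a shell around x, only those with k in a finite set
  \<open>K\<close> can meet a given shell around y, since \<open>N\<close> contracts geometrically.
  The orbits are thus separated by finitely many pairs of neighbourhoods, one for each k in
  \<open>K\<close>, intersected with the shells.\<close>

lemma Hausdorff_X: "Hausdorff_space X"
  unfolding Hausdorff_space_def
proof (intro allI impI)
  fix p q assume "p \<in> topspace X \<and> q \<in> topspace X \<and> p \<noteq> q"
  then have pq: "p \<in> \<pi> ` punctured" "q \<in> \<pi> ` punctured" "p \<noteq> q" by (simp_all add: topspace_X)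
  from pq(1) obtain x where x: "x \<in> punctured" "p = \<pi> x" by (rule imageE)
  from pq(2) obtain y where y: "y \<in> punctured" "q = \<pi> y" by (rule imageE)
  have xy: "x \<in> punctured" "y \<in> punctured" "p = \<pi> x" "q = \<pi> y" "\<pi> x \<noteq> \<pi> y"
    using x y pq(3) by simp_all
  obtain r R where r: "0 < r" "c * R \<le> r" "x \<in> shell r R" using shell_exists xy by blast
  obtain r' R' where r': "0 < r'" "c * R' \<le> r'" "y \<in> shell r' R'" using shell_exists xy by blast
  have "(\<lambda>n. c ^ n * R) \<longlonglongrightarrow> 0 * R" "(\<lambda>n. c ^ n * R') \<longlonglongrightarrow> 0 * R'"
    using c by (intro tendsto_mult LIMSEQ_power_zero tendsto_const; simp)+
  then have lim: "(\<lambda>n. c ^ n * R) \<longlonglongrightarrow> 0" "(\<lambda>n. c ^ n * R') \<longlonglongrightarrow> 0" by simp_all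
  have "\<forall>\<^sub>F n in sequentially. c ^ n * R < r' \<and> c ^ n * R' < r"
    using order_tendstoD(2)[OF lim(1) r'(1)] order_tendstoD(2)[OF lim(2) r(1)]
    by (rule eventually_conj)
  then obtain n where n: "\<And>m. m \<ge> n \<Longrightarrow> c ^ m * R < r' \<and> c ^ m * R' < r"
    unfolding eventually_sequentially by blast
  define K where "K = {- int n .. int n}"
  have far: "fk k u \<notin> shell r' R'" if "u \<in> shell r R" "k \<notin> K" for u k
  proof (cases "k > 0")
    case True
    then have k: "nat k \<ge> n" using that by (auto simp: K_def)
    have "N (fk k u) \<le> c ^ nat k * N u" using True by (intro N_fk) simp
    also have "\<dots> \<le> c ^ nat k * R" using that c by (simp add: shell_def)
    also have "\<dots> < r'" using n[OF k] by simp
    finally show ?thesis by (simp add: shell_def)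
  next
    case False
    show ?thesis
    proof
      assume v: "fk k u \<in> shell r' R'"
      have k: "nat (- k) \<ge> n" using that False by (auto simp: K_def)
      have "N u \<le> c ^ nat (- k) * N (fk k u)"
        using N_fk[of "- k" "fk k u"] fk_minus False by simp
      also have "\<dots> \<le> c ^ nat (- k) * R'" using v c by (simp add: shell_def)
      also have "\<dots> < r" using n[OF k] by simp
      finally show False using that by (simp add: shell_def)
    qed
  qed
  have "\<exists>A B. open A \<and> open B \<and> x \<in> A \<and> y \<in> B \<and> fk k ` A \<inter> B = {}" for k
  proof -
    have "fk k x \<noteq> y" using xy(5) proj_fk by metis
    then obtain A B where AB: "open A" "open B" "fk k x \<in> A" "y \<in> B" "A \<inter> B = {}"
      by (metis hausdorff)
    then have "open (fk k -` A)" using fk_cont by (intro open_vimage) auto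
    then show ?thesis using AB by (intro exI[of _ "fk k -` A"] exI[of _ B]) auto
  qed
  then obtain A B where AB: "\<And>k. open (A k)" "\<And>k. open (B k)" "\<And>k. x \<in> A k" "\<And>k. y \<in> B k"
    "\<And>k. fk k ` A k \<inter> B k = {}" by metis
  define U where "U = shell r R \<inter> (\<Inter>k\<in>K. A k)"
  define W where "W = shell r' R' \<inter> (\<Inter>k\<in>K. B k)"
  have fin: "finite K" by (simp add: K_def)
  have oU: "open U" "open W" unfolding U_def W_def using fin AB open_shell by (auto intro!: open_Int open_INT)
  have sub: "U \<subseteq> punctured" "W \<subseteq> punctured"
    using shell_punctured[of r R] shell_punctured[of r' R'] r r' by (auto simp: U_def W_def)
  have "\<pi> ` U \<inter> \<pi> ` W = {}"
  proof (rule ccontr)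
    assume "\<not> ?thesis"
    then obtain u w where uw: "u \<in> U" "w \<in> W" "\<pi> u = \<pi> w" by auto
    then obtain k where k: "w = fk k u" using proj_eq by blast
    then have "k \<in> K" using far[of u k] uw by (auto simp: U_def W_def)
    then have "fk k u \<in> fk k ` A k \<inter> B k" using uw k by (auto simp: U_def W_def)
    then show False using AB by blast
  qed
  moreover have "x \<in> U" "y \<in> W" using r r' AB by (auto simp: U_def W_def)
  ultimately show "\<exists>U V. openin X U \<and> openin X V \<and> p \<in> U \<and> q \<in> V \<and> disjnt U V"
    using open_image[OF oU(1) sub(1)] open_image[OF oU(2) sub(2)] xy
    by (intro exI[of _ "\<pi> ` U"] exI[of _ "\<pi> ` W"]) (auto simp: disjnt_def)
qed

lemma second_countable_X: "second_countable X"
proof (rule second_countable_open_map_image[OF proj_continuous proj_open_map])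
  show "second_countable punctured_top"
  proof -
    obtain B :: "(quat \<times> quat) set set" where B: "countable B" "topological_basis B"
      using ex_countable_basis by blast
    have "second_countable (euclidean :: (quat \<times> quat) topology)"
      unfolding second_countable_def
    proof (intro exI[of _ B] conjI ballI allI impI)
      fix V assume "V \<in> B" then show "openin euclidean V" using B topological_basis_open by auto
    next
      fix U and x :: "quat \<times> quat" assume "openin euclidean U \<and> x \<in> U"
      then show "\<exists>V\<in>B. x \<in> V \<and> V \<subseteq> U" using topological_basisE[OF B(2)] by (metis open_openin)
    qed (rule B)
    then show ?thesis by (rule second_countable_subtopology)
  qed
qed (simp add: topspace_X)

lemma covering_X: "covering_map punctured_top X \<pi>"
  unfolding covering_map_def
proof (intro conjI ballI)
  fix q assume "q \<in> topspace X"
  then obtain x where x: "x \<in> punctured" "q = \<pi> x" by (auto simp: topspace_X)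
  obtain r R where r: "0 < r" "c * R \<le> r" "x \<in> shell r R" using shell_exists x by blast
  let ?V = "shell r R"
  have V: "open ?V" "?V \<subseteq> punctured" "inj_on \<pi> ?V"
    using open_shell shell_punctured r inj_on_shell by auto
  have sheet: "open (fk k ` ?V)" "fk k ` ?V \<subseteq> punctured" "inj_on \<pi> (fk k ` ?V)" "\<pi> ` fk k ` ?V = \<pi> ` ?V" for k
    using V fk_open fk_punctured_iff by (auto simp: inj_on_def image_comp)
  show "\<exists>T. q \<in> T \<and> openin X T \<and> (\<exists>\<V>. \<Union>\<V> = topspace punctured_top \<inter> \<pi> -` T \<and>
      (\<forall>U\<in>\<V>. openin punctured_top U) \<and> pairwise disjnt \<V> \<and>
      (\<forall>U\<in>\<V>. homeomorphic_map (subtopology punctured_top U) (subtopology X T) \<pi>))"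
  proof (rule exI[of _ "\<pi> ` ?V"], intro conjI, goal_cases)
    case 3
    show ?case
  proof (intro exI[of _ "range (\<lambda>k. fk k ` ?V)"] conjI ballI)
    have "(\<Union>k. fk k ` ?V) \<subseteq> punctured" using sheet(2) by blast
    moreover have "{x. \<pi> x \<in> \<pi> ` ?V} = \<pi> -` \<pi> ` ?V" by auto
    ultimately show "\<Union> (range (\<lambda>k. fk k ` ?V)) = topspace punctured_top \<inter> \<pi> -` \<pi> ` ?V"
      using preimage_image[of ?V] by auto
    show "pairwise disjnt (range (\<lambda>k. fk k ` ?V))"
    proof (rule pairwiseI)
      fix A B assume "A \<in> range (\<lambda>k. fk k ` ?V)" "B \<in> range (\<lambda>k. fk k ` ?V)" "A \<noteq> B"
      then obtain j k where jk: "A = fk j ` ?V" "B = fk k ` ?V" "j \<noteq> k" by auto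
      show "disjnt A B"
      proof (rule ccontr)
        assume "\<not> disjnt A B"
        then obtain z where z: "z \<in> fk j ` ?V" "z \<in> fk k ` ?V" using jk unfolding disjnt_def by blast
        from z(1) obtain u where u: "u \<in> ?V" "z = fk j u" by blast
        from z(2) obtain v where v: "v \<in> ?V" "z = fk k v" by blast
        have uv: "u \<in> ?V" "v \<in> ?V" "fk j u = fk k v" using u v by simp_all
        then have "fk (- k + j) u = v" using fk_add[of "- k" j u] fk_minus by simp
        then have "fk (- k + j) u \<in> ?V" using uv(2) by (simp only:)
        then have "- k + j = 0" by (rule shell_disjoint[OF r(2) uv(1)])
        then show False using jk by simp
      qed
    qed
    fix U assume "U \<in> range (\<lambda>k. fk k ` ?V)"
    then obtain k where U: "U = fk k ` ?V" by auto
    show "openin punctured_top U" using sheet(1,2) by (simp add: openin_punctured_top U)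
    show "homeomorphic_map (subtopology punctured_top U) (subtopology X (\<pi> ` ?V)) \<pi>"
      using homeomorphic_proj[OF sheet(1-3)] sheet(4) by (simp add: U)
  qed
  qed (use x r open_image V in auto)
qed (use proj_continuous topspace_X in auto)

end

section \<open>The induced slice-quaternionic structure\<close>

lemma Ball_case_prod_iff: "(\<forall>(U, \<phi>)\<in>S. Q U \<phi>) \<longleftrightarrow> (\<forall>U \<phi>. (U, \<phi>) \<in> S \<longrightarrow> Q U \<phi>)"
  by auto

locale slice_contraction = contraction +
  assumes regular: "slice_regular_map UNIV (int_iterate f k)"
    and circular_shell: "circular (shell r R)"
begin

abbreviation "\<A> \<equiv> orbit_atlas \<Gamma>"

text \<open>The iterates are slice regular on the whole space, so \<open>UNIV\<close> serves as
  circular domain at every point, whatever the shape of V.\<close>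

lemma regular_on_deck:
  assumes "\<And>x. x \<in> V \<Longrightarrow> \<exists>M k. open M \<and> x \<in> M \<and> M \<subseteq> V \<and> (\<forall>y\<in>M. g y = fk k y)"
  shows "slice_regular_on V g"
  unfolding slice_regular_on_def
proof
  fix x assume "x \<in> V"
  from assms[OF this] obtain M k where "open M" "x \<in> M" "M \<subseteq> V" "\<forall>y\<in>M. g y = fk k y" by blast
  then show "\<exists>N D h. open N \<and> x \<in> N \<and> N \<subseteq> V \<and> slice_regular_map D h \<and> N \<subseteq> circular_set D \<and> (\<forall>y\<in>N. g y = h y)"
    using regular[of k] by (intro exI[of _ M] exI[of _ UNIV] exI[of _ "fk k"]) (auto simp: circular_set_UNIV)
qed

lemma inv_into_punctured_id: "y \<in> punctured \<Longrightarrow> inv_into punctured id y = y"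
  by (metis id_apply inj_on_id inv_into_f_f)

lemma fk_in_Aut: "fk k \<in> slice_Aut punctured_top punctured_atlas"
proof -
  have bb: "bij_betw (fk k) punctured punctured" for k
    by (rule bij_betwI[where g = "fk (- k)"]) (auto simp: fk_punctured_iff fk_minus)
  have sm: "slice_map punctured_top punctured_atlas punctured_top punctured_atlas g"
    if g: "\<And>x. x \<in> punctured \<Longrightarrow> g x = fk k x" for g k
  proof -
    have "continuous_on punctured g" using fk_cont[of punctured k] g by (simp cong: continuous_on_cong)
    then have "continuous_map punctured_top punctured_top g"
      using g fk_punctured_iff by auto
    moreover have "slice_regular_on (id ` (punctured \<inter> g -` punctured)) (id \<circ> g \<circ> inv_into punctured id)"
    proof (rule regular_on_deck)
      fix x assume "x \<in> id ` (punctured \<inter> g -` punctured)"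
      then show "\<exists>M k. open M \<and> x \<in> M \<and> M \<subseteq> id ` (punctured \<inter> g -` punctured) \<and>
          (\<forall>y\<in>M. (id \<circ> g \<circ> inv_into punctured id) y = fk k y)"
        using g fk_punctured_iff
        by (intro exI[of _ punctured] exI[of _ k]) (auto simp: open_punctured inv_into_punctured_id)
    qed
    ultimately show ?thesis by (simp add: slice_map_def punctured_atlas_def)
  qed
  have "inv_into punctured (fk k) x = fk (- k) x" if "x \<in> punctured" for x
    using inv_into_f_f[OF bij_betw_imp_inj_on[OF bb[of k]], of "fk (- k) x"] that
    by (simp add: fk_punctured_iff fk_minus)
  then show ?thesis using bb sm[of "fk k" k] sm[of "inv_into punctured (fk k)" "- k"]
    by (simp add: slice_Aut_def)
qed

lemma in_atlas: "(U, \<phi>) \<in> \<A> \<longleftrightarrow> (\<exists>V. U = \<pi> ` V \<and> \<phi> = inv_into V \<pi> \<and> V \<subseteq> punctured \<and> circular V \<and> inj_on \<pi> V)"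
  by (auto simp: orbit_atlas_def)

lemma section_image:
  assumes "inj_on \<pi> V"
  shows "inv_into V \<pi> ` (\<pi> ` V \<inter> S) = {v \<in> V. \<pi> v \<in> S}"
  using assms by (force simp: image_iff inv_into_f_f)

lemma inv_section:
  assumes "inj_on \<pi> V" "v \<in> V"
  shows "inv_into (\<pi> ` V) (inv_into V \<pi>) v = \<pi> v"
proof -
  have "inj_on (inv_into V \<pi>) (\<pi> ` V)" by (simp add: inj_on_inv_into)
  moreover have "inv_into V \<pi> (\<pi> v) = v" using assms by simp
  ultimately show ?thesis using assms(2) by (metis imageI inv_into_f_f)
qed

lemma proj_section: "y \<in> \<pi> ` W \<Longrightarrow> inv_into W \<pi> y \<in> W \<and> \<pi> (inv_into W \<pi> y) = y"
  by (simp add: inv_into_into f_inv_into_f)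

lemma section_deck:
  assumes V: "open V" "inj_on \<pi> V" and W: "open W" "inj_on \<pi> W"
    and x: "x \<in> inv_into V \<pi> ` (\<pi> ` V \<inter> \<pi> ` W)"
  shows "\<exists>M k. open M \<and> x \<in> M \<and> M \<subseteq> inv_into V \<pi> ` (\<pi> ` V \<inter> \<pi> ` W) \<and>
    (\<forall>y\<in>M. (inv_into W \<pi> \<circ> inv_into (\<pi> ` V) (inv_into V \<pi>)) y = fk k y)"
proof (rule deck_local[OF _ W _ _ x])
  have "inv_into V \<pi> ` (\<pi> ` V \<inter> \<pi> ` W) = V \<inter> {x. \<pi> x \<in> \<pi> ` W}"
    unfolding section_image[OF V(2)] by auto
  then show "open (inv_into V \<pi> ` (\<pi> ` V \<inter> \<pi> ` W))" using V open_preimage[OF W(1)] by auto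
  fix y assume y: "y \<in> inv_into V \<pi> ` (\<pi> ` V \<inter> \<pi> ` W)"
  then show "(inv_into W \<pi> \<circ> inv_into (\<pi> ` V) (inv_into V \<pi>)) y \<in> W"
    "\<pi> ((inv_into W \<pi> \<circ> inv_into (\<pi> ` V) (inv_into V \<pi>)) y) = \<pi> y"
    using proj_section[of "\<pi> y" W] inv_section[OF V(2), of y] unfolding section_image[OF V(2)] by simp_all
qed

lemma section_regular:
  assumes "open V" "inj_on \<pi> V" "open W" "inj_on \<pi> W"
  shows "slice_regular_on (inv_into V \<pi> ` (\<pi> ` V \<inter> \<pi> ` W)) (inv_into W \<pi> \<circ> inv_into (\<pi> ` V) (inv_into V \<pi>))"
  by (rule regular_on_deck[OF section_deck[OF assms]])

lemma proj_slice_map: "slice_map punctured_top punctured_atlas X \<A> \<pi>"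
proof -
  have "slice_regular_on (id ` (punctured \<inter> \<pi> -` U)) (\<phi> \<circ> \<pi> \<circ> inv_into punctured id)"
    if "(U, \<phi>) \<in> \<A>" for U \<phi>
  proof (rule regular_on_deck)
    from that obtain W where W: "U = \<pi> ` W" "\<phi> = inv_into W \<pi>" "circular W" "inj_on \<pi> W"
      unfolding in_atlas by blast
    fix x assume x: "x \<in> id ` (punctured \<inter> \<pi> -` U)"
    show "\<exists>M k. open M \<and> x \<in> M \<and> M \<subseteq> id ` (punctured \<inter> \<pi> -` U) \<and>
        (\<forall>y\<in>M. (\<phi> \<circ> \<pi> \<circ> inv_into punctured id) y = fk k y)"
    proof (rule deck_local[OF _ circular_imp_open[OF W(3)] W(4) _ _ x])
      have "id ` (punctured \<inter> \<pi> -` U) = punctured \<inter> {x. \<pi> x \<in> \<pi> ` W}" using W by auto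
      then show "open (id ` (punctured \<inter> \<pi> -` U))"
        using open_punctured open_preimage[OF circular_imp_open[OF W(3)]] by auto
    next
      fix y assume "y \<in> id ` (punctured \<inter> \<pi> -` U)"
      then have y: "y \<in> punctured" "\<pi> y \<in> \<pi> ` W" using W by auto
      show "(\<phi> \<circ> \<pi> \<circ> inv_into punctured id) y \<in> W"
        using y proj_section[of "\<pi> y" W] W(2) by (simp add: inv_into_punctured_id)
      show "\<pi> ((\<phi> \<circ> \<pi> \<circ> inv_into punctured id) y) = \<pi> y"
        using y proj_section[of "\<pi> y" W] W(2) by (simp add: inv_into_punctured_id)
    qed
  qed
  then show ?thesis
    using proj_continuous unfolding slice_map_def punctured_atlas_def by auto
qed

lemma atlas_regular:
  assumes "(U, \<phi>) \<in> \<A>" "(V, \<psi>) \<in> \<A>"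
  shows "slice_regular_on (\<phi> ` (U \<inter> V)) (\<psi> \<circ> inv_into U \<phi>)"
  using assms section_regular circular_imp_open unfolding in_atlas by blast

lemma slice_atlas_X: "slice_atlas X \<A>"
  unfolding slice_atlas_def Ball_case_prod_iff
proof (intro conjI allI impI atlas_regular)
  fix U \<phi> assume "(U, \<phi>) \<in> \<A>"
  then obtain W where W: "U = \<pi> ` W" "\<phi> = inv_into W \<pi>" "W \<subseteq> punctured" "circular W" "inj_on \<pi> W"
    unfolding in_atlas by blast
  have im: "\<phi> ` U = W" using W(5) by (simp add: W(1,2) inv_into_image_cancel)
  have o: "open W" using W circular_imp_open by blast
  show "chart_on X (U, \<phi>)" unfolding chart_on_def prod.case im
    using open_image[OF o W(3)] homeomorphic_section[OF o W(3,5)] o W(1,2) by simp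
  show "circular (\<phi> ` U)" using im W(4) by simp
next
  show "(\<Union>(U, \<phi>)\<in>\<A>. U) = topspace X"
  proof (intro equalityI subsetI)
    fix q assume "q \<in> (\<Union>(U, \<phi>)\<in>\<A>. U)"
    then obtain U \<phi> where "(U, \<phi>) \<in> \<A>" "q \<in> U" by auto
    then show "q \<in> topspace X" unfolding in_atlas topspace_X by blast
  next
    fix q assume "q \<in> topspace X"
    then have "q \<in> \<pi> ` punctured" by (simp add: topspace_X)
    then obtain x where x: "x \<in> punctured" "q = \<pi> x" by blast
    obtain r R where r: "0 < r" "c * R \<le> r" "x \<in> shell r R" using shell_exists x by blast
    have "(\<pi> ` shell r R, inv_into (shell r R) \<pi>) \<in> \<A>"
      unfolding in_atlas using shell_punctured[of r R] r inj_on_shell circular_shell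
      by (intro exI[of _ "shell r R"]) auto
    then show "q \<in> (\<Union>(U, \<phi>)\<in>\<A>. U)" using x r by blast
  qed
qed

lemma slice_covering_X: "slice_covering X \<A> \<pi>"
  unfolding slice_covering_def Ball_case_prod_iff
proof (intro conjI allI impI covering_X proj_slice_map)
  fix U V \<psi> assume U: "open U \<and> U \<subseteq> punctured \<and> inj_on \<pi> U" and V: "(V, \<psi>) \<in> \<A>"
  from V obtain W where "V = \<pi> ` W" "\<psi> = inv_into W \<pi>" "circular W" "inj_on \<pi> W"
    unfolding in_atlas by blast
  then show "slice_regular_on (\<psi> ` (V \<inter> \<pi> ` U)) (inv_into U \<pi> \<circ> inv_into V \<psi>)"
    using section_regular[of W U] U circular_imp_open by blast
qed

lemma slice_manifold_X: "slice_manifold X \<A>"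
  by (simp add: slice_manifold_def Hausdorff_X second_countable_X slice_atlas_X)

lemma same_structure_X: "same_slice_structure X \<A> \<A>"
proof -
  have "slice_map X \<A> X \<A> id"
    unfolding slice_map_def Ball_case_prod_iff using atlas_regular by simp
  then show ?thesis by (simp add: same_slice_structure_def)
qed

lemma affine_atlas_X:
  assumes "\<And>k. affine_transformation (fk k)"
  shows "affine_atlas X \<A>"
  unfolding affine_atlas_def Ball_case_prod_iff
proof (intro conjI allI impI ballI slice_atlas_X)
  fix U \<phi> V \<psi> x assume UV: "(U, \<phi>) \<in> \<A>" "(V, \<psi>) \<in> \<A>" and x: "x \<in> \<phi> ` (U \<inter> V)"
  from UV obtain W Z where W: "U = \<pi> ` W" "\<phi> = inv_into W \<pi>" "open W" "inj_on \<pi> W"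
    and Z: "V = \<pi> ` Z" "\<psi> = inv_into Z \<pi>" "open Z" "inj_on \<pi> Z"
    unfolding in_atlas using circular_imp_open by blast
  from section_deck[OF W(3,4) Z(3,4) x[unfolded W(1,2) Z(1)]] obtain M k where
    "open M" "x \<in> M" "M \<subseteq> \<phi> ` (U \<inter> V)" "\<forall>y\<in>M. (\<psi> \<circ> inv_into U \<phi>) y = fk k y"
    unfolding W(1,2)[symmetric] Z(1,2)[symmetric] by (elim exE conjE)
  with assms[of k] show "\<exists>N T. open N \<and> x \<in> N \<and> N \<subseteq> \<phi> ` (U \<inter> V) \<and> affine_transformation T \<and>
      (\<forall>y\<in>N. (\<psi> \<circ> inv_into U \<phi>) y = T y)"
    by (intro exI conjI)
qed

lemma simply_connected_punctured: "simply_connected punctured"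
  unfolding punctured_def by (rule simply_connected_punctured_universe) (simp add: Basis_quat_def)

end

section \<open>The fundamental group of the quotient\<close>

context contraction
begin

definition lifts :: "'a::euclidean_space set \<Rightarrow> ('a \<Rightarrow> (quat \<times> quat) set) \<Rightarrow> ('a \<Rightarrow> quat \<times> quat) \<Rightarrow> bool" where
  "lifts U h g \<longleftrightarrow> continuous_on U g \<and> (\<forall>x\<in>U. g x \<in> punctured \<and> \<pi> (g x) = h x)"

lemma lifts_subset: "lifts U h g \<Longrightarrow> V \<subseteq> U \<Longrightarrow> lifts V h g"
  by (auto simp: lifts_def intro: continuous_on_subset)

lemma sheet_exists:
  assumes "x \<in> punctured"
  shows "\<exists>W. open W \<and> W \<subseteq> punctured \<and> inj_on \<pi> W \<and> x \<in> W"
  using shell_exists[OF assms] open_shell shell_punctured inj_on_shell by (meson less_imp_le)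

text \<open>The sets in question are intervals, not open sets, so the set of agreement is shown to
  be open and closed relative to C.\<close>

lemma lift_unique:
  assumes C: "connected C" and g: "lifts C h g" "lifts C h g'" and a: "a \<in> C" "g a = g' a" and x: "x \<in> C"
  shows "g x = g' x"
proof -
  define T where "T = {x \<in> C. g x = g' x}"
  have cg: "continuous_on C g" "continuous_on C g'" using g by (auto simp: lifts_def)
  have T: "T = {x \<in> C. g x - g' x = 0}" by (auto simp: T_def)
  have "closedin (top_of_set C) T"
    unfolding T by (rule continuous_closedin_preimage_constant[OF continuous_on_diff[OF cg]])
  moreover have "openin (top_of_set C) T"
  proof (subst openin_subopen, intro ballI)
    fix y assume y: "y \<in> T"
    then have "g y \<in> punctured" using g by (auto simp: T_def lifts_def)
    then obtain W where W: "open W" "inj_on \<pi> W" "g y \<in> W" using sheet_exists by blast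
    have "openin (top_of_set C) (C \<inter> g -` W)" "openin (top_of_set C) (C \<inter> g' -` W)"
      using continuous_openin_preimage_gen[OF cg(1) W(1)] continuous_openin_preimage_gen[OF cg(2) W(1)] by auto
    then have "openin (top_of_set C) ((C \<inter> g -` W) \<inter> (C \<inter> g' -` W))" by (rule openin_Int)
    moreover have "g z = g' z" if "z \<in> C" "g z \<in> W" "g' z \<in> W" for z
      using that g by (intro inj_onD[OF W(2)]) (simp_all add: lifts_def)
    then have "(C \<inter> g -` W) \<inter> (C \<inter> g' -` W) \<subseteq> T" by (simp add: T_def subset_iff)
    ultimately show "\<exists>S. openin (top_of_set C) S \<and> y \<in> S \<and> S \<subseteq> T"
      using y W(3) by (intro exI[of _ "(C \<inter> g -` W) \<inter> (C \<inter> g' -` W)"]) (auto simp: T_def)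
  qed
  ultimately have "T = {} \<or> T = C" using C unfolding connected_clopen by blast
  then show ?thesis using a x by (auto simp: T_def)
qed

lemma lifts_fk: "lifts C h g \<Longrightarrow> lifts C h (\<lambda>x. fk k (g x))"
  unfolding lifts_def
  by (auto simp: fk_punctured_iff intro: continuous_on_compose2[OF fk_cont[of UNIV]])

text \<open>With this, lifting of paths and of homotopies is the same statement,
  \<open>good_compact_convex\<close>, for an interval and for a square.\<close>

lemma torsor_lifts:
  fixes H :: "'a::euclidean_space \<Rightarrow> (quat \<times> quat) set"
  assumes H: "continuous_map euclidean X H"
  shows "torsor_sheaf (\<lambda>U g. lifts U H g) \<Gamma> UNIV"
proof
  fix U and g :: "'a \<Rightarrow> quat \<times> quat"
  assume U: "open U" and loc: "\<And>x. x \<in> U \<Longrightarrow> \<exists>N. open N \<and> x \<in> N \<and> N \<subseteq> U \<and> lifts N H g"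
  have "isCont g x" if "x \<in> U" for x
  proof -
    obtain N where "open N" "x \<in> N" "lifts N H g" using loc \<open>x \<in> U\<close> by blast
    then show ?thesis by (auto simp: lifts_def continuous_on_eq_continuous_at)
  qed
  then have "continuous_on U g" by (simp add: continuous_at_imp_continuous_on)
  then show "lifts U H g" using loc unfolding lifts_def by blast
next
  fix U V and g :: "'a \<Rightarrow> quat \<times> quat" assume "lifts U H g" "V \<subseteq> U"
  then show "lifts V H g" by (rule lifts_subset)
next
  fix U and g g' :: "'a \<Rightarrow> quat \<times> quat" assume "lifts U H g" "\<And>x. x \<in> U \<Longrightarrow> g x = g' x"
  then show "lifts U H g'" unfolding lifts_def by (simp cong: continuous_on_cong)
next
  fix U and g :: "'a \<Rightarrow> quat \<times> quat" and T assume "lifts U H g" "T \<in> \<Gamma>"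
  then show "lifts U H (T \<circ> g)" using lifts_fk by (auto simp: o_def)
next
  fix U and g g' :: "'a \<Rightarrow> quat \<times> quat" and x
  assume U: "open U" and g: "lifts U H g" "lifts U H g'" and x: "x \<in> U"
  then have "\<pi> (g x) = \<pi> (g' x)" by (simp add: lifts_def)
  then obtain k where k: "g' x = fk k (g x)" using proj_eq by blast
  obtain W where W: "open W" "inj_on \<pi> W" "g' x \<in> W"
    using sheet_exists[of "g' x"] g(2) x by (auto simp: lifts_def)
  define M where "M = (g' -` W \<inter> U) \<inter> ((\<lambda>x. fk k (g x)) -` W \<inter> U)"
  have "open (r -` W \<inter> U)" if "lifts U H r" for r
    using that W(1) by (simp add: lifts_def continuous_on_open_vimage[OF U])
  from open_Int[OF this[OF g(2)] this[OF lifts_fk[OF g(1), of k]]]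
  have "open M" unfolding M_def .
  moreover have "g' y = fk k (g y)" if "y \<in> M" for y
    using that g by (intro inj_onD[OF W(2)]) (auto simp: lifts_def M_def)
  ultimately show "\<exists>T\<in>\<Gamma>. \<exists>N. open N \<and> x \<in> N \<and> N \<subseteq> U \<and> (\<forall>y\<in>N. g' y = T (g y))"
    using x W(3) k by (intro bexI[of _ "fk k"] exI[of _ M]) (auto simp: M_def)
next
  fix U and g :: "'a \<Rightarrow> quat \<times> quat" and S T
  assume "U \<noteq> {}" "lifts U H g" "S \<in> \<Gamma>" "T \<in> \<Gamma>" "\<forall>y\<in>U. S (g y) = T (g y)"
  then show "S = T" unfolding lifts_def using fk_free by blast
next
  fix x :: 'a
  have "H x \<in> topspace X" using continuous_map_image_subset_topspace[OF H] by auto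
  then obtain e where e: "e \<in> punctured" "H x = \<pi> e" by (auto simp: topspace_X)
  obtain W where W: "open W" "W \<subseteq> punctured" "inj_on \<pi> W" "e \<in> W" using sheet_exists e by blast
  define U where "U = {x. H x \<in> \<pi> ` W}"
  have "open U" using openin_continuous_map_preimage[OF H open_image[OF W(1,2)]] by (simp add: U_def)
  moreover have "continuous_map (top_of_set U) (subtopology X (\<pi> ` W)) H"
    using continuous_map_from_subtopology[OF H] by (auto simp: continuous_map_in_subtopology U_def)
  then have "continuous_map (top_of_set U) (top_of_set W) (inv_into W \<pi> \<circ> H)"
    using homeomorphic_section[OF W(1-3)] homeomorphic_imp_continuous_map continuous_map_compose by blast
  then have "continuous_on U (inv_into W \<pi> \<circ> H)" by (simp add: continuous_map_in_subtopology)
  then have "lifts U H (inv_into W \<pi> \<circ> H)"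
    by (simp add: lifts_def U_def f_inv_into_f) (auto intro: subsetD[OF W(2) inv_into_into])
  ultimately show "\<exists>U g. open U \<and> x \<in> U \<and> lifts U H g" using e W(4) by (auto simp: U_def)
qed

lemma lift_exists:
  fixes K :: "'a::euclidean_space set"
  assumes K: "compact K" "convex K" and h: "continuous_map (top_of_set K) X h"
    and a: "a \<in> K" and e: "e \<in> punctured" "\<pi> e = h a"
  shows "\<exists>g. lifts K h g \<and> g a = e"
proof -
  have ne: "K \<noteq> {}" using a by blast
  have cl: "closed K" using K by (simp add: compact_imp_closed)
  \<comment> \<open>Sections live on open sets; the nearest point retraction extends h from the
    compact convex K to the whole space.\<close>
  define H where "H = h \<circ> closest_point K"
  have "continuous_map euclidean (top_of_set K) (closest_point K)"
    using continuous_on_closest_point[OF K(2) cl ne, of UNIV] closest_point_in_set[OF cl ne]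
    by (auto simp: continuous_map_in_subtopology)
  then have H: "continuous_map euclidean X H"
    unfolding H_def using h by (rule continuous_map_compose)
  interpret torsor_sheaf "\<lambda>U g. lifts U H g" \<Gamma> UNIV by (rule torsor_lifts[OF H])
  obtain d where d: "d > 0" "good (\<Union>x\<in>K. ball x d)" using good_compact_convex[OF K] by auto
  then obtain g where g: "lifts (\<Union>x\<in>K. ball x d) H g" by (auto simp: good_def)
  have sub: "K \<subseteq> (\<Union>x\<in>K. ball x d)" using d(1) by auto
  have "lifts K H g" by (rule lifts_subset[OF g sub])
  then have gK: "lifts K h g" by (simp add: lifts_def H_def closest_point_self)
  then have "\<pi> (g a) = \<pi> e" using a e by (simp add: lifts_def)
  then obtain k where "e = fk k (g a)" using proj_eq by blast
  then show ?thesis using lifts_fk[OF gK, of k] by auto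
qed

lemma lifts_imp_pathin: "lifts {0..1} p p' \<Longrightarrow> pathin X p"
proof -
  assume l: "lifts {0..1} p p'"
  then have "continuous_map (top_of_set {0..1}) punctured_top p'"
    by (auto simp: lifts_def)
  then have "continuous_map (top_of_set {0..1}) X (\<pi> \<circ> p')"
    using proj_continuous continuous_map_compose by blast
  then show ?thesis unfolding pathin_def
    by (rule continuous_map_eq) (use l in \<open>auto simp: lifts_def\<close>)
qed

text \<open>The homotopy classes described upstairs: as the covering space is simply connected, the
  loops with a given k will form exactly one class, and k is its integer.\<close>

definition end_class :: "quat \<times> quat \<Rightarrow> int \<Rightarrow> (real \<Rightarrow> (quat \<times> quat) set) set" where
  "end_class e k = {p \<in> loops_at X (\<pi> e). \<exists>p'. lifts {0..1} p p' \<and> p' 0 = e \<and> p' 1 = fk k e}"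

lemma end_class_exists:
  assumes e: "e \<in> punctured" and p: "p \<in> loops_at X (\<pi> e)"
  shows "\<exists>k. p \<in> end_class e k"
proof -
  have "continuous_map (top_of_set {0..1}) X p" "p 0 = \<pi> e" "p 1 = \<pi> e"
    using p by (auto simp: loops_at_def pathin_def)
  then obtain p' where p': "lifts {0..1} p p'" "p' 0 = e"
    using lift_exists[of "{0..1::real}" p 0 e] e by auto
  then have "\<pi> (p' 1) = \<pi> e" using \<open>p 1 = \<pi> e\<close> by (simp add: lifts_def)
  then obtain k where "p' 1 = fk k e" using proj_eq by metis
  then show ?thesis using p p' by (auto simp: end_class_def)
qed

lemma end_class_unique:
  assumes e: "e \<in> punctured" and p: "p \<in> end_class e j" "p \<in> end_class e k"
  shows "j = k"
proof -
  obtain p' p'' where l: "lifts {0..1} p p'" "p' 0 = e" "p' 1 = fk j e"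
    "lifts {0..1} p p''" "p'' 0 = e" "p'' 1 = fk k e" using p by (auto simp: end_class_def)
  have "p' 1 = p'' 1" by (rule lift_unique[OF _ l(1,4), of 0]) (use l in auto)
  then show ?thesis using fk_free[OF e] l by simp
qed

lemma end_class_nonempty:
  assumes e: "e \<in> punctured" and pc: "path_connected punctured"
  shows "end_class e k \<noteq> {}"
proof -
  have "fk k e \<in> punctured" using e by (simp add: fk_punctured_iff)
  then obtain g where g: "path g" "path_image g \<subseteq> punctured" "pathstart g = e" "pathfinish g = fk k e"
    using pc e unfolding path_connected_def by blast
  then have l: "lifts {0..1} (\<pi> \<circ> g) g"
    by (auto simp: lifts_def path_def path_image_def)
  then have "\<pi> \<circ> g \<in> end_class e k"
    using lifts_imp_pathin[OF l] g by (auto simp: end_class_def loops_at_def pathstart_def pathfinish_def)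
  then show ?thesis by blast
qed

lemma unit_square_topology:
  "prod_topology (top_of_set {0..1::real}) (top_of_set {0..1::real}) = top_of_set (cbox (0, 0) (1, 1))"
  by (simp add: prod_topology_subtopology_eu cbox_Pair_eq)

lemma end_class_homotopic:
  assumes e: "e \<in> punctured" and sc: "simply_connected punctured"
    and p: "p \<in> end_class e k" and q: "q \<in> end_class e k"
  shows "loop_homotopic X (\<pi> e) p q"
proof -
  obtain p' where p': "lifts {0..1} p p'" "p' 0 = e" "p' 1 = fk k e" using p by (auto simp: end_class_def)
  obtain q' where q': "lifts {0..1} q q'" "q' 0 = e" "q' 1 = fk k e" using q by (auto simp: end_class_def)
  have "path p' \<and> path_image p' \<subseteq> punctured \<and> path q' \<and> path_image q' \<subseteq> punctured \<and>
      pathstart q' = pathstart p' \<and> pathfinish q' = pathfinish p'"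
    using p' q' by (auto simp: lifts_def path_def path_image_def pathstart_def pathfinish_def)
  then have "homotopic_paths punctured p' q'"
    by (rule sc[unfolded simply_connected_eq_homotopic_paths, THEN conjunct2, THEN spec, THEN spec, THEN mp])
  then obtain h :: "real \<times> real \<Rightarrow> quat \<times> quat" where h0: "continuous_on ({0..1} \<times> {0..1}) h" "h \<in> ({0..1} \<times> {0..1}) \<rightarrow> punctured"
    "\<forall>t\<in>{0..1}. h (0, t) = p' t" "\<forall>t\<in>{0..1}. h (1, t) = q' t"
    "\<forall>s\<in>{0..1}. pathstart (h \<circ> Pair s) = pathstart p' \<and> pathfinish (h \<circ> Pair s) = pathfinish p'"
    unfolding homotopic_paths by (elim exE conjE) (rule that, assumption+)
  then have h: "h (0, t) = p' t" "h (1, t) = q' t" "h (t, 0) = p' 0" "h (t, 1) = p' 1" if "t \<in> {0..1}" for t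
    using that by (simp_all add: pathstart_def pathfinish_def)
  \<comment> \<open>\<open>homotopic_with\<close> requires the homotopy to start at p and to end at
    q for all real t, also outside the unit interval, where the projected homotopy says nothing.
    Hence the separate values for s = 0 and s = 1.\<close>
  define K where "K = (\<lambda>(s :: real, t). if s = 0 then p t else if s = 1 then q t else \<pi> (h (s, t)))"
  have K: "K (s, t) = \<pi> (h (s, t))" if "t \<in> {0..1}" for s t
    using that h(1,2) p'(1) q'(1) by (auto simp: K_def lifts_def)
  have "continuous_map (top_of_set ({0..1} \<times> {0..1})) punctured_top h"
    using h0(1,2) by (auto simp: continuous_map_in_subtopology)
  then have "continuous_map (top_of_set ({0..1} \<times> {0..1})) X (\<pi> \<circ> h)"
    using proj_continuous continuous_map_compose by blast
  then have "continuous_map (top_of_set ({0..1} \<times> {0..1})) X K"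
    by (rule continuous_map_eq) (use K in auto)
  then show ?thesis
    unfolding loop_homotopic_def homotopic_with_def unit_square_topology cbox_Pair_eq
    by (intro exI[of _ K] conjI)
      (use K h(3,4) p' in \<open>auto simp: K_def cbox_interval\<close>)
qed

text \<open>The homotopy is lifted over the square. On the two sides where it is constant its lift
  is constant by uniqueness, so the lifts of p and q share their end points.\<close>

lemma end_class_homotopy_closed:
  assumes e: "e \<in> punctured" and p: "p \<in> end_class e k"
    and q: "q \<in> loops_at X (\<pi> e)" and pq: "loop_homotopic X (\<pi> e) p q"
  shows "q \<in> end_class e k"
proof -
  obtain p' where p': "lifts {0..1} p p'" "p' 0 = e" "p' 1 = fk k e" using p by (auto simp: end_class_def)
  have p01: "p 0 = \<pi> e" using p by (auto simp: end_class_def loops_at_def)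
  obtain h where h: "continuous_map (top_of_set (cbox (0 :: real, 0 :: real) (1, 1))) X h"
    "\<forall>t. h (0, t) = p t" "\<forall>t. h (1, t) = q t"
    "\<forall>s\<in>{0..1}. h (s, 0) = \<pi> e \<and> h (s, 1) = \<pi> e"
    using pq[unfolded loop_homotopic_def homotopic_with_def unit_square_topology]
    by (elim exE conjE) (rule that, assumption+)
  obtain g where g: "lifts (cbox (0, 0) (1, 1)) h g" "g (0, 0) = e"
    using lift_exists[OF compact_cbox convex_box(1) h(1), of "(0, 0)" e] e h(2) p01
    by (auto simp: cbox_Pair_eq)
  have restrict: "lifts {0..1} (h \<circ> c) (g \<circ> c)"
    if "continuous_on {0..1} c" "\<And>t. t \<in> {0..1} \<Longrightarrow> c t \<in> cbox (0, 0) (1, 1)"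
    for c :: "real \<Rightarrow> real \<times> real"
  proof -
    have "continuous_on {0..1} (g \<circ> c)"
      unfolding o_def using g(1) that
      by (intro continuous_on_compose2[of "cbox (0, 0) (1, 1)" g _ c] image_subsetI) (simp_all add: lifts_def)
    then show ?thesis using g(1) that(2) by (auto simp: lifts_def)
  qed
  have const: "lifts {0..1} (\<lambda>_. \<pi> u) (\<lambda>_. u)" if "u \<in> punctured" for u
    using that by (simp add: lifts_def)
  have left: "lifts {0..1} p (\<lambda>t. g (0, t))" "lifts {0..1} q (\<lambda>t. g (1, t))"
    using restrict[of "\<lambda>t. (0, t)"] restrict[of "\<lambda>t. (1, t)"] h(2,3)
    by (auto simp: o_def cbox_Pair_eq continuous_on_Pair)
  have "lifts {0..1} (\<lambda>s. h (s, 0)) (\<lambda>s. g (s, 0))" "lifts {0..1} (\<lambda>s. h (s, 1)) (\<lambda>s. g (s, 1))"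
    using restrict[of "\<lambda>s. (s, 0)"] restrict[of "\<lambda>s. (s, 1)"]
    by (auto simp: o_def cbox_Pair_eq continuous_on_Pair)
  then have bottom: "lifts {0..1} (\<lambda>s. \<pi> e) (\<lambda>s. g (s, 0))" "lifts {0..1} (\<lambda>s. \<pi> (fk k e)) (\<lambda>s. g (s, 1))"
    using h(4) by (auto simp: lifts_def)
  have "g (0, 1) = p' 1" by (rule lift_unique[OF _ left(1) p'(1), of 0]) (use g p' in auto)
  have "g (1, 0) = e"
    by (rule lift_unique[OF _ bottom(1) const[OF e], of 0]) (use g in auto)
  moreover have "g (1, 1) = fk k e"
    by (rule lift_unique[OF _ bottom(2) const, of 0])
      (use e \<open>g (0, 1) = p' 1\<close> p' in \<open>auto simp: fk_punctured_iff\<close>)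
  ultimately show ?thesis using q left(2) by (auto simp: end_class_def)
qed

lemma end_class_join:
  assumes e: "e \<in> punctured" and p: "p \<in> end_class e j" and q: "q \<in> end_class e k"
  shows "loop_join p q \<in> end_class e (j + k)"
proof -
  obtain p' where p': "lifts {0..1} p p'" "p' 0 = e" "p' 1 = fk j e" using p by (auto simp: end_class_def)
  obtain q' where q': "lifts {0..1} q q'" "q' 0 = e" "q' 1 = fk k e" using q by (auto simp: end_class_def)
  \<comment> \<open>The lift of q starts at e, but the lift of p ends at \<open>fk j e\<close>; the
    deck transformation \<open>fk j\<close> moves the second lift to where the first one
    ends.\<close>
  define r where "r = p' +++ (\<lambda>t. fk j (q' t))"
  have fq: "lifts {0..1} q (\<lambda>t. fk j (q' t))" using lifts_fk[OF q'(1)] .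
  have "path r" unfolding r_def
    using p' fq q' by (intro path_join_imp) (auto simp: lifts_def path_def pathfinish_def pathstart_def)
  then have l: "lifts {0..1} (loop_join p q) r"
    using p'(1) fq by (auto simp: lifts_def path_def r_def joinpaths_def loop_join_def)
  have "r 0 = e" "r 1 = fk (j + k) e" using p' q' by (simp_all add: r_def joinpaths_def fk_add)
  moreover have "loop_join p q \<in> loops_at X (\<pi> e)"
    using lifts_imp_pathin[OF l] p q by (auto simp: loops_at_def loop_join_def end_class_def)
  ultimately show ?thesis using l by (auto simp: end_class_def)
qed

lemma fundamental_group_iso:
  assumes sc: "simply_connected punctured" and x: "x \<in> topspace X"
  shows "fundamental_group X x \<cong> integer_group"
proof -
  obtain e where e: "e \<in> punctured" "x = \<pi> e" using x by (auto simp: topspace_X)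
  have pc: "path_connected punctured" using sc by (rule simply_connected_imp_path_connected)
  let ?L = "end_class e"
  have cls: "loop_class X x p = ?L k" if "p \<in> ?L k" for p k
    using that end_class_homotopic[OF e(1) sc that] end_class_homotopy_closed[OF e(1) that]
    by (auto simp: loop_class_def e(2)) (auto simp: end_class_def)
  have mult: "(\<Union>p\<in>?L j. \<Union>q\<in>?L k. loop_class X x (loop_join p q)) = ?L (j + k)" for j k
  proof -
    have "loop_class X x (loop_join p q) = ?L (j + k)" if "p \<in> ?L j" "q \<in> ?L k" for p q
      using cls[OF end_class_join[OF e(1) that]] .
    then show ?thesis using end_class_nonempty[OF e(1) pc] by auto
  qed
  have carrier: "loop_class X x ` loops_at X x = range ?L"
  proof (intro equalityI subsetI)
    fix P assume "P \<in> loop_class X x ` loops_at X x"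
    then obtain p where p: "p \<in> loops_at X (\<pi> e)" "P = loop_class X x p" using e(2) by blast
    then obtain k where "p \<in> ?L k" using end_class_exists[OF e(1)] by blast
    then show "P \<in> range ?L" using p(2) cls by blast
  next
    fix P assume "P \<in> range ?L"
    then obtain k where k: "P = ?L k" by blast
    obtain p where p: "p \<in> ?L k" using end_class_nonempty[OF e(1) pc] by blast
    then have "p \<in> loops_at X x" by (simp add: end_class_def e(2))
    then show "P \<in> loop_class X x ` loops_at X x" using cls[OF p] k by blast
  qed
  have "inj ?L"
  proof (rule injI)
    fix j k assume "?L j = ?L k"
    then show "j = k" using end_class_unique[OF e(1)] end_class_nonempty[OF e(1) pc] by blast
  qed
  \<comment> \<open>The isomorphism is built starting from the integers: its inversion by
    \<open>group.iso_sym\<close> asks for the group axioms on that side, so they need not be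
    verified for classes of loops.\<close>
  then have "?L \<in> iso integer_group (fundamental_group X x)"
    by (auto simp: iso_def hom_def bij_betw_def fundamental_group_def carrier mult)
  then have "integer_group \<cong> fundamental_group X x" unfolding is_iso_def by blast
  then show ?thesis by (rule group.iso_sym[OF group_integer_group])
qed

end

section \<open>Affine transformations and developing maps\<close>

definition lmul :: "quat \<Rightarrow> quat \<times> quat \<Rightarrow> quat \<times> quat" where
  "lmul q v = (q * fst v, q * snd v)"

definition left_linear :: "(quat \<times> quat \<Rightarrow> quat \<times> quat) \<Rightarrow> bool" where
  "left_linear L \<longleftrightarrow> (\<forall>u v. L (u + v) = L u + L v) \<and> (\<forall>q v. L (lmul q v) = lmul q (L v))"

lemma lmul_simps:
  "lmul q (u + v) = lmul q u + lmul q v" "lmul (p + q) v = lmul p v + lmul q v"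
  "lmul (p * q) v = lmul p (lmul q v)" "lmul 1 v = v" "lmul 0 v = 0" "lmul q 0 = 0"
  "lmul (of_real r) v = r *\<^sub>R v" "lmul q (u - v) = lmul q u - lmul q v"
  "lmul (p - q) v = lmul p v - lmul q v" "lmul (- q) v = - lmul q v"
  by (auto simp: lmul_def algebra_simps zero_prod_def prod_eq_iff scaleR_conv_of_real)

lemma left_linearD:
  assumes "left_linear L"
  shows "L (u + v) = L u + L v" "L (lmul q v) = lmul q (L v)" "L (r *\<^sub>R v) = r *\<^sub>R L v"
    "L 0 = 0" "L (- v) = - L v" "L (u - v) = L u - L v"
proof -
  show *: "L (u + v) = L u + L v" "L (lmul q v) = lmul q (L v)" for u v q
    using assms unfolding left_linear_def by blast+
  show "L (r *\<^sub>R v) = r *\<^sub>R L v" "L 0 = 0" "L (- v) = - L v"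
    using *(2)[of "of_real r" v] *(2)[of 0 0] *(2)[of "-1" v] by (simp_all add: lmul_simps)
  then show "L (u - v) = L u - L v" using *(1)[of u "- v"] *(2)[of "-1" v] by (simp add: lmul_simps)
qed

lemma left_linear_imp_linear: "left_linear L \<Longrightarrow> linear L"
  by (intro linearI) (auto simp: left_linearD)

lemma left_linear_matrix:
  assumes "left_linear L"
  shows "L (z, w) = (z * fst (L (1, 0)) + w * fst (L (0, 1)), z * snd (L (1, 0)) + w * snd (L (0, 1)))"
proof -
  have "(z, w) = lmul z (1, 0) + lmul w (0, 1)" by (simp add: lmul_def)
  then have "L (z, w) = lmul z (L (1, 0)) + lmul w (L (0, 1))"
    using left_linearD[OF assms] by metis
  then show ?thesis by (simp add: lmul_def)
qed

text \<open>Coefficients on the right are the same as a linear part that commutes with left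
  multiplication by quaternions. In this form affine maps are compatible with the scalars of every
  slice.\<close>

lemma affine_transformation_iff:
  "affine_transformation T \<longleftrightarrow> left_linear (\<lambda>v. T v - T 0)"
proof
  assume "affine_transformation T"
  then obtain a b c a' b' c' where T: "\<And>z w. T (z, w) = (z * a + w * b + c, z * a' + w * b' + c')"
    unfolding affine_transformation_def by blast
  then have "T v - T 0 = (fst v * a + snd v * b, fst v * a' + snd v * b')" for v
    by (cases v) (simp add: zero_prod_def)
  then show "left_linear (\<lambda>v. T v - T 0)"
    by (simp add: left_linear_def lmul_def distrib_left distrib_right mult.assoc del: split_paired_All)
next
  assume L: "left_linear (\<lambda>v. T v - T 0)"
  show "affine_transformation T"
    unfolding affine_transformation_def
  proof (intro exI allI)
    fix z w
    show "T (z, w) = (z * fst (T (1, 0) - T 0) + w * fst (T (0, 1) - T 0) + fst (T 0),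
        z * snd (T (1, 0) - T 0) + w * snd (T (0, 1) - T 0) + snd (T 0))"
      using left_linear_matrix[OF L, of z w] by (simp add: prod_eq_iff algebra_simps)
  qed
qed

definition affine_bijections :: "(quat \<times> quat \<Rightarrow> quat \<times> quat) set" where
  "affine_bijections = {T. affine_transformation T \<and> bij T}"

lemma left_linear_compose: "left_linear L \<Longrightarrow> left_linear M \<Longrightarrow> left_linear (L \<circ> M)"
  by (simp add: left_linear_def del: split_paired_All)

lemma affine_compose:
  assumes "affine_transformation T" "affine_transformation S"
  shows "affine_transformation (T \<circ> S)"
proof -
  have "(\<lambda>v. (T \<circ> S) v - (T \<circ> S) 0) = (\<lambda>v. T v - T 0) \<circ> (\<lambda>v. S v - S 0)"
  proof
    fix v
    have "T (S v) - T 0 = (T (S v - S 0) - T 0) + (T (S 0) - T 0)"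
      using left_linearD(1)[OF assms(1)[unfolded affine_transformation_iff], of "S v - S 0" "S 0"] by simp
    then show "(T \<circ> S) v - (T \<circ> S) 0 = ((\<lambda>v. T v - T 0) \<circ> (\<lambda>v. S v - S 0)) v"
      by (simp add: algebra_simps)
  qed
  then show ?thesis using assms left_linear_compose unfolding affine_transformation_iff by simp
qed

lemma affine_inverse:
  assumes T: "affine_transformation T" "bij T"
  shows "affine_transformation (inv_into UNIV T)"
proof -
  let ?S = "inv_into UNIV T"
  have TS: "T (?S v) = v" for v using T(2) by (simp add: bij_is_surj surj_f_inv_f)
  have inj: "T u = T v \<Longrightarrow> u = v" for u v using T(2) by (metis bij_is_inj injD)
  note L = left_linearD[OF T(1)[unfolded affine_transformation_iff]]
  have add: "T (u + v) = T u + T v - T 0" for u v using L(1)[of u v] by (simp add: algebra_simps)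
  have mul: "T (lmul q v) = lmul q (T v) - lmul q (T 0) + T 0" for q v
    using L(2)[of q v] by (simp add: algebra_simps lmul_simps)
  have diff: "T (u - v) = T u - T v + T 0" for u v using L(6)[of u v] by (simp add: algebra_simps)
  show ?thesis unfolding affine_transformation_iff left_linear_def
  proof (intro conjI allI)
    fix u v q
    show "?S (u + v) - ?S 0 = (?S u - ?S 0) + (?S v - ?S 0)"
      by (rule inj) (simp add: add diff TS)
    show "?S (lmul q v) - ?S 0 = lmul q (?S v - ?S 0)"
      by (rule inj) (simp add: add diff mul TS lmul_simps)
  qed
qed

lemma affine_bijections_group:
  "id \<in> affine_bijections"
  "S \<in> affine_bijections \<Longrightarrow> T \<in> affine_bijections \<Longrightarrow> S \<circ> T \<in> affine_bijections"
  "S \<in> affine_bijections \<Longrightarrow> inv_into UNIV S \<in> affine_bijections"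
proof -
  have "affine_transformation id"
    by (simp add: affine_transformation_iff left_linear_def del: split_paired_All)
  then show "id \<in> affine_bijections" by (simp add: affine_bijections_def)
  show "S \<in> affine_bijections \<Longrightarrow> T \<in> affine_bijections \<Longrightarrow> S \<circ> T \<in> affine_bijections"
    "S \<in> affine_bijections \<Longrightarrow> inv_into UNIV S \<in> affine_bijections"
    by (simp_all add: affine_bijections_def affine_compose affine_inverse bij_comp bij_imp_bij_inv)
qed

lemma left_linear_eq_on_open:
  assumes L: "left_linear L" and U: "open U" "x \<in> U" and eq: "\<And>y. y \<in> U \<Longrightarrow> L y = L x"
  shows "L v = 0"
proof -
  obtain e where e: "e > 0" "ball x e \<subseteq> U" using U open_contains_ball by blast
  define t where "t = e / (2 * (norm v + 1))"
  have nv: "norm v + 1 > 0" by (simp add: add_nonneg_pos)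
  then have t: "t > 0" using e(1) by (simp add: t_def)
  have "norm (t *\<^sub>R v) = t * norm v" using t by simp
  also have "\<dots> \<le> t * (norm v + 1)" using t by simp
  also have "\<dots> = e / 2" unfolding t_def using nv by (simp add: divide_simps)
  also have "\<dots> < e" using e(1) by simp
  finally have "x + t *\<^sub>R v \<in> U" using e(2) by (auto simp: dist_norm)
  then have "L (x + t *\<^sub>R v) = L x" by (rule eq)
  then show ?thesis using t by (simp add: left_linearD[OF L])
qed

lemma affine_eq_on_open:
  assumes ST: "affine_transformation S" "affine_transformation T" and U: "open U" "x \<in> U"
    and eq: "\<And>y. y \<in> U \<Longrightarrow> S y = T y"
  shows "S = T"
proof
  fix v
  let ?L = "\<lambda>v. (S v - S 0) - (T v - T 0)"
  have L: "left_linear ?L"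
    using ST unfolding affine_transformation_iff by (simp add: left_linear_def lmul_simps del: split_paired_All)
  have "?L v = 0" for v
    by (rule left_linear_eq_on_open[OF L U]) (simp add: eq U(2))
  from this[of v] this[of x] show "S v = T v" using eq[OF U(2)] by (simp add: algebra_simps)
qed

text \<open>Applied to changes of charts, which are injective on small open sets. A kernel vector of
  the linear part, scaled down, would violate injectivity, and in finite dimension an injective
  linear map is onto.\<close>

lemma affine_inj_imp_bij:
  assumes S: "affine_transformation S" and U: "open U" "x \<in> U" and inj: "inj_on S U"
  shows "S \<in> affine_bijections"
proof -
  let ?L = "\<lambda>v. S v - S 0"
  have L: "left_linear ?L" using S by (simp add: affine_transformation_iff)
  have ker: "v = 0" if v: "?L v = 0" for v
  proof (rule ccontr)
    assume nz: "v \<noteq> 0"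
    obtain e where e: "e > 0" "ball x e \<subseteq> U" using U open_contains_ball by blast
    define t where "t = e / (2 * norm v)"
    have t: "t > 0" "norm (t *\<^sub>R v) < e" using e nz by (auto simp: t_def)
    then have "x + t *\<^sub>R v \<in> U" using e(2) by (auto simp: dist_norm)
    moreover have "?L (x + t *\<^sub>R v) = ?L x"
      using left_linearD(1)[OF L, of x "t *\<^sub>R v"] left_linearD(3)[OF L, of t v] v by simp
    then have "S (x + t *\<^sub>R v) = S x" by simp
    ultimately have "x + t *\<^sub>R v = x" using inj U(2) by (auto dest: inj_onD)
    then show False using t nz by simp
  qed
  have lin: "linear ?L" by (rule left_linear_imp_linear[OF L])
  have "inj ?L" using ker linear_injective_0[OF lin] by simp
  then have "surj ?L" using lin linear_injective_imp_surjective by blast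
  have "inj S" using \<open>inj ?L\<close> by (auto simp: inj_def)
  moreover have "surj S"
  proof (rule surjI)
    fix y
    have "?L (inv_into UNIV ?L (y - S 0)) = y - S 0" using \<open>surj ?L\<close> by (rule surj_f_inv_f)
    then show "S (inv_into UNIV ?L (y - S 0)) = y" by (simp add: algebra_simps)
  qed
  ultimately show ?thesis using S by (simp add: affine_bijections_def bij_def)
qed

section \<open>Gluing over the punctured space\<close>

context torsor_sheaf
begin

text \<open>The overlap of a further half-space with the union so far consists of convex sets that
  all contain p, so it is connected.\<close>

lemma good_Union_halfspaces:
  assumes "finite C" and C: "\<And>c. c \<in> C \<Longrightarrow> norm c = 1 \<and> 0 < c \<bullet> p" and Om: "- {0} \<subseteq> Om"
  shows "good (\<Union>c\<in>C. {x. 0 < c \<bullet> x})"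
  using assms(1) C
proof (induction C rule: finite_induct)
  case empty
  show ?case using adm_local[of "{}"] by (auto simp: good_def)
next
  case (insert d C)
  have "{x. 0 < d \<bullet> x} \<subseteq> Om" using Om by auto
  then have "good {x. 0 < d \<bullet> x}" using insert.prems by (intro good_halfspace) auto
  moreover have "good (\<Union>c\<in>C. {x. 0 < c \<bullet> x})" using insert by auto
  moreover have "connected (\<Union>c\<in>C. {x. 0 < d \<bullet> x} \<inter> {x. 0 < c \<bullet> x})"
  proof (rule connected_Union)
    show "\<And>S. S \<in> (\<lambda>c. {x. 0 < d \<bullet> x} \<inter> {x. 0 < c \<bullet> x}) ` C \<Longrightarrow> connected S"
      by (auto intro!: convex_connected convex_Int convex_halfspace_gt convex_halfspace_lt)
    have "p \<in> \<Inter> ((\<lambda>c. {x. 0 < d \<bullet> x} \<inter> {x. 0 < c \<bullet> x}) ` C)" using insert.prems by auto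
    then show "\<Inter> ((\<lambda>c. {x. 0 < d \<bullet> x} \<inter> {x. 0 < c \<bullet> x}) ` C) \<noteq> {}" by blast
  qed
  then have "connected ({x. 0 < d \<bullet> x} \<inter> (\<Union>c\<in>C. {x. 0 < c \<bullet> x}))" by (simp only: Int_UN_distrib)
  ultimately show ?case using good_Un by simp
qed

text \<open>The punctured space is the union of \<open>{x. \<exists>b. 0 < b \<bullet> x}\<close> and \<open>{x. \<exists>b. b \<bullet> x < 0}\<close>
  (\<open>b\<close> a basis vector), each a union of half-spaces with a common point.\<close>

lemma good_punctured:
  assumes dim: "3 \<le> DIM('a)" and Om: "- {0} \<subseteq> Om"
  shows "good (- {0})"
proof -
  let ?H = "\<lambda>c. {x :: 'a. 0 < c \<bullet> x}"
  define P where "P = (\<Union>c\<in>Basis. ?H c)"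
  define M where "M = (\<Union>c\<in>uminus ` Basis. ?H c)"
  have one: "b \<bullet> (\<Sum>i\<in>Basis. i) = 1" if "b \<in> Basis" for b :: 'a
    using that by (simp add: inner_sum_right inner_Basis)
  have "good P" unfolding P_def by (rule good_Union_halfspaces[of _ "\<Sum>i\<in>Basis. i"]) (auto simp: one Om)
  moreover have "good M"
    unfolding M_def by (rule good_Union_halfspaces[of _ "- (\<Sum>i\<in>Basis. i)"]) (auto simp: one Om)
  moreover have "connected (P \<inter> M)"
  proof -
    \<comment> \<open>\<open>Q b\<close> is the part of the overlap where coordinate b is negative
      and some other one is positive. It is a union of convex sets with a common point: coordinate b
      equal to -1, all others equal to 1.\<close>
    define Q where "Q b = (\<Union>c\<in>Basis - {b}. ?H c \<inter> ?H (- b))" for b :: 'a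
    have PM: "P \<inter> M = (\<Union>b\<in>Basis. Q b)"
    proof (intro equalityI subsetI)
      fix x assume "x \<in> P \<inter> M"
      then obtain c b where "c \<in> Basis" "0 < c \<bullet> x" "b \<in> Basis" "0 < - b \<bullet> x" by (auto simp: P_def M_def)
      then show "x \<in> (\<Union>b\<in>Basis. Q b)" unfolding Q_def by (intro UN_I[of b] UN_I[of c]) auto
    qed (auto simp: P_def M_def Q_def)
    have Qc: "connected (Q b)" if b: "b \<in> Basis" for b
      unfolding Q_def
    proof (rule connected_Union)
      show "\<And>S. S \<in> (\<lambda>c. ?H c \<inter> ?H (- b)) ` (Basis - {b}) \<Longrightarrow> connected S"
        by (auto intro!: convex_connected convex_Int convex_halfspace_gt convex_halfspace_lt)
      have "(\<Sum>i\<in>Basis. i) - 2 *\<^sub>R b \<in> \<Inter> ((\<lambda>c. ?H c \<inter> ?H (- b)) ` (Basis - {b}))"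
        using b by (auto simp: inner_diff_right one inner_Basis)
      then show "\<Inter> ((\<lambda>c. ?H c \<inter> ?H (- b)) ` (Basis - {b})) \<noteq> {}" by blast
    qed
    \<comment> \<open>Here the dimension enters: with b and b' both negative, a third coordinate has
      to be positive.\<close>
    have meet: "Q b \<inter> Q b' \<noteq> {}" if b: "b \<in> Basis" "b' \<in> Basis" "b \<noteq> b'" for b b'
    proof -
      have "card {b, b'} < card (Basis :: 'a set)" using dim b by simp
      then obtain c :: 'a where c: "c \<in> Basis" "c \<noteq> b" "c \<noteq> b'"
        by (metis card_mono finite.emptyI finite_insert insertCI linorder_not_le subsetI)
      have "(\<Sum>i\<in>Basis. i) - 2 *\<^sub>R b - 2 *\<^sub>R b' \<in> Q b \<inter> Q b'"
        using b c unfolding Q_def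
        by (auto simp: inner_diff_right one inner_Basis intro!: bexI[of _ c])
      then show ?thesis by blast
    qed
    obtain b0 :: 'a where b0: "b0 \<in> Basis" using nonempty_Basis by blast
    have Q0: "Q b0 \<noteq> {}"
    proof -
      have "card {b0} < card (Basis :: 'a set)" using dim by simp
      then obtain b1 :: 'a where b1: "b1 \<in> Basis" "b1 \<noteq> b0"
        by (metis card_mono finite.emptyI finite_insert insertCI linorder_not_le subsetI)
      then show ?thesis using meet[OF b0 b1(1)] by auto
    qed
    have "connected (\<Union>b\<in>Basis. Q b \<union> Q b0)"
    proof (rule connected_Union)
      fix S assume "S \<in> (\<lambda>b. Q b \<union> Q b0) ` Basis"
      then obtain b where b: "b \<in> Basis" "S = Q b \<union> Q b0" by blast
      show "connected S"
        using meet[OF b(1) b0] Qc[OF b(1)] Qc[OF b0] b(2) by (cases "b = b0") (auto intro: connected_Un)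
    next
      show "\<Inter> ((\<lambda>b. Q b \<union> Q b0) ` Basis) \<noteq> {}" using Q0 by blast
    qed
    moreover have "(\<Union>b\<in>Basis. Q b \<union> Q b0) = (\<Union>b\<in>Basis. Q b)" using b0 by blast
    ultimately show ?thesis using PM by simp
  qed
  ultimately have "good (P \<union> M)" by (rule good_Un)
  moreover have "P \<union> M = - {0}"
  proof (intro equalityI subsetI)
    fix x :: 'a assume "x \<in> - {0}"
    then obtain b where b: "b \<in> Basis" "x \<bullet> b \<noteq> 0" using euclidean_all_zero_iff[of x] by auto
    then have "0 < b \<bullet> x \<or> 0 < (- b) \<bullet> x" by (auto simp: inner_commute)
    then show "x \<in> P \<union> M" using b unfolding P_def M_def by blast
  qed (auto simp: P_def M_def)
  ultimately show ?thesis by simp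
qed

end

section \<open>The developing map of an affine atlas\<close>

lemma affine_atlasD:
  assumes "affine_atlas X A" "(U, \<phi>) \<in> A" "(V, \<psi>) \<in> A" "x \<in> \<phi> ` (U \<inter> V)"
  shows "\<exists>N T. open N \<and> x \<in> N \<and> N \<subseteq> \<phi> ` (U \<inter> V) \<and> affine_transformation T \<and>
    (\<forall>y\<in>N. (\<psi> \<circ> inv_into U \<phi>) y = T y)"
  by (rule assms(1)[unfolded affine_atlas_def Ball_case_prod_iff, THEN conjunct2, THEN spec, THEN spec,
        THEN mp, OF assms(2), THEN spec, THEN spec, THEN mp, OF assms(3), THEN bspec, OF assms(4)])

locale affine_contraction = slice_contraction +
  fixes B :: "(quat \<times> quat) set chart set"
  assumes affine: "affine_atlas X B" and same: "same_slice_structure X \<A> B"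
begin

lemma chart_B:
  assumes "(V, \<psi>) \<in> B"
  shows "openin X V" "open (\<psi> ` V)" "inj_on \<psi> V"
    "homeomorphic_map (subtopology X V) (top_of_set (\<psi> ` V)) \<psi>"
proof -
  have c: "chart_on X (V, \<psi>)" using affine assms unfolding affine_atlas_def slice_atlas_def by blast
  then show V: "openin X V" and "open (\<psi> ` V)"
    and h: "homeomorphic_map (subtopology X V) (top_of_set (\<psi> ` V)) \<psi>"
    by (auto simp: chart_on_def)
  have "topspace (subtopology X V) = V" using openin_subset[OF V] by auto
  then show "inj_on \<psi> V" using homeomorphic_imp_injective_map[OF h] by simp
qed

lemma open_chart_domain: "(V, \<psi>) \<in> B \<Longrightarrow> open {x \<in> punctured. \<pi> x \<in> V}"
  using chart_B(1) openin_X by blast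

lemma chart_proj_continuous:
  assumes "(V, \<psi>) \<in> B"
  shows "continuous_on {x \<in> punctured. \<pi> x \<in> V} (\<lambda>x. \<psi> (\<pi> x))"
proof -
  have "continuous_map (subtopology punctured_top {x \<in> punctured. \<pi> x \<in> V}) (subtopology X V) \<pi>"
    using continuous_map_from_subtopology[OF proj_continuous] by (auto simp: continuous_map_in_subtopology)
  then have "continuous_map (subtopology punctured_top {x \<in> punctured. \<pi> x \<in> V}) (top_of_set (\<psi> ` V)) (\<psi> \<circ> \<pi>)"
    using homeomorphic_imp_continuous_map[OF chart_B(4)[OF assms]] continuous_map_compose by blast
  moreover have "subtopology punctured_top {x \<in> punctured. \<pi> x \<in> V} = top_of_set {x \<in> punctured. \<pi> x \<in> V}"
    by (simp add: subtopology_subtopology Int_absorb1 Collect_mono_iff)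
  ultimately show ?thesis by (simp add: continuous_map_in_subtopology o_def)
qed

lemma chart_proj_image_open:
  assumes V: "(V, \<psi>) \<in> B" and M: "open M" "M \<subseteq> {x \<in> punctured. \<pi> x \<in> V}"
  shows "open ((\<lambda>x. \<psi> (\<pi> x)) ` M)"
proof -
  have "openin X (\<pi> ` M)" using M by (intro open_image) auto
  moreover have "\<pi> ` M \<subseteq> V" using M by auto
  ultimately have "openin (subtopology X V) (\<pi> ` M)"
    by (simp add: openin_open_subtopology[OF chart_B(1)[OF V]])
  then have "openin (top_of_set (\<psi> ` V)) (\<psi> ` \<pi> ` M)"
    using homeomorphic_imp_open_map[OF chart_B(4)[OF V]] by (simp add: open_map_def)
  then show ?thesis using chart_B(2)[OF V] by (simp add: openin_open_eq image_image)
qed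

definition developed_on where
  "developed_on M g V \<psi> T \<longleftrightarrow> open M \<and> M \<subseteq> {x \<in> punctured. \<pi> x \<in> V} \<and> (V, \<psi>) \<in> B \<and>
    T \<in> affine_bijections \<and> (\<forall>y\<in>M. g y = T (\<psi> (\<pi> y)))"

text \<open>Locally g is a chart of \<open>B\<close>, read on the covering space and followed by an
  affine bijection. The affine factor is part of the notion so that affine maps act on such
  g.\<close>

definition develops :: "(quat \<times> quat) set \<Rightarrow> (quat \<times> quat \<Rightarrow> quat \<times> quat) \<Rightarrow> bool" where
  "develops U g \<longleftrightarrow> (\<forall>x\<in>U. \<exists>M V \<psi> T. x \<in> M \<and> M \<subseteq> U \<and> developed_on M g V \<psi> T)"

lemma developsE:
  assumes "develops U g" "x \<in> U"
  obtains M V \<psi> T where "open M" "x \<in> M" "M \<subseteq> U" "(V, \<psi>) \<in> B" "T \<in> affine_bijections"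
    "M \<subseteq> {x \<in> punctured. \<pi> x \<in> V}" "\<forall>y\<in>M. g y = T (\<psi> (\<pi> y))"
  using bspec[OF assms[unfolded develops_def]] unfolding developed_on_def
  by (elim exE conjE) (rule that, assumption+)

lemma developsI:
  assumes "\<And>x. x \<in> U \<Longrightarrow> \<exists>M V \<psi> T. x \<in> M \<and> developed_on M g V \<psi> T" "open U"
  shows "develops U g"
  unfolding develops_def
proof
  fix x assume "x \<in> U"
  from assms(1)[OF this] obtain M V \<psi> T where M: "x \<in> M" "developed_on M g V \<psi> T" by (elim exE conjE)
  then have "developed_on (M \<inter> U) g V \<psi> T" using assms(2) by (auto simp: developed_on_def)
  with M(1) \<open>x \<in> U\<close> show "\<exists>M V \<psi> T. x \<in> M \<and> M \<subseteq> U \<and> developed_on M g V \<psi> T"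
    by (intro exI[of _ "M \<inter> U"]) auto
qed

lemma developed_at:
  assumes "x \<in> U" "develops U g"
  shows "\<exists>M V \<psi> T. x \<in> M \<and> developed_on M g V \<psi> T"
  using bspec[OF assms(2)[unfolded develops_def] assms(1)] by (elim exE conjE) (intro exI conjI)

lemma develops_map:
  assumes "develops U g" and map: "\<And>M V \<psi> T. M \<subseteq> U \<Longrightarrow> developed_on M g V \<psi> T \<Longrightarrow> developed_on M g' V \<psi> (F T)"
  shows "develops U g'"
  unfolding develops_def
proof
  fix x assume "x \<in> U"
  from bspec[OF assms(1)[unfolded develops_def] this] obtain M V \<psi> T where
    "x \<in> M" "M \<subseteq> U" "developed_on M g V \<psi> T" by (elim exE conjE)
  with map show "\<exists>M V \<psi> T. x \<in> M \<and> M \<subseteq> U \<and> developed_on M g' V \<psi> T" by (intro exI conjI)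
qed

text \<open>Uniqueness up to the group is the affinity of the changes of charts. Freeness holds
  because charts have open images and an affine map is determined by its values on a nonempty open
  set.\<close>

lemma torsor_develops: "torsor_sheaf develops affine_bijections punctured"
proof
  fix U g assume U: "open U" "\<And>x. x \<in> U \<Longrightarrow> \<exists>N. open N \<and> x \<in> N \<and> N \<subseteq> U \<and> develops N g"
  show "develops U g"
  proof (rule developsI[OF _ U(1)])
    fix x assume "x \<in> U"
    then obtain N where "x \<in> N" "develops N g" using U(2) by blast
    then show "\<exists>M V \<psi> T. x \<in> M \<and> developed_on M g V \<psi> T" by (rule developed_at)
  qed
next
  fix U V :: "(quat \<times> quat) set" and g assume g: "develops U g" and V: "open V" "V \<subseteq> U"
  show "develops V g"
    by (rule developsI[OF _ V(1)]) (rule developed_at[OF subsetD[OF V(2)] g])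
next
  fix U g g' assume g: "develops U g" and eq: "\<And>x. x \<in> U \<Longrightarrow> g x = g' x"
  have "developed_on M g' V \<psi> T" if "M \<subseteq> U" "developed_on M g V \<psi> T" for M V \<psi> T
  proof -
    have "g' y = g y" if "y \<in> M" for y using eq[OF subsetD[OF \<open>M \<subseteq> U\<close> that]] by simp
    then show ?thesis using that(2) by (simp add: developed_on_def)
  qed
  with g show "develops U g'" by (rule develops_map)
next
  fix U g S assume g: "develops U g" and S: "S \<in> affine_bijections"
  have "developed_on M (S \<circ> g) V \<psi> (S \<circ> T)" if "developed_on M g V \<psi> T" for M V \<psi> T
    using that affine_bijections_group(2)[OF S] by (simp add: developed_on_def)
  with g show "develops U (S \<circ> g)" by (rule develops_map)
next
  fix U g1 g2 x
  assume U: "open U" and g: "develops U g1" "develops U g2" and x: "x \<in> U"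
  from g(1) x obtain N1 V1 \<psi>1 T1 where 1: "open N1" "x \<in> N1" "N1 \<subseteq> U" "(V1, \<psi>1) \<in> B" "T1 \<in> affine_bijections"
    "N1 \<subseteq> {x \<in> punctured. \<pi> x \<in> V1}" "\<forall>y\<in>N1. g1 y = T1 (\<psi>1 (\<pi> y))" by (rule developsE)
  from g(2) x obtain N2 V2 \<psi>2 T2 where 2: "open N2" "x \<in> N2" "N2 \<subseteq> U" "(V2, \<psi>2) \<in> B" "T2 \<in> affine_bijections"
    "N2 \<subseteq> {x \<in> punctured. \<pi> x \<in> V2}" "\<forall>y\<in>N2. g2 y = T2 (\<psi>2 (\<pi> y))" by (rule developsE)
  have pV: "\<pi> y \<in> V1" "\<pi> y \<in> V2" if "y \<in> N1 \<inter> N2" for y using that 1(6) 2(6) by auto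
  have "\<psi>1 (\<pi> x) \<in> \<psi>1 ` (V1 \<inter> V2)" using 1(2) 2(2) pV by auto
  from affine_atlasD[OF affine 1(4) 2(4) this]
  obtain M S where M: "open M" "\<psi>1 (\<pi> x) \<in> M" "M \<subseteq> \<psi>1 ` (V1 \<inter> V2)" "affine_transformation S"
    "\<forall>y\<in>M. (\<psi>2 \<circ> inv_into V1 \<psi>1) y = S y" by (elim exE conjE)
  have inv1: "inv_into V1 \<psi>1 (\<psi>1 v) = v" if "v \<in> V1" for v
    using inv_into_f_f[OF chart_B(3)[OF 1(4)] that] .
  \<comment> \<open>The atlas only provides an affine map; being a change of charts, it is injective
    near the point and hence one of the affine bijections.\<close>
  have "inj_on S M"
  proof (rule inj_onI)
    fix a b assume ab: "a \<in> M" "b \<in> M" "S a = S b"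
    obtain u v where uv: "u \<in> V1 \<inter> V2" "a = \<psi>1 u" "v \<in> V1 \<inter> V2" "b = \<psi>1 v" using ab(1,2) M(3) by blast
    have "\<psi>2 u = \<psi>2 v" using bspec[OF M(5) ab(1)] bspec[OF M(5) ab(2)] ab(3) uv inv1 by simp
    then show "a = b" using inj_onD[OF chart_B(3)[OF 2(4)]] uv by blast
  qed
  then have S: "S \<in> affine_bijections" by (rule affine_inj_imp_bij[OF M(4,1,2)])
  define N where "N = N1 \<inter> N2 \<inter> (\<lambda>y. \<psi>1 (\<pi> y)) -` M"
  have "continuous_on (N1 \<inter> N2) (\<lambda>y. \<psi>1 (\<pi> y))"
    using chart_proj_continuous[OF 1(4)] by (rule continuous_on_subset) (use 1(6) in auto)
  then have "open N"
    using 1(1) 2(1) M(1) continuous_on_open_vimage[of "N1 \<inter> N2" "\<lambda>y. \<psi>1 (\<pi> y)"]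
    unfolding N_def by (metis Int_commute open_Int)
  moreover have "g2 y = (T2 \<circ> S \<circ> inv_into UNIV T1) (g1 y)" if y: "y \<in> N" for y
  proof -
    have "inv_into UNIV T1 (g1 y) = \<psi>1 (\<pi> y)"
      using 1(5,7) y by (simp add: N_def affine_bijections_def bij_is_inj)
    moreover have "S (\<psi>1 (\<pi> y)) = \<psi>2 (\<pi> y)"
      using bspec[OF M(5), of "\<psi>1 (\<pi> y)"] inv1[of "\<pi> y"] pV[of y] y by (simp add: N_def)
    ultimately show ?thesis using 2(7) y by (simp add: N_def)
  qed
  moreover have "T2 \<circ> S \<circ> inv_into UNIV T1 \<in> affine_bijections"
    using affine_bijections_group 1(5) 2(5) S by blast
  moreover have "x \<in> N" "N \<subseteq> U" using 1(2,3) 2(2) M(2) by (auto simp: N_def)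
  ultimately show "\<exists>T\<in>affine_bijections. \<exists>N. open N \<and> x \<in> N \<and> N \<subseteq> U \<and> (\<forall>y\<in>N. g2 y = T (g1 y))" by blast
next
  fix U g S T
  assume U: "open U" "U \<noteq> {}" and g: "develops U g" and ST: "S \<in> affine_bijections" "T \<in> affine_bijections"
    and eq: "\<forall>y\<in>U. S (g y) = T (g y)"
  from U obtain x where x: "x \<in> U" by blast
  from g x obtain N V \<psi> R where N: "open N" "x \<in> N" "N \<subseteq> U" "(V, \<psi>) \<in> B" "R \<in> affine_bijections"
    "N \<subseteq> {x \<in> punctured. \<pi> x \<in> V}" "\<forall>y\<in>N. g y = R (\<psi> (\<pi> y))" by (rule developsE)
  have "S \<circ> R = T \<circ> R"
  proof (rule affine_eq_on_open[OF _ _ chart_proj_image_open[OF N(4,1,6)]])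
    show "affine_transformation (S \<circ> R)" "affine_transformation (T \<circ> R)"
      using ST N(5) by (auto simp: affine_bijections_def affine_compose)
    show "\<psi> (\<pi> x) \<in> (\<lambda>x. \<psi> (\<pi> x)) ` N" using N(2) by blast
    fix y assume "y \<in> (\<lambda>x. \<psi> (\<pi> x)) ` N"
    then obtain z where z: "z \<in> N" "y = \<psi> (\<pi> z)" by (rule imageE)
    then show "(S \<circ> R) y = (T \<circ> R) y" using bspec[OF eq subsetD[OF N(3) z(1)]] bspec[OF N(7) z(1)] by simp
  qed
  moreover have "surj R" using N(5) by (simp add: affine_bijections_def bij_is_surj)
  ultimately show "S = T" by (metis surj_fun_eq)
next
  fix x :: "quat \<times> quat" assume x: "x \<in> punctured"
  have "\<pi> x \<in> (\<Union>(U, \<phi>)\<in>B. U)"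
    using affine x topspace_X unfolding affine_atlas_def slice_atlas_def by auto
  then obtain V \<psi> where V: "(V, \<psi>) \<in> B" "\<pi> x \<in> V" by auto
  have "developed_on {x \<in> punctured. \<pi> x \<in> V} (\<lambda>x. \<psi> (\<pi> x)) V \<psi> id"
    using open_chart_domain[OF V(1)] V(1) affine_bijections_group(1) by (simp add: developed_on_def)
  then have "develops {x \<in> punctured. \<pi> x \<in> V} (\<lambda>x. \<psi> (\<pi> x))"
    unfolding develops_def by (intro ballI exI conjI) auto
  then show "\<exists>U g. open U \<and> x \<in> U \<and> develops U g"
    using open_chart_domain[OF V(1)] V(2) x by blast
qed

text \<open>As f does not change orbits, \<open>g \<circ> f\<close> develops the same atlas, and
  over the connected punctured space it differs from g by a single affine map.\<close>

lemma developing_map_exists: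
  "\<exists>g T. develops punctured g \<and> affine_transformation T \<and> (\<forall>x\<in>punctured. g (f x) = T (g x))"
proof -
  interpret torsor_sheaf develops affine_bijections punctured by (rule torsor_develops)
  have p: "punctured = - {0}" by (simp add: punctured_def zero_prod_def)
  have "good punctured"
    unfolding p by (rule good_punctured) (simp_all add: Basis_quat_def p[symmetric])
  then obtain g where g: "develops punctured g" by (auto simp: good_def)
  have fk1: "f x = fk 1 x" for x by (simp add: int_iterate_def)
  have "develops punctured (g \<circ> f)"
  proof (rule developsI[OF _ open_punctured])
    fix x assume "x \<in> punctured"
    then have "f x \<in> punctured" by (simp add: fk1 fk_punctured_iff)
    with g obtain N V \<psi> T where N: "open N" "f x \<in> N" "N \<subseteq> punctured" "(V, \<psi>) \<in> B" "T \<in> affine_bijections"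
      "N \<subseteq> {x \<in> punctured. \<pi> x \<in> V}" "\<forall>y\<in>N. g y = T (\<psi> (\<pi> y))" by (rule developsE)
    have "developed_on (f -` N) (g \<circ> f) V \<psi> T"
      unfolding developed_on_def
    proof (intro conjI ballI subsetI)
      show "open (f -` N)" using N(1) cont(1) by (rule open_vimage)
      fix y assume "y \<in> f -` N"
      then have y: "f y \<in> N" by simp
      have "f y \<in> {x \<in> punctured. \<pi> x \<in> V}" by (rule subsetD[OF N(6) y])
      moreover have f: "\<pi> (f y) = \<pi> y" "f y \<in> punctured \<longleftrightarrow> y \<in> punctured"
        by (simp_all add: fk1 fk_punctured_iff)
      ultimately show "y \<in> {x \<in> punctured. \<pi> x \<in> V}" by (simp only: mem_Collect_eq f simp_thms)
      show "(g \<circ> f) y = T (\<psi> (\<pi> y))" using bspec[OF N(7) y] by (simp only: o_apply f)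
    qed (rule N)+
    then show "\<exists>M V \<psi> T. x \<in> M \<and> developed_on M (g \<circ> f) V \<psi> T"
      using N(2) by (intro exI[of _ "f -` N"]) auto
  qed
  moreover have "connected punctured"
    using simply_connected_punctured by (rule simply_connected_imp_connected)
  moreover have "punctured \<noteq> {}" by (auto simp: punctured_def intro: exI[of _ "1 :: quat"])
  ultimately obtain T where "T \<in> affine_bijections" "\<forall>x\<in>punctured. (g \<circ> f) x = T (g x)"
    using adm_connected[OF open_punctured _ g] by blast
  then show ?thesis using g by (auto simp: affine_bijections_def)
qed

lemma develops_locally_injective:
  assumes "develops punctured g" "x \<in> punctured"
  shows "\<exists>M. open M \<and> x \<in> M \<and> inj_on g M"
proof -
  from assms obtain N V \<psi> T where N: "open N" "x \<in> N" "N \<subseteq> punctured" "(V, \<psi>) \<in> B" "T \<in> affine_bijections"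
    "N \<subseteq> {x \<in> punctured. \<pi> x \<in> V}" "\<forall>y\<in>N. g y = T (\<psi> (\<pi> y))" by (rule developsE)
  obtain r R where r: "0 < r" "c * R \<le> r" "x \<in> shell r R" using shell_exists assms(2) by blast
  have "inj_on g (N \<inter> shell r R)"
  proof (rule inj_onI)
    fix y z assume yz: "y \<in> N \<inter> shell r R" "z \<in> N \<inter> shell r R" "g y = g z"
    then have "T (\<psi> (\<pi> y)) = T (\<psi> (\<pi> z))" using N(7) by simp
    then have "\<psi> (\<pi> y) = \<psi> (\<pi> z)"
      using N(5) by (simp add: affine_bijections_def bij_is_inj inj_eq)
    then have "\<pi> y = \<pi> z" using inj_onD[OF chart_B(3)[OF N(4)]] yz N(6) by blast
    then show "y = z" using inj_onD[OF inj_on_shell[OF r(2)]] yz by blast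
  qed
  then show ?thesis using N(1,2) open_shell r(3) by (intro exI[of _ "N \<inter> shell r R"]) auto
qed

text \<open>The assumption that \<open>B\<close> defines the same structure enters here: a chart of
  \<open>B\<close>, written in the chart given by a shell, is slice regular, and the linear part of
  an affine map preserves linearity for left multiplication by J.\<close>

lemma develops_slice_holomorphic:
  assumes g: "develops punctured g" and J: "J \<in> imag_units"
    and z: "(emb J (fst z), emb J (snd z)) \<in> punctured"
  shows "\<exists>L. ((\<lambda>z. g (emb J (fst z), emb J (snd z))) has_derivative L) (at z) \<and>
    (\<forall>v. L (\<i> * fst v, \<i> * snd v) = lmul J (L v))"
proof -
  define E where "E z = (emb J (fst z), emb J (snd z))" for z
  have contE: "continuous_on UNIV E" unfolding E_def by (intro continuous_intros)
  from g z obtain N V \<psi> T where N: "open N" "E z \<in> N" "N \<subseteq> punctured" "(V, \<psi>) \<in> B" "T \<in> affine_bijections"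
    "N \<subseteq> {x \<in> punctured. \<pi> x \<in> V}" "\<forall>y\<in>N. g y = T (\<psi> (\<pi> y))"
    unfolding E_def[symmetric] by (rule developsE)
  obtain r R where r: "0 < r" "c * R \<le> r" "E z \<in> shell r R"
    using shell_exists z unfolding E_def by blast
  let ?W = "shell r R"
  have W: "?W \<subseteq> punctured" "circular ?W" "inj_on \<pi> ?W"
    using shell_punctured[of r R] r(1) circular_shell inj_on_shell[OF r(2)] by auto
  then have "(\<pi> ` ?W, inv_into ?W \<pi>) \<in> \<A>" unfolding in_atlas by blast
  moreover have "slice_map X \<A> X B id" using same by (simp add: same_slice_structure_def)
  ultimately have "slice_regular_on (inv_into ?W \<pi> ` (\<pi> ` ?W \<inter> id -` V))
      (\<psi> \<circ> id \<circ> inv_into (\<pi> ` ?W) (inv_into ?W \<pi>))"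
    using N(4) unfolding slice_map_def Ball_case_prod_iff by blast
  then have sr: "slice_regular_on {v \<in> ?W. \<pi> v \<in> V} (\<psi> \<circ> inv_into (\<pi> ` ?W) (inv_into ?W \<pi>))"
    by (simp add: section_image[OF W(3)])
  have "(emb J (fst z), emb J (snd z)) \<in> {v \<in> ?W. \<pi> v \<in> V}"
    using N(2,6) r(3) by (auto simp: E_def)
  from slice_regular_on_derivative[OF sr J this] obtain L where
    L: "((\<lambda>z. (\<psi> \<circ> inv_into (\<pi> ` ?W) (inv_into ?W \<pi>)) (E z)) has_derivative L) (at z)"
    "\<And>v. L (\<i> * fst v, \<i> * snd v) = (J * fst (L v), J * snd (L v))" unfolding E_def by blast
  let ?M = "\<lambda>v. T v - T 0"
  have M: "left_linear ?M" using N(5) by (simp add: affine_bijections_def affine_transformation_iff)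
  have bM: "bounded_linear ?M"
    using left_linear_imp_linear[OF M] by (simp add: linear_conv_bounded_linear)
  have "((\<lambda>z. ?M ((\<psi> \<circ> inv_into (\<pi> ` ?W) (inv_into ?W \<pi>)) (E z)) + T 0) has_derivative (\<lambda>v. ?M (L v))) (at z)"
    using has_derivative_add_const[OF bounded_linear.has_derivative[OF bM L(1)]] .
  moreover have "open (E -` (N \<inter> ?W))" using N(1) open_shell contE by (intro open_vimage) auto
  ultimately have "((\<lambda>z. g (E z)) has_derivative (\<lambda>v. ?M (L v))) (at z)"
  proof (rule has_derivative_transform_within_open)
    show "z \<in> E -` (N \<inter> ?W)" using N(2) r(3) by simp
    fix y assume "y \<in> E -` (N \<inter> ?W)"
    then show "?M ((\<psi> \<circ> inv_into (\<pi> ` ?W) (inv_into ?W \<pi>)) (E y)) + T 0 = g (E y)"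
      using N(7) inv_section[OF W(3), of "E y"] by simp
  qed
  moreover have "?M (L (\<i> * fst v, \<i> * snd v)) = lmul J (?M (L v))" for v
    using left_linearD(2)[OF M, of J "L v"] L(2)[of v] by (simp add: lmul_def)
  ultimately show ?thesis unfolding E_def by blast
qed

end

section \<open>Power series on slices\<close>

lemma real_power_series_unique:
  fixes a :: "nat \<Rightarrow> 'a::euclidean_space"
  assumes "\<And>t :: real. t \<noteq> 0 \<Longrightarrow> (\<lambda>d. t ^ d *\<^sub>R a d) sums 0"
  shows "a d = 0"
proof (rule euclidean_eqI)
  fix u :: 'a
  define c where "c n = a n \<bullet> u" for n
  have s: "(\<lambda>d. t ^ d * c d) sums 0" if "t \<noteq> 0" for t
    using bounded_linear.sums[OF bounded_linear_inner_left assms[OF that], of u] by (simp add: c_def)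
  have "c d = 0"
  proof (induction d rule: less_induct)
    case (less d)
    have "(\<lambda>n. c (n + d) * t ^ n) sums 0" if t: "t \<noteq> 0" for t
    proof -
      have "(\<lambda>n. t ^ (n + d) * c (n + d)) sums 0"
        using sums_iff_shift[of "\<lambda>d. t ^ d * c d" d 0] s[OF t] less by simp
      then have "(\<lambda>n. inverse (t ^ d) * (t ^ (n + d) * c (n + d))) sums (inverse (t ^ d) * 0)"
        by (rule sums_mult)
      moreover have "inverse (t ^ d) * (t ^ (n + d) * c (n + d)) = c (n + d) * t ^ n" for n
        using t by (simp add: power_add field_simps)
      ultimately show ?thesis by simp
    qed
    then have "((\<lambda>x. 0) \<longlongrightarrow> c (0 + d)) (at (0 :: real))"
      by (intro powser_limit_0_strong[of 1 "\<lambda>n. c (n + d)" "\<lambda>x. 0"]) auto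
    then have "c (0 + d) = 0" by (rule tendsto_unique[OF at_neq_bot _ tendsto_const])
    then show "c d = 0" by simp
  qed
  then show "a d \<bullet> u = 0 \<bullet> u" by (simp add: c_def)
qed

definition sm :: "quat \<Rightarrow> complex \<Rightarrow> quat \<times> quat \<Rightarrow> quat \<times> quat" where
  "sm J t v = lmul (emb J t) v"

text \<open>The complex coordinate of v along u when J acts on the left as the imaginary unit. It
  reduces statements about maps into the quaternionic plane to scalar complex analysis.\<close>

definition cmp :: "quat \<Rightarrow> quat \<times> quat \<Rightarrow> quat \<times> quat \<Rightarrow> complex" where
  "cmp J u v = Complex (v \<bullet> u) (v \<bullet> lmul J u)"

lemma norm_lmul: "norm (lmul q v) = norm q * norm v"
proof -
  have "(norm q * norm (fst v))\<^sup>2 + (norm q * norm (snd v))\<^sup>2 = (norm q)\<^sup>2 * ((norm (fst v))\<^sup>2 + (norm (snd v))\<^sup>2)"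
    by (simp add: power_mult_distrib algebra_simps)
  then show ?thesis
    by (cases v) (simp add: lmul_def norm_Pair norm_mult real_sqrt_mult)
qed

lemma linear_lmul: "linear (lmul q)"
  by (rule linearI) (auto simp: lmul_def scaleR_conv_of_real quat_of_real_commute[of _ q] algebra_simps
      simp flip: mult.assoc)

lemma linear_lmul_left: "linear (\<lambda>q. lmul q v)"
  by (rule linearI) (auto simp: lmul_def algebra_simps)

lemma inner_lmul:
  assumes J: "J \<in> imag_units"
  shows "lmul J u \<bullet> v = - (u \<bullet> lmul J v)" "lmul J u \<bullet> lmul J v = u \<bullet> v"
proof -
  have re: "qre J = 0" using J by (simp add: imag_units_iff)
  have "(J * x) \<bullet> y = - (x \<bullet> (J * y))" for x y :: quat
    using re by (simp add: inner_quat_def algebra_simps)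
  then show *: "lmul J u \<bullet> v = - (u \<bullet> lmul J v)" for u v
    by (cases u; cases v) (simp add: lmul_def)
  have JJ: "lmul J (lmul J v) = - v" by (simp add: lmul_def imag_units_sq_left[OF J] prod_eq_iff)
  have "lmul J u \<bullet> lmul J v = - (u \<bullet> lmul J (lmul J v))" by (rule *)
  then show "lmul J u \<bullet> lmul J v = u \<bullet> v" unfolding JJ by simp
qed

lemma sm_simps:
  assumes "J \<in> imag_units"
  shows "sm J (s * t) v = sm J s (sm J t v)" "sm J 1 v = v" "sm J (of_real r) v = r *\<^sub>R v"
    "sm J (s + t) v = sm J s v + sm J t v" "sm J 0 v = 0" "sm J t 0 = 0"
    "sm J t (u + v) = sm J t u + sm J t v" "sm J t (u - v) = sm J t u - sm J t v"
    "norm (sm J t v) = cmod t * norm v"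
  using assms by (simp_all add: sm_def emb_simps emb_mult lmul_simps norm_lmul norm_emb)

lemma bounded_linear_sm: "bounded_linear (\<lambda>t. sm J t v)" "bounded_linear (\<lambda>v. sm J t v)"
  unfolding sm_def
  using linear_compose[OF linear_emb linear_lmul_left] linear_lmul
  by (simp_all add: linear_conv_bounded_linear o_def)

lemma linear_cmp: "linear (cmp J u)"
  by (rule linearI) (simp_all add: cmp_def inner_add_left complex_eq_iff)

lemma bounded_linear_cmp: "bounded_linear (cmp J u)"
  using linear_cmp by (simp add: linear_conv_bounded_linear)

lemma cmp_lmul: "J \<in> imag_units \<Longrightarrow> cmp J u (lmul J v) = \<i> * cmp J u v"
  by (simp add: cmp_def complex_eq_iff inner_lmul(1)[of J v u] inner_lmul(2)[of J v u])

lemma norm_cmp_le: "J \<in> imag_units \<Longrightarrow> norm u = 1 \<Longrightarrow> cmod (cmp J u v) \<le> 2 * norm v"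
proof -
  assume J: "J \<in> imag_units" and u: "norm u = 1"
  have "cmod (cmp J u v) \<le> \<bar>v \<bullet> u\<bar> + \<bar>v \<bullet> lmul J u\<bar>"
    using cmod_le[of "cmp J u v"] by (simp add: cmp_def)
  also have "\<dots> \<le> norm v * norm u + norm v * norm (lmul J u)"
    by (intro add_mono Cauchy_Schwarz_ineq2)
  finally show ?thesis using u J by (simp add: norm_lmul imag_units_iff)
qed

text \<open>The basis vectors u and their multiples \<open>lmul J u\<close> are two orthonormal
  bases over the reals, so the sum represents v twice; hence the factor 1/2.\<close>

lemma cmp_reconstruct:
  assumes J: "J \<in> imag_units"
  shows "v = (1/2) *\<^sub>R (\<Sum>u\<in>Basis. sm J (cmp J u v) u)"
proof -
  have 1: "(\<Sum>u\<in>Basis. (v \<bullet> u) *\<^sub>R u) = v" for v :: "quat \<times> quat" by (rule euclidean_representation)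
  have "(\<Sum>u\<in>Basis. (v \<bullet> lmul J u) *\<^sub>R lmul J u) = lmul J (\<Sum>u\<in>Basis. (- lmul J v \<bullet> u) *\<^sub>R u)"
    using J by (simp add: linear_sum[OF linear_lmul] linear_scale[OF linear_lmul] inner_lmul)
  also have "\<dots> = lmul J (- lmul J v)" unfolding 1 ..
  also have "\<dots> = v" using J by (simp add: lmul_def imag_units_sq_left)
  finally have 2: "(\<Sum>u\<in>Basis. (v \<bullet> lmul J u) *\<^sub>R lmul J u) = v" .
  have "sm J (cmp J u v) u = (v \<bullet> u) *\<^sub>R u + (v \<bullet> lmul J u) *\<^sub>R lmul J u" for u
    unfolding sm_def cmp_def emb_def by (simp add: lmul_simps)
  then show ?thesis by (simp add: sum.distrib 1 2)
qed

text \<open>The 4 is half the number of the eight basis vectors.\<close>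

lemma norm_le_cmp:
  assumes J: "J \<in> imag_units" and B: "\<And>u. u \<in> Basis \<Longrightarrow> cmod (cmp J u v) \<le> B"
  shows "norm v \<le> 4 * B"
proof -
  have "norm v = (1/2) * norm (\<Sum>u\<in>Basis. sm J (cmp J u v) u)"
    by (subst cmp_reconstruct[OF J, of v]) simp
  also have "norm (\<Sum>u\<in>Basis. sm J (cmp J u v) u) \<le> (\<Sum>u\<in>(Basis :: (quat \<times> quat) set). B)"
    by (rule sum_norm_le) (simp add: sm_simps[OF J] B)
  finally show ?thesis by (simp add: Basis_quat_def)
qed

text \<open>Each coordinate extends over 0 by Riemann's theorem and is then entire. Cauchy's
  estimate on the unit circle bounds its coefficients by \<open>2 * B\<close>, and reassembling
  costs another factor 4. The explicit bound will be applied to differences, to show that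
  coefficients vary continuously.\<close>

lemma slice_power_series:
  assumes J: "J \<in> imag_units"
    and hol: "\<And>u. u \<in> Basis \<Longrightarrow> (\<lambda>t. cmp J u (h t)) holomorphic_on - {0}"
    and bd: "\<forall>\<^sub>F t in at 0. norm (h t) \<le> C"
    and B: "\<And>t. cmod t = 1 \<Longrightarrow> norm (h t) \<le> B"
  shows "\<exists>a. (\<forall>t. t \<noteq> 0 \<longrightarrow> (\<lambda>d. sm J (t ^ d) (a d)) sums h t) \<and> (\<forall>d. norm (a d) \<le> 8 * B)"
proof -
  have ex: "\<exists>F. F holomorphic_on UNIV \<and> (\<forall>t\<in>UNIV - {0}. F t = cmp J u (h t))" if u: "u \<in> Basis" for u
  proof -
    have nu: "norm u = 1" using u by simp
    have "\<forall>\<^sub>F t in at 0. norm (cmp J u (h t)) \<le> 2 * C"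
    proof (rule eventually_mono[OF bd])
      fix t assume "norm (h t) \<le> C"
      then show "norm (cmp J u (h t)) \<le> 2 * C" using norm_cmp_le[OF J nu, of "h t"] by linarith
    qed
    then show ?thesis
      using holomorphic_on_extend_bounded[of "\<lambda>t. cmp J u (h t)" UNIV 0] hol[OF u]
      by (auto simp: Compl_eq_Diff_UNIV)
  qed
  then obtain F where F: "\<And>u. u \<in> Basis \<Longrightarrow> F u holomorphic_on UNIV"
    "\<And>u t. u \<in> Basis \<Longrightarrow> t \<noteq> 0 \<Longrightarrow> F u t = cmp J u (h t)" by (metis DiffI UNIV_I singletonD)
  define c where "c u d = (deriv ^^ d) (F u) 0 / fact d" for u d
  define a where "a d = (1/2) *\<^sub>R (\<Sum>u\<in>Basis. sm J (c u d) u)" for d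
  have sums: "(\<lambda>d. c u d * t ^ d) sums F u t" if "u \<in> Basis" for u t
    using holomorphic_power_series[of "F u" 0 "cmod t + 1" t] holomorphic_on_subset[OF F(1)[OF that]]
    by (simp add: c_def)
  have "(\<lambda>d. sm J (t ^ d) (a d)) sums h t" if t: "t \<noteq> 0" for t
  proof -
    have "(\<lambda>d. (1/2) *\<^sub>R (\<Sum>u\<in>Basis. sm J (c u d * t ^ d) u)) sums ((1/2) *\<^sub>R (\<Sum>u\<in>Basis. sm J (F u t) u))"
      using sums by (intro bounded_linear.sums[OF bounded_linear_scaleR_right] sums_sum
          bounded_linear.sums[OF bounded_linear_sm(1)])
    moreover have "(1/2) *\<^sub>R (\<Sum>u\<in>Basis. sm J (F u t) u) = h t"
      using cmp_reconstruct[OF J, of "h t"] F(2) t by simp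
    moreover have "(1/2) *\<^sub>R (\<Sum>u\<in>Basis. sm J (c u d * t ^ d) u) = sm J (t ^ d) (a d)" for d
      unfolding a_def using J
      by (simp add: linear_scale[OF bounded_linear.linear[OF bounded_linear_sm(2)]]
          linear_sum[OF bounded_linear.linear[OF bounded_linear_sm(2)]] sm_simps mult.commute
          flip: sm_simps(1))
    ultimately show ?thesis by simp
  qed
  moreover have "norm (a d) \<le> 8 * B" for d
  proof -
    have cd: "cmod (c u d) \<le> 2 * B" if u: "u \<in> Basis" for u
    proof -
      have "norm ((deriv ^^ d) (F u) 0) \<le> fact d * (2 * B) / 1 ^ d"
      proof (rule Cauchy_inequality)
        show "F u holomorphic_on ball 0 1" "continuous_on (cball 0 1) (F u)"
          using holomorphic_on_subset[OF F(1)[OF u]] holomorphic_on_imp_continuous_on by blast+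
        fix x :: complex assume "norm (0 - x) = 1"
        then have "cmod x = 1" "x \<noteq> 0" by auto
        then show "norm (F u x) \<le> 2 * B"
          using norm_cmp_le[OF J, of u "h x"] B[of x] u F(2)[of u x] by auto
      qed simp
      then show ?thesis by (simp add: c_def norm_divide field_simps)
    qed
    have "norm (a d) = (1/2) * norm (\<Sum>u\<in>Basis. sm J (c u d) u)" by (simp add: a_def)
    also have "norm (\<Sum>u\<in>Basis. sm J (c u d) u) \<le> (\<Sum>u\<in>(Basis :: (quat \<times> quat) set). 2 * B)"
      by (rule sum_norm_le) (use cd in \<open>simp add: sm_simps[OF J]\<close>)
    finally show ?thesis by (simp add: Basis_quat_def)
  qed
  ultimately show ?thesis by blast
qed

text \<open>Only real t are used: on real scalars all slices act alike, so expansions from different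
  slices can be compared.\<close>

lemma slice_series_unique:
  assumes J: "J \<in> imag_units"
    and "\<And>t :: real. t \<noteq> 0 \<Longrightarrow> (\<lambda>d. sm J (of_real t ^ d) (a d)) sums h t"
      "\<And>t :: real. t \<noteq> 0 \<Longrightarrow> (\<lambda>d. sm J (of_real t ^ d) (b d)) sums h t"
  shows "a d = b d"
proof -
  have "a d - b d = 0"
  proof (rule real_power_series_unique)
    fix t :: real assume "t \<noteq> 0"
    from sums_diff[OF assms(2)[OF this] assms(3)[OF this]]
    show "(\<lambda>d. t ^ d *\<^sub>R (a d - b d)) sums 0"
      by (simp add: sm_simps(3)[OF J] scaleR_diff_right flip: of_real_power)
  qed
  then show ?thesis by simp
qed

section \<open>Maps that are holomorphic on every slice\<close>

definition E :: "quat \<Rightarrow> complex \<times> complex \<Rightarrow> quat \<times> quat" where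
  "E J x = (emb J (fst x), emb J (snd x))"

lemma E_punctured: "J \<in> imag_units \<Longrightarrow> E J x \<in> punctured \<longleftrightarrow> x \<noteq> 0"
  by (cases x) (auto simp: E_def punctured_def emb_eq_0_iff zero_prod_def)

lemma continuous_E: "continuous_on S (E J)"
  unfolding E_def by (intro continuous_intros)

lemma E_inj: "J \<in> imag_units \<Longrightarrow> E J x = E J y \<longleftrightarrow> x = y"
  by (cases x; cases y) (simp add: E_def emb_inj)

locale slice_holomorphic_map =
  fixes g :: "quat \<times> quat \<Rightarrow> quat \<times> quat"
  assumes holomorphic: "J \<in> imag_units \<Longrightarrow> z \<noteq> 0 \<Longrightarrow>
    \<exists>L. ((\<lambda>z. g (E J z)) has_derivative L) (at z) \<and> (\<forall>v. L (\<i> * fst v, \<i> * snd v) = lmul J (L v))"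
begin

lemma continuous_slice: "J \<in> imag_units \<Longrightarrow> 0 \<notin> S \<Longrightarrow> continuous_on S (\<lambda>z. g (E J z))"
proof (intro continuous_at_imp_continuous_on ballI)
  fix z assume "J \<in> imag_units" "0 \<notin> S" "z \<in> S"
  then obtain L where "((\<lambda>z. g (E J z)) has_derivative L) (at z)" using holomorphic[of J z] by blast
  then show "isCont (\<lambda>z. g (E J z)) z" by (rule has_derivative_continuous)
qed

text \<open>Restriction to a holomorphic curve and projection to one coordinate leave a scalar
  function of one variable, to which the classical theorems apply.\<close>

lemma curve_holomorphic:
  assumes J: "J \<in> imag_units" and S: "open S"
    and x: "x holomorphic_on S" and y: "y holomorphic_on S" and nz: "\<And>t. t \<in> S \<Longrightarrow> (x t, y t) \<noteq> 0"
  shows "(\<lambda>t. cmp J u (g (E J (x t, y t)))) holomorphic_on S"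
  unfolding holomorphic_on_open[OF S]
proof
  fix t assume t: "t \<in> S"
  obtain x' y' where d: "(x has_field_derivative x') (at t)" "(y has_field_derivative y') (at t)"
    using x y t unfolding holomorphic_on_open[OF S] by blast
  obtain L where L: "((\<lambda>z. g (E J z)) has_derivative L) (at (x t, y t))"
    "\<forall>v. L (\<i> * fst v, \<i> * snd v) = lmul J (L v)" using holomorphic[OF J nz[OF t]] by blast
  have "((\<lambda>t. (x t, y t)) has_derivative (\<lambda>s. (x' * s, y' * s))) (at t)"
    using d unfolding has_field_derivative_def by (intro has_derivative_Pair)
  from has_derivative_compose[OF this L(1)]
  have "((\<lambda>t. g (E J (x t, y t))) has_derivative (\<lambda>s. L (x' * s, y' * s))) (at t)" .
  from bounded_linear.has_derivative[OF bounded_linear_cmp this]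
  have der: "((\<lambda>t. cmp J u (g (E J (x t, y t)))) has_derivative (\<lambda>s. cmp J u (L (x' * s, y' * s)))) (at t)" .
  have lin: "linear L" using has_derivative_linear[OF L(1)] .
  have "cmp J u (L (x' * s, y' * s)) = cmp J u (L (x', y')) * s" for s
  proof -
    have "(x' * s, y' * s) = Re s *\<^sub>R (x', y') + Im s *\<^sub>R (\<i> * x', \<i> * y')"
      by (simp add: complex_eq_iff)
    then have "L (x' * s, y' * s) = Re s *\<^sub>R L (x', y') + Im s *\<^sub>R L (\<i> * x', \<i> * y')"
      by (simp only: linear_add[OF lin] linear_scale[OF lin])
    moreover have "L (\<i> * x', \<i> * y') = lmul J (L (x', y'))" using L(2)[rule_format, of "(x', y')"] by simp
    ultimately have "L (x' * s, y' * s) = Re s *\<^sub>R L (x', y') + Im s *\<^sub>R lmul J (L (x', y'))" by (simp only:)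
    then have "cmp J u (L (x' * s, y' * s)) = Re s *\<^sub>R cmp J u (L (x', y')) + Im s *\<^sub>R (\<i> * cmp J u (L (x', y')))"
      by (simp add: linear_add[OF linear_cmp] linear_scale[OF linear_cmp] cmp_lmul[OF J])
    then show ?thesis by (simp add: complex_eq_iff algebra_simps)
  qed
  then have "(\<lambda>s. cmp J u (L (x' * s, y' * s))) = (*) (cmp J u (L (x', y')))" by auto
  with der show "\<exists>f'. ((\<lambda>t. cmp J u (g (E J (x t, y t)))) has_field_derivative f') (at t)"
    unfolding has_field_derivative_def by metis
qed

text \<open>The only part of Hartogs' extension theorem that is needed: on \<open>|z| \<le> 1\<close>, \<open>z \<noteq> 0\<close> the maximum
  principle in \<open>w\<close> bounds \<open>g\<close> by its values on the compact set \<open>|z| \<le> 1\<close>, \<open>|w| = 1\<close>.\<close>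

lemma bounded_near_0:
  assumes J: "J \<in> imag_units"
  shows "\<exists>M. \<forall>z w. (z, w) \<noteq> 0 \<longrightarrow> cmod z \<le> 1 \<longrightarrow> cmod w \<le> 1 \<longrightarrow> norm (g (E J (z, w))) \<le> M"
proof -
  let ?K = "cball (0 :: complex) 1 \<times> sphere (0 :: complex) 1"
  have "compact ((\<lambda>x. g (E J x)) ` ?K)"
    by (intro compact_continuous_image continuous_slice[OF J] compact_Times compact_cball compact_sphere)
      (auto simp: zero_prod_def)
  then obtain M where M: "\<And>x. x \<in> ?K \<Longrightarrow> norm (g (E J x)) \<le> M"
    using compact_imp_bounded bounded_iff by (metis imageI)
  have nz: "norm (g (E J (z, w))) \<le> 4 * (2 * M)" if z: "z \<noteq> 0" "cmod z \<le> 1" and w: "cmod w \<le> 1" for z w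
  proof (rule norm_le_cmp[OF J])
    fix u :: "quat \<times> quat" assume u: "u \<in> Basis"
    have hol: "(\<lambda>w. cmp J u (g (E J (z, w)))) holomorphic_on UNIV"
      using z by (intro curve_holomorphic[OF J]) (auto simp: zero_prod_def intro!: holomorphic_intros)
    show "cmod (cmp J u (g (E J (z, w)))) \<le> 2 * M"
    proof (rule maximum_modulus_frontier[of "\<lambda>w. cmp J u (g (E J (z, w)))" "cball 0 1"])
      show "(\<lambda>w. cmp J u (g (E J (z, w)))) holomorphic_on interior (cball 0 1)"
        "continuous_on (closure (cball 0 1)) (\<lambda>w. cmp J u (g (E J (z, w))))"
        using holomorphic_on_subset[OF hol] holomorphic_on_imp_continuous_on by blast+
      fix v :: complex assume "v \<in> frontier (cball 0 1)"
      then have "norm (g (E J (z, v))) \<le> M" using z by (intro M) simp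
      then show "cmod (cmp J u (g (E J (z, v)))) \<le> 2 * M"
        using norm_cmp_le[OF J, of u "g (E J (z, v))"] u by simp
    qed (use w in auto)
  qed
  have "norm (g (E J (z, w))) \<le> 8 * M" if x: "(z, w) \<noteq> 0" "cmod z \<le> 1" "cmod w \<le> 1" for z w
  proof (cases "z = 0")
    case False
    then show ?thesis using nz[OF _ x(2,3)] by simp
  next
    case True
    then have w: "w \<noteq> 0" using x by (simp add: zero_prod_def)
    have "continuous_on UNIV (\<lambda>z. g (E J (z, w)))"
    proof -
      have "continuous_on UNIV ((\<lambda>x. g (E J x)) \<circ> (\<lambda>z. (z, w)))"
        using w by (intro continuous_on_compose continuous_slice[OF J] continuous_intros) (auto simp: zero_prod_def)
      then show ?thesis by (simp add: o_def)
    qed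
    then have "((\<lambda>z. norm (g (E J (z, w)))) \<longlongrightarrow> norm (g (E J (0, w)))) (at 0)"
      by (intro tendsto_norm) (simp add: continuous_on_def)
    moreover have "\<forall>\<^sub>F z in at 0. norm (g (E J (z, w))) \<le> 8 * M"
      unfolding eventually_at using nz[OF _ _ x(3)] by (intro exI[of _ 1]) auto
    ultimately have "norm (g (E J (0, w))) \<le> 8 * M" by (rule tendsto_upperbound) simp
    then show ?thesis using True by simp
  qed
  then show ?thesis by blast
qed

lemma curve_bounded:
  assumes J: "J \<in> imag_units" and x: "x \<noteq> 0" and q: "q > 0"
  shows "\<exists>C. \<forall>\<^sub>F t in at 0. norm (g (E J (t ^ q * fst x, t * snd x))) \<le> C"
proof -
  obtain M where M: "\<And>z w. (z, w) \<noteq> 0 \<Longrightarrow> cmod z \<le> 1 \<Longrightarrow> cmod w \<le> 1 \<Longrightarrow> norm (g (E J (z, w))) \<le> M"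
    using bounded_near_0[OF J] by blast
  have "((\<lambda>t. cmod (t ^ q * fst x)) \<longlongrightarrow> cmod (0 ^ q * fst x)) (at 0)"
    "((\<lambda>t. cmod (t * snd x)) \<longlongrightarrow> cmod (0 * snd x)) (at 0)" by (intro tendsto_intros)+
  then have lim: "((\<lambda>t. cmod (t ^ q * fst x)) \<longlongrightarrow> 0) (at 0)" "((\<lambda>t. cmod (t * snd x)) \<longlongrightarrow> 0) (at 0)"
    using q by (simp_all add: power_0_left)
  have "\<forall>\<^sub>F t in at 0. cmod (t ^ q * fst x) < 1" "\<forall>\<^sub>F t in at 0. cmod (t * snd x) < 1"
    using order_tendstoD(2)[OF lim(1), of 1] order_tendstoD(2)[OF lim(2), of 1] by simp_all
  moreover have "\<forall>\<^sub>F t :: complex in at 0. t \<noteq> 0" by (simp add: eventually_at_filter)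
  ultimately have "\<forall>\<^sub>F t in at 0. norm (g (E J (t ^ q * fst x, t * snd x))) \<le> M"
  proof eventually_elim
    case (elim t)
    then show ?case using x by (intro M) (auto simp: prod_eq_iff)
  qed
  then show ?thesis by blast
qed

lemma weighted_holomorphic:
  assumes "J \<in> imag_units" "x \<noteq> 0"
  shows "(\<lambda>t. cmp J u (g (E J (t ^ q * fst x, t * snd x)))) holomorphic_on - {0}"
  using assms by (intro curve_holomorphic) (auto simp: prod_eq_iff intro!: holomorphic_intros)

lemma weighted_series_exists:
  assumes J: "J \<in> imag_units" and x: "x \<noteq> 0" and q: "q > 0"
  shows "\<exists>a. \<forall>t. t \<noteq> 0 \<longrightarrow> (\<lambda>d. sm J (t ^ d) (a d)) sums g (E J (t ^ q * fst x, t * snd x))"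
proof -
  obtain C where C: "\<forall>\<^sub>F t in at 0. norm (g (E J (t ^ q * fst x, t * snd x))) \<le> C"
    using curve_bounded[OF J x q] by blast
  have "continuous_on (sphere 0 1) ((\<lambda>x. g (E J x)) \<circ> (\<lambda>t. (t ^ q * fst x, t * snd x)))"
    using x by (intro continuous_on_compose continuous_slice[OF J] continuous_intros) (auto simp: prod_eq_iff)
  then have "bounded ((\<lambda>t. g (E J (t ^ q * fst x, t * snd x))) ` sphere 0 1)"
    by (intro compact_imp_bounded compact_continuous_image) (simp_all add: o_def)
  then obtain B where "\<forall>y\<in>(\<lambda>t. g (E J (t ^ q * fst x, t * snd x))) ` sphere 0 1. norm y \<le> B"
    unfolding bounded_iff by (rule exE)
  then have B: "norm (g (E J (t ^ q * fst x, t * snd x))) \<le> B" if "cmod t = 1" for t using that by simp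
  have "\<exists>a. (\<forall>t. t \<noteq> 0 \<longrightarrow> (\<lambda>d. sm J (t ^ d) (a d)) sums g (E J (t ^ q * fst x, t * snd x))) \<and>
      (\<forall>d. norm (a d) \<le> 8 * B)"
    by (rule slice_power_series[OF J weighted_holomorphic[OF J x] C B])
  then show ?thesis by (elim exE conjE) (rule exI, assumption)
qed

end

section \<open>Resonant contractions admit no developing map\<close>

lemma tendsto_power_mult_geometric:
  fixes r :: real
  assumes "0 \<le> r" "r < 1"
  shows "(\<lambda>k. real k ^ d * r ^ k) \<longlonglongrightarrow> 0"
proof (cases "r = 0 \<or> d = 0")
  case True
  then show ?thesis
  proof
    assume "r = 0"
    then have "\<forall>\<^sub>F k in sequentially. real k ^ d * r ^ k = 0"
      by (intro eventually_sequentiallyI[of 1]) auto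
    then show ?thesis by (rule tendsto_eventually)
  next
    assume "d = 0"
    then show ?thesis using assms by (simp add: LIMSEQ_realpow_zero)
  qed
next
  case False
  \<comment> \<open>With this root, k^d r^k is the d-th power of k \<rho>^k, which tends to
    0.\<close>
  define \<rho> where "\<rho> = root d r"
  have \<rho>: "\<rho> ^ d = r" "0 \<le> \<rho>" "\<rho> < 1"
    using False assms by (auto simp: \<rho>_def real_root_lt_1_iff)
  have "(\<lambda>k. (real k * \<rho> ^ k) ^ d) \<longlonglongrightarrow> 0 ^ d"
    using powser_times_n_limit_0[of \<rho>] \<rho> by (intro tendsto_power) (simp add: mult.commute)
  moreover have "(real k * \<rho> ^ k) ^ d = real k ^ d * r ^ k" for k
    by (simp add: power_mult_distrib \<rho>(1)[symmetric] power_mult[symmetric] mult.commute)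
  ultimately show ?thesis using False by (simp add: power_0_left)
qed

text \<open>Along the shifts by \<nu> the function is a geometric sequence. A polynomial bound
  forwards excludes r > 1, one backwards excludes r < 1.\<close>

lemma growth_dichotomy:
  fixes y :: "complex \<Rightarrow> real"
  assumes nonneg: "\<And>z. 0 \<le> y z" and r: "0 \<le> r" and rec: "\<And>z. y (z + \<nu>) = r * y z"
    and up: "\<And>z. \<exists>C. \<forall>k\<ge>1. y (z + of_nat k * \<nu>) \<le> C * real k ^ d"
    and down: "\<And>z. \<exists>C. \<forall>k\<ge>1. y (z - of_nat k * \<nu>) \<le> C * real k ^ d"
    and "y z \<noteq> 0"
  shows "r = 1"
proof (rule ccontr)
  assume "r \<noteq> 1"
  have iter: "y (z + of_nat k * \<nu>) = r ^ k * y z" for z k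
  proof (induction k)
    case (Suc k)
    have "y (z + of_nat (Suc k) * \<nu>) = y ((z + of_nat k * \<nu>) + \<nu>)" by (simp add: algebra_simps)
    then show ?case using rec Suc by simp
  qed simp
  have "y z = 0"
  proof (cases "r < 1")
    case True
    obtain C where C: "\<And>k. k \<ge> 1 \<Longrightarrow> y (z - of_nat k * \<nu>) \<le> C * real k ^ d" using down by blast
    have le: "y z \<le> C * (real k ^ d * r ^ k)" if "k \<ge> 1" for k
    proof -
      have "y z = r ^ k * y (z - of_nat k * \<nu>)" using iter[of "z - of_nat k * \<nu>" k] by simp
      also have "\<dots> \<le> r ^ k * (C * real k ^ d)" using C[OF that] r by (intro mult_left_mono) auto
      finally show ?thesis by (simp add: mult_ac)
    qed
    have "(\<lambda>k. C * (real k ^ d * r ^ k)) \<longlonglongrightarrow> C * 0"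
      by (intro tendsto_mult tendsto_const tendsto_power_mult_geometric r True)
    then have "y z \<le> C * 0" by (rule LIMSEQ_le_const) (use le in blast)
    then show ?thesis using nonneg[of z] by simp
  next
    case False
    then have r1: "r > 1" using \<open>r \<noteq> 1\<close> by simp
    obtain C where C: "\<And>k. k \<ge> 1 \<Longrightarrow> y (z + of_nat k * \<nu>) \<le> C * real k ^ d" using up by blast
    have le: "y z \<le> C * (real k ^ d * (1 / r) ^ k)" if "k \<ge> 1" for k
      using C[OF that] r1 unfolding iter by (simp add: power_one_over field_simps)
    have "(\<lambda>k. C * (real k ^ d * (1 / r) ^ k)) \<longlonglongrightarrow> C * 0"
      using r1 by (intro tendsto_mult tendsto_const tendsto_power_mult_geometric) auto
    then have "y z \<le> C * 0" by (rule LIMSEQ_le_const) (use le in blast)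
    then show ?thesis using nonneg[of z] by simp
  qed
  then show False using \<open>y z \<noteq> 0\<close> by simp
qed

text \<open>Coordinates adapted to the left line spanned by A: \<phi> is the quotient map by that
  line, and e spans a complement.\<close>

lemma left_functional_exists:
  assumes "A \<noteq> 0"
  shows "\<exists>\<phi> \<psi> e. (\<forall>u v. \<phi> (u + v) = \<phi> u + \<phi> v) \<and> (\<forall>q v. \<phi> (lmul q v) = q * \<phi> v) \<and> \<phi> A = 0 \<and>
    (\<forall>v. v = lmul (\<psi> v) A + lmul (\<phi> v) e)"
proof (cases "fst A = 0")
  case True
  then have "snd A \<noteq> 0" using assms by (auto simp: prod_eq_iff)
  then have "v = lmul (snd v * inverse (snd A)) A + lmul (fst v) (1, 0)" for v
    using True by (simp add: lmul_def prod_eq_iff mult.assoc)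
  then show ?thesis using True
    by (intro exI[of _ fst] exI[of _ "\<lambda>v. snd v * inverse (snd A)"] exI[of _ "(1, 0)"])
      (simp add: lmul_def)
next
  case False
  define \<phi> where "\<phi> v = snd v - fst v * (inverse (fst A) * snd A)" for v
  have "v = lmul (fst v * inverse (fst A)) A + lmul (\<phi> v) (0, 1)" for v
    using False by (simp add: \<phi>_def lmul_def prod_eq_iff mult.assoc)
  moreover have "\<phi> A = 0" using False by (simp add: \<phi>_def mult.assoc[symmetric])
  moreover have "\<phi> (u + v) = \<phi> u + \<phi> v" "\<phi> (lmul q v) = q * \<phi> v" for u v q
    by (simp_all add: \<phi>_def lmul_def algebra_simps)
  ultimately show ?thesis
    by (intro exI[of _ \<phi>] exI[of _ "\<lambda>v. fst v * inverse (fst A)"] exI[of _ "(0, 1)"]) auto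
qed

context slice_holomorphic_map
begin

text \<open>The difference of the expansions at two nearby points is again a series of the kind
  treated by \<open>slice_power_series\<close>. Uniform continuity of g on a compact set makes it
  small on the unit circle, hence its coefficients are small.\<close>

lemma coefficient_continuous:
  assumes J: "J \<in> imag_units" and q: "q > 0"
    and a: "\<And>x t. x \<noteq> 0 \<Longrightarrow> t \<noteq> 0 \<Longrightarrow> (\<lambda>d. sm J (t ^ d) (a x d)) sums g (E J (t ^ q * fst x, t * snd x))"
  shows "continuous_on (- {0}) (\<lambda>x. a x d)"
proof (intro continuous_at_imp_continuous_on ballI)
  fix x0 :: "complex \<times> complex" assume "x0 \<in> - {0}"
  then have x0: "x0 \<noteq> 0" by simp
  define \<Phi> where "\<Phi> = (\<lambda>y :: complex \<times> complex \<times> complex. g (E J (fst y ^ q * fst (snd y), fst y * snd (snd y))))"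
  define \<rho> where "\<rho> = norm x0 / 2"
  have \<rho>: "\<rho> > 0" using x0 by (simp add: \<rho>_def)
  have ball: "x \<noteq> 0" if "x \<in> cball x0 \<rho>" for x
    using that x0 by (auto simp: \<rho>_def dist_norm)
  let ?K = "sphere (0 :: complex) 1 \<times> cball x0 \<rho>"
  have "continuous_on ?K ((\<lambda>x. g (E J x)) \<circ> (\<lambda>y. (fst y ^ q * fst (snd y), fst y * snd (snd y))))"
    using ball by (intro continuous_on_compose continuous_slice[OF J] continuous_intros) (force simp: prod_eq_iff)
  then have "continuous_on ?K \<Phi>" by (simp add: \<Phi>_def o_def)
  moreover have "compact ?K" by (intro compact_Times) auto
  ultimately have uc: "uniformly_continuous_on ?K \<Phi>" by (rule compact_uniformly_continuous)
  show "isCont (\<lambda>x. a x d) x0"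
    unfolding continuous_at_eps_delta
  proof (intro allI impI)
    fix \<epsilon> :: real assume \<epsilon>: "\<epsilon> > 0"
    \<comment> \<open>The coefficient bound loses a factor 8; with 16 the difference is at most half
      of \<epsilon>.\<close>
    then have "\<epsilon> / 16 > 0" by simp
    then obtain \<delta> where \<delta>: "\<delta> > 0" "\<forall>y\<in>?K. \<forall>y'\<in>?K. dist y' y < \<delta> \<longrightarrow> dist (\<Phi> y') (\<Phi> y) < \<epsilon> / 16"
      using uc unfolding uniformly_continuous_on_def by blast
    have "dist (a x d) (a x0 d) < \<epsilon>" if x: "dist x x0 < min \<delta> \<rho>" for x
    proof -
      have xn: "x \<noteq> 0" using x by (intro ball) (simp add: dist_commute)
      let ?h = "\<lambda>t. g (E J (t ^ q * fst x, t * snd x)) - g (E J (t ^ q * fst x0, t * snd x0))"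
      have small: "norm (?h t) \<le> \<epsilon> / 16" if t: "cmod t = 1" for t
      proof -
        have "dist (t, x) (t, x0) < \<delta>" using x by (simp add: dist_Pair_Pair)
        moreover have "(t, x) \<in> ?K" "(t, x0) \<in> ?K" using t x \<rho> by (auto simp: dist_commute)
        ultimately have "dist (\<Phi> (t, x)) (\<Phi> (t, x0)) < \<epsilon> / 16" using \<delta>(2) by blast
        then show ?thesis by (simp add: \<Phi>_def dist_norm)
      qed
      have hol: "(\<lambda>t. cmp J u (?h t)) holomorphic_on - {0}" for u
        using holomorphic_on_diff[OF weighted_holomorphic[OF J xn] weighted_holomorphic[OF J x0]]
        by (simp add: linear_diff[OF linear_cmp])
      obtain C C' where C: "\<forall>\<^sub>F t in at 0. norm (g (E J (t ^ q * fst x, t * snd x))) \<le> C"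
        "\<forall>\<^sub>F t in at 0. norm (g (E J (t ^ q * fst x0, t * snd x0))) \<le> C'"
        using curve_bounded[OF J xn q] curve_bounded[OF J x0 q] by blast
      have "\<forall>\<^sub>F t in at 0. norm (?h t) \<le> C + C'"
        using C by eventually_elim (rule order_trans[OF norm_triangle_ineq4 add_mono])
      then have "\<exists>b. (\<forall>t. t \<noteq> 0 \<longrightarrow> (\<lambda>d. sm J (t ^ d) (b d)) sums ?h t) \<and> (\<forall>d. norm (b d) \<le> 8 * (\<epsilon> / 16))"
        by (rule slice_power_series[OF J hol _ small])
      then obtain b where b: "\<forall>t. t \<noteq> 0 \<longrightarrow> (\<lambda>d. sm J (t ^ d) (b d)) sums ?h t" "\<forall>d. norm (b d) \<le> 8 * (\<epsilon> / 16)"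
        by (elim exE conjE) (rule that, assumption+)
      have "b d = a x d - a x0 d"
      proof (rule slice_series_unique[OF J])
        fix t :: real assume t: "t \<noteq> 0"
        then show "(\<lambda>d. sm J (of_real t ^ d) (b d)) sums ?h (of_real t)" using b(1) by simp
        have "(\<lambda>d. sm J (of_real t ^ d) (a x d) - sm J (of_real t ^ d) (a x0 d)) sums ?h (of_real t)"
          using t by (intro sums_diff a xn x0) auto
        then show "(\<lambda>d. sm J (of_real t ^ d) (a x d - a x0 d)) sums ?h (of_real t)"
          by (simp add: sm_simps(8)[OF J])
      qed
      then have "norm (a x d - a x0 d) \<le> 8 * (\<epsilon> / 16)" using b(2)[rule_format, of d] by simp
      then show ?thesis using \<epsilon> by (simp add: dist_norm)
    qed
    then show "\<exists>\<delta>>0. \<forall>x. dist x x0 < \<delta> \<longrightarrow> dist (a x d) (a x0 d) < \<epsilon>"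
      using \<delta>(1) \<rho> by (intro exI[of _ "min \<delta> \<rho>"]) auto
  qed
qed

end

section \<open>Expansion of an equivariant map in the resonant case\<close>

locale resonant_developing_map = slice_holomorphic_map g for g +
  fixes T :: "quat \<times> quat \<Rightarrow> quat \<times> quat" and p :: nat and b :: real and l :: quat
  assumes p: "p > 1" and b: "b \<noteq> 0" "\<bar>b\<bar> < 1" and l: "l \<noteq> 0"
    and affine: "affine_transformation T"
    and equivariant: "x \<in> punctured \<Longrightarrow> g (hopf_map p (of_real b ^ p) (of_real b) l x) = T (g x)"
    and locally_injective: "x \<in> punctured \<Longrightarrow> \<exists>M. open M \<and> x \<in> M \<and> inj_on g M"
begin

definition "L v = T v - T 0"

lemma L: "left_linear L"
  using affine unfolding affine_transformation_iff L_def .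

lemmas L_simps = left_linearD[OF L]

lemma bounded_linear_L: "bounded_linear L"
  using left_linear_imp_linear[OF L] by (simp add: linear_conv_bounded_linear)

lemma L_sm: "L (sm J t v) = sm J t (L v)"
  by (simp add: sm_def L_simps)

lemma powers_inj: "\<bar>b\<bar> ^ m = \<bar>b\<bar> ^ n \<longleftrightarrow> m = n"
  using b by (simp add: power_inject_exp')

text \<open>The translation part of \<open>T\<close> is a constant and enters in degree 0 only; this
  is why eigenvalue equations are stated for d at least 1.\<close>

lemma L_series:
  assumes J: "J \<in> imag_units" and t: "(\<lambda>d. sm J (of_real t ^ d) (a d)) sums v"
  shows "(\<lambda>d. sm J (of_real t ^ d) (L (a d) + (if d = 0 then T 0 else 0))) sums T v"
proof -
  have "(\<lambda>d. sm J (of_real t ^ d) (L (a d))) sums L v"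
    using bounded_linear.sums[OF bounded_linear_L t] by (simp add: L_sm)
  moreover have "(\<lambda>d. if d = 0 then T 0 else 0) sums T 0"
    using sums_If_finite[of "\<lambda>d. d = 0" "\<lambda>_. T 0"] by simp
  ultimately have "(\<lambda>d. sm J (of_real t ^ d) (L (a d)) + (if d = 0 then T 0 else 0)) sums (L v + T 0)"
    by (rule sums_add)
  moreover have "sm J (of_real t ^ d) (L (a d)) + (if d = 0 then T 0 else 0) =
      sm J (of_real t ^ d) (L (a d) + (if d = 0 then T 0 else 0))" for d
    by (cases "d = 0") (simp_all add: sm_simps(2)[OF J])
  ultimately show ?thesis by (simp add: L_def)
qed

text \<open>One sequence of coefficients serves all slices, because they all contain the real points
  of the axis. Comparing slices will later force the exponent on the axis to be 1.\<close>

lemma axis_expansion: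
  "\<exists>c. (\<forall>J\<in>imag_units. \<forall>t. t \<noteq> 0 \<longrightarrow> (\<lambda>d. sm J (t ^ d) (c d)) sums g (E J (t, 0))) \<and>
    (\<forall>d\<ge>1. L (c d) = b ^ (p * d) *\<^sub>R c d)"
proof -
  have ex: "\<exists>a. \<forall>t. t \<noteq> 0 \<longrightarrow> (\<lambda>d. sm J (t ^ d) (a d)) sums g (E J (t, 0))" if J: "J \<in> imag_units" for J
    using weighted_series_exists[OF J, of "(1, 0)" 1] by (simp add: zero_prod_def)
  obtain J0 :: quat where J0: "J0 \<in> imag_units" using quat_emb_exists by blast
  obtain c where c: "\<forall>t. t \<noteq> 0 \<longrightarrow> (\<lambda>d. sm J0 (t ^ d) (c d)) sums g (E J0 (t, 0))" using ex[OF J0] by blast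
  have all: "\<forall>t. t \<noteq> 0 \<longrightarrow> (\<lambda>d. sm J (t ^ d) (c d)) sums g (E J (t, 0))" if J: "J \<in> imag_units" for J
  proof -
    obtain a where a: "\<forall>t. t \<noteq> 0 \<longrightarrow> (\<lambda>d. sm J (t ^ d) (a d)) sums g (E J (t, 0))" using ex[OF J] by blast
    have "a d = c d" for d
    proof (rule slice_series_unique[OF J])
      fix t :: real assume t: "t \<noteq> 0"
      have EE: "E J (of_real t, 0) = E J0 (of_real t, 0)" by (simp add: E_def emb_simps)
      show "(\<lambda>d. sm J (of_real t ^ d) (a d)) sums g (E J0 (of_real t, 0))" using a t unfolding EE[symmetric] by simp
      have "(\<lambda>d. sm J0 (of_real t ^ d) (c d)) sums g (E J0 (of_real t, 0))" using c t by simp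
      then show "(\<lambda>d. sm J (of_real t ^ d) (c d)) sums g (E J0 (of_real t, 0))"
        unfolding of_real_power[symmetric] by (simp only: sm_simps(3)[OF J] sm_simps(3)[OF J0])
    qed
    then have "a = c" by blast
    then show ?thesis using a by simp
  qed
  have "L (c d) = b ^ (p * d) *\<^sub>R c d" if "d \<ge> 1" for d
  proof -
    have "L (c d) + (if d = 0 then T 0 else 0) = sm J0 (of_real (b ^ p) ^ d) (c d)"
    proof (rule slice_series_unique[OF J0])
      fix t :: real assume t: "t \<noteq> 0"
      have pt: "E J0 (of_real t, 0) \<in> punctured" using t by (simp add: E_punctured[OF J0] zero_prod_def)
      have hm: "hopf_map p (of_real b ^ p) (of_real b) l (E J0 (of_real t, 0)) = E J0 (of_real (b ^ p * t), 0)"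
        using p by (simp add: hopf_map_def E_def emb_simps power_0_left mult.commute
            flip: of_real_mult of_real_power)
      show "(\<lambda>d. sm J0 (of_real t ^ d) (L (c d) + (if d = 0 then T 0 else 0))) sums T (g (E J0 (of_real t, 0)))"
        using c t by (intro L_series[OF J0]) simp
      have "(\<lambda>d. sm J0 (of_real (b ^ p * t) ^ d) (c d)) sums g (E J0 (of_real (b ^ p * t), 0))"
        using c t b by simp
      then show "(\<lambda>d. sm J0 (of_real t ^ d) (sm J0 (of_real (b ^ p) ^ d) (c d))) sums T (g (E J0 (of_real t, 0)))"
        unfolding equivariant[OF pt, symmetric] hm
        by (simp add: sm_simps(1)[OF J0, symmetric] power_mult_distrib mult.commute)
    qed
    then show ?thesis using that
      by (simp add: sm_simps(3)[OF J0] power_mult flip: of_real_power)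
  qed
  then show ?thesis using all by blast
qed

end

text \<open>As J is chosen with l in its slice and b is real, f maps pairs of points of this slice
  to such pairs and is there a complex polynomial map.\<close>

locale resonant_coefficients = resonant_developing_map +
  fixes J :: quat and l' :: complex and a :: "complex \<times> complex \<Rightarrow> nat \<Rightarrow> quat \<times> quat"
  assumes J: "J \<in> imag_units" and l': "l = emb J l'"
    and a: "x \<noteq> 0 \<Longrightarrow> t \<noteq> 0 \<Longrightarrow> (\<lambda>d. sm J (t ^ d) (a x d)) sums g (E J (t ^ p * fst x, t * snd x))"
begin

definition "\<mu> = l' / of_real (b ^ p)"

lemma l'_nz: "l' \<noteq> 0"
  using l l' by (auto simp: emb_simps)

lemma mu_nz: "\<mu> \<noteq> 0"
  using l'_nz b by (simp add: \<mu>_def)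

lemma homogeneous:
  fixes s :: real
  assumes s: "s \<noteq> 0" and x: "(z, w) \<noteq> 0"
  shows "a (of_real (s ^ p) * z, of_real s * w) d = s ^ d *\<^sub>R a (z, w) d"
proof (rule slice_series_unique[OF J])
  fix t :: real assume t: "t \<noteq> 0"
  have "(of_real (s ^ p) * z, of_real s * w) \<noteq> 0" using s x by (auto simp: zero_prod_def)
  from a[OF this, of "of_real t"] t
  show "(\<lambda>d. sm J (of_real t ^ d) (a (of_real (s ^ p) * z, of_real s * w) d)) sums
      g (E J (of_real (t * s) ^ p * z, of_real (t * s) * w))"
    by (simp add: power_mult_distrib mult_ac)
  from a[OF x, of "of_real (t * s)"] s t
  have "(\<lambda>d. sm J (of_real (t * s) ^ d) (a (z, w) d)) sums g (E J (of_real (t * s) ^ p * z, of_real (t * s) * w))"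
    by simp
  moreover have "sm J (of_real (t * s) ^ d) (a (z, w) d) = sm J (of_real t ^ d) (s ^ d *\<^sub>R a (z, w) d)" for d
    by (simp add: power_mult_distrib sm_simps(1)[OF J] sm_simps(3)[OF J] flip: of_real_power)
  ultimately show "(\<lambda>d. sm J (of_real t ^ d) (s ^ d *\<^sub>R a (z, w) d)) sums
      g (E J (of_real (t * s) ^ p * z, of_real (t * s) * w))" by simp
qed

text \<open>Applying f to (t^p z, t w) gives ((b t)^p (z + \<mu> w^p), b t w). Expanding both sides
  of the equivariance in t, the degree d terms differ by the factor b^d from replacing t by b
  t.\<close>

lemma L_coefficient:
  assumes x: "(z, w) \<noteq> 0" and d: "d \<ge> 1"
  shows "L (a (z, w) d) = b ^ d *\<^sub>R a (z + \<mu> * w ^ p, w) d"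
proof -
  have x': "(z + \<mu> * w ^ p, w) \<noteq> 0" using x p by (auto simp: zero_prod_def power_0_left)
  have "L (a (z, w) d) + (if d = 0 then T 0 else 0) = b ^ d *\<^sub>R a (z + \<mu> * w ^ p, w) d"
  proof (rule slice_series_unique[OF J])
    fix t :: real assume t: "t \<noteq> 0"
    let ?y = "(of_real t ^ p * z, of_real t * w)"
    have "?y \<noteq> 0" using t x by (auto simp: zero_prod_def)
    then have pt: "E J ?y \<in> punctured" by (simp add: E_punctured[OF J])
    have br: "of_real b ^ p = emb J (of_real b ^ p)" "of_real b = emb J (of_real b)"
      by (simp_all add: emb_simps flip: of_real_power)
    have hm: "hopf_map p (of_real b ^ p) (of_real b) l (E J ?y) =
        E J (of_real (t * b) ^ p * (z + \<mu> * w ^ p), of_real (t * b) * w)"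
    proof -
      have "hopf_map p (of_real b ^ p) (of_real b) l (E J ?y) =
          E J (of_real t ^ p * z * of_real b ^ p + (of_real t * w) ^ p * l', of_real t * w * of_real b)"
        unfolding hopf_map_def E_def l' br
        by (simp add: emb_simps(4) emb_mult[OF J] emb_power[OF J])
      also have "of_real t ^ p * z * of_real b ^ p + (of_real t * w) ^ p * l' =
          of_real (t * b) ^ p * (z + \<mu> * w ^ p)"
        using b by (simp add: \<mu>_def field_simps power_mult_distrib)
      finally show ?thesis by (simp add: mult_ac)
    qed
    show "(\<lambda>d. sm J (of_real t ^ d) (L (a (z, w) d) + (if d = 0 then T 0 else 0))) sums T (g (E J ?y))"
      using a[OF x, of "of_real t"] t by (intro L_series[OF J]) simp
    from a[OF x', of "of_real (t * b)"] t b
    have "(\<lambda>d. sm J (of_real (t * b) ^ d) (a (z + \<mu> * w ^ p, w) d)) sums T (g (E J ?y))"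
      unfolding equivariant[OF pt, symmetric] hm by simp
    moreover have "sm J (of_real (t * b) ^ d) v = sm J (of_real t ^ d) (b ^ d *\<^sub>R v)" for d v
      by (simp add: power_mult_distrib sm_simps(1)[OF J] sm_simps(3)[OF J] flip: of_real_power)
    ultimately show "(\<lambda>d. sm J (of_real t ^ d) (b ^ d *\<^sub>R a (z + \<mu> * w ^ p, w) d)) sums T (g (E J ?y))"
      by simp
  qed
  then show ?thesis using d by simp
qed

text \<open>By homogeneity \<open>a (z + k \<nu>, w) d = k\<^bsup>d/p\<^esup> a (z / k + \<nu>, w / k\<^bsup>1/p\<^esup>) d\<close>.\<close>

lemma growth_limit:
  assumes w: "w \<noteq> 0" and \<nu>: "\<nu> \<noteq> 0"
  shows "(\<lambda>k. (1 / root p (real k) ^ d) *\<^sub>R a (z + of_nat k * \<nu>, w) d) \<longlonglongrightarrow> a (\<nu>, 0) d"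
proof -
  have p0: "p > 0" using p by simp
  have "(\<lambda>k. z * of_real (1 / real k) + \<nu>) \<longlonglongrightarrow> z * of_real 0 + \<nu>"
    by (intro tendsto_intros lim_1_over_n)
  moreover have "(\<lambda>k. of_real (root p (1 / real k)) * w) \<longlonglongrightarrow> of_real (root p 0) * w"
    by (intro tendsto_intros lim_1_over_n)
  ultimately have lim: "(\<lambda>k. (z * of_real (1 / real k) + \<nu>, of_real (root p (1 / real k)) * w)) \<longlonglongrightarrow> (\<nu>, 0)"
    using tendsto_Pair by fastforce
  have "isCont (\<lambda>x. a x d) (\<nu>, 0)"
    using coefficient_continuous[OF J p0 a] \<nu>
    by (simp add: continuous_on_eq_continuous_at open_Compl zero_prod_def)
  from isCont_tendsto_compose[OF this lim]
  have "(\<lambda>k. a (z * of_real (1 / real k) + \<nu>, of_real (root p (1 / real k)) * w) d) \<longlonglongrightarrow> a (\<nu>, 0) d" .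
  moreover have "\<forall>\<^sub>F k in sequentially. a (z * of_real (1 / real k) + \<nu>, of_real (root p (1 / real k)) * w) d =
      (1 / root p (real k) ^ d) *\<^sub>R a (z + of_nat k * \<nu>, w) d"
  proof (intro eventually_sequentiallyI[of 1])
    fix k :: nat assume k: "1 \<le> k"
    define s where "s = root p (1 / real k)"
    have s: "s \<noteq> 0" "s ^ p = 1 / real k" "s = 1 / root p (real k)"
      using k p0 by (simp_all add: s_def real_root_divide power_one_over)
    have "(z + of_nat k * \<nu>, w) \<noteq> 0" using w by (simp add: zero_prod_def)
    from homogeneous[OF s(1) this, of d]
    have "a (of_real (s ^ p) * (z + of_nat k * \<nu>), of_real s * w) d = s ^ d *\<^sub>R a (z + of_nat k * \<nu>, w) d" .
    moreover have "of_real (s ^ p) * (z + of_nat k * \<nu>) = z * of_real (1 / real k) + \<nu>"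
      unfolding s(2) using k by (simp add: field_simps)
    ultimately show "a (z * of_real (1 / real k) + \<nu>, of_real (root p (1 / real k)) * w) d =
      (1 / root p (real k) ^ d) *\<^sub>R a (z + of_nat k * \<nu>, w) d"
      by (simp add: s_def[symmetric] s(3) power_one_over)
  qed
  ultimately show ?thesis by (rule Lim_transform_eventually)
qed

text \<open>A convergent sequence is bounded. The exponent d/p is weakened to d, since any
  polynomial bound is enough against geometric growth.\<close>

lemma growth_bound:
  assumes w: "w \<noteq> 0" and \<nu>: "\<nu> \<noteq> 0"
  shows "\<exists>C. \<forall>k\<ge>1. norm (a (z + of_nat k * \<nu>, w) d) \<le> C * real k ^ d"
proof -
  obtain C where C: "\<And>k. norm ((1 / root p (real k) ^ d) *\<^sub>R a (z + of_nat k * \<nu>, w) d) \<le> C"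
    using convergent_imp_Bseq[OF convergentI[OF growth_limit[OF w \<nu>, of d z]]] unfolding Bseq_def by blast
  have "norm (a (z + of_nat k * \<nu>, w) d) \<le> C * real k ^ d" if k: "k \<ge> 1" for k
  proof -
    define s where "s = root p (real k)"
    have s: "1 \<le> s" using k p by (simp add: s_def)
    have "s ^ 1 \<le> s ^ p" using s p by (intro power_increasing) auto
    then have sk: "s \<le> real k" using p by (simp add: s_def)
    have "norm (a (z + of_nat k * \<nu>, w) d) \<le> C * s ^ d"
      using C[of k] s by (simp add: s_def[symmetric] field_simps)
    also have "\<dots> \<le> C * real k ^ d"
      using order_trans[OF norm_ge_zero C[of k]] sk s by (intro mult_left_mono power_mono) auto
    finally show ?thesis .
  qed
  then show ?thesis by blast
qed

text \<open>Used with \<phi> the identity, when all values lie in the eigenline of \<open>L\<close>,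
  and with \<phi> the projection modulo that line. The bound in the backward direction is the
  forward one for the opposite shift.\<close>

lemma coefficient_dichotomy:
  fixes \<phi> :: "quat \<times> quat \<Rightarrow> 'v::real_normed_vector"
  assumes w: "w \<noteq> 0" and \<phi>: "bounded_linear \<phi>" and r: "0 \<le> r"
    and rec: "\<And>z. norm (\<phi> (a (z + \<mu> * w ^ p, w) d)) = r * norm (\<phi> (a (z, w) d))"
    and nz: "\<phi> (a (z, w) d) \<noteq> 0"
  shows "r = 1"
proof (rule growth_dichotomy[where y = "\<lambda>z. norm (\<phi> (a (z, w) d))" and \<nu> = "\<mu> * w ^ p" and d = d])
  obtain K where K: "\<And>v. norm (\<phi> v) \<le> norm v * K" "K > 0" using bounded_linear.pos_bounded[OF \<phi>] by blast
  have bd: "\<exists>C. \<forall>k\<ge>1. norm (\<phi> (a (z + of_nat k * \<nu>, w) d)) \<le> C * real k ^ d" if \<nu>: "\<nu> \<noteq> 0" for z \<nu>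
  proof -
    obtain C where C: "\<forall>k\<ge>1. norm (a (z + of_nat k * \<nu>, w) d) \<le> C * real k ^ d"
      using growth_bound[OF w \<nu>] by blast
    have "norm (\<phi> (a (z + of_nat k * \<nu>, w) d)) \<le> (C * K) * real k ^ d" if "k \<ge> 1" for k
    proof -
      have "norm (\<phi> (a (z + of_nat k * \<nu>, w) d)) \<le> norm (a (z + of_nat k * \<nu>, w) d) * K" by (rule K)
      also have "\<dots> \<le> (C * real k ^ d) * K" using C that K(2) by (intro mult_right_mono) auto
      finally show ?thesis by (simp add: mult_ac)
    qed
    then show ?thesis by blast
  qed
  have nz': "\<mu> * w ^ p \<noteq> 0" using mu_nz w by simp
  show "\<exists>C. \<forall>k\<ge>1. norm (\<phi> (a (z + of_nat k * (\<mu> * w ^ p), w) d)) \<le> C * real k ^ d" for z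
    by (rule bd[OF nz'])
  show "\<exists>C. \<forall>k\<ge>1. norm (\<phi> (a (z - of_nat k * (\<mu> * w ^ p), w) d)) \<le> C * real k ^ d" for z
    using bd[of "- (\<mu> * w ^ p)" z] nz' by simp
qed (use r rec nz in auto)

end

section \<open>Local injectivity and the eigenvalues of the linear part\<close>

context resonant_developing_map
begin

lemma slice_injective:
  assumes K: "K \<in> imag_units" and x: "x \<noteq> 0"
  shows "\<exists>\<epsilon>>0. \<forall>y\<in>ball x \<epsilon>. \<forall>y'\<in>ball x \<epsilon>. g (E K y) = g (E K y') \<longrightarrow> y = y'"
proof -
  have "E K x \<in> punctured" using x by (simp add: E_punctured[OF K])
  then obtain M where M: "open M" "E K x \<in> M" "inj_on g M" using locally_injective by blast
  have "open (E K -` M)" by (rule open_vimage[OF M(1) continuous_E])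
  then obtain \<epsilon> where \<epsilon>: "\<epsilon> > 0" "ball x \<epsilon> \<subseteq> E K -` M" using M(2) open_contains_ball by blast
  have "y = y'" if "y \<in> ball x \<epsilon>" "y' \<in> ball x \<epsilon>" "g (E K y) = g (E K y')" for y y'
  proof -
    have "E K y \<in> M" "E K y' \<in> M" using subsetD[OF \<epsilon>(2) that(1)] subsetD[OF \<epsilon>(2) that(2)] by simp_all
    then have "E K y = E K y'" by (rule inj_onD[OF M(3) that(3)])
    then show ?thesis by (simp add: E_inj[OF K])
  qed
  then show ?thesis using \<epsilon>(1) by blast
qed

end

context resonant_coefficients
begin

text \<open>If only degrees divisible by p occurred, replacing t by \<zeta> t with \<zeta>^p = 1
  would not change the series, while it fixes t^p z. Then g would agree at (1, w) and (1, \<zeta> w)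
  for small nonzero w, against local injectivity at (1, 0).\<close>

lemma nondivisible_coefficient:
  "\<exists>e z w. \<not> p dvd e \<and> w \<noteq> 0 \<and> a (z, w) e \<noteq> 0"
proof (rule ccontr)
  assume "\<not> ?thesis"
  then have zero: "a (z, w) e = 0" if "w \<noteq> 0" "\<not> p dvd e" for e z w using that by blast
  have "(1 :: complex, 0 :: complex) \<noteq> 0" by (simp add: zero_prod_def)
  from slice_injective[OF J this] obtain \<epsilon> where \<epsilon>: "\<epsilon> > 0"
    "\<forall>y\<in>ball (1, 0) \<epsilon>. \<forall>y'\<in>ball (1, 0) \<epsilon>. g (E J y) = g (E J y') \<longrightarrow> y = y'"
    by (elim exE conjE)
  have "card {\<zeta> :: complex. \<zeta> ^ p = 1} = p" using p by (intro card_roots_unity_eq) simp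
  then have "{\<zeta> :: complex. \<zeta> ^ p = 1} \<noteq> {1}" using p by auto
  then obtain \<zeta> :: complex where \<zeta>: "\<zeta> ^ p = 1" "\<zeta> \<noteq> 1" by auto
  have "cmod \<zeta> ^ p = 1" using \<zeta>(1) by (metis norm_one norm_power)
  then have n\<zeta>: "cmod \<zeta> = 1" using p power_eq_iff_eq_base[of p "cmod \<zeta>" 1] by simp
  define w :: complex where "w = of_real (\<epsilon> / 2)"
  have w: "w \<noteq> 0" "cmod w < \<epsilon>" using \<epsilon>(1) by (auto simp: w_def norm_divide)
  have x: "(1 :: complex, w) \<noteq> 0" by (simp add: zero_prod_def)
  have "\<zeta> \<noteq> 0" using n\<zeta> by auto
  have s: "(\<lambda>d. sm J (1 ^ d) (a (1, w) d)) sums g (E J (1, w))" using a[OF x, of 1] by simp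
  have s\<zeta>: "(\<lambda>d. sm J (\<zeta> ^ d) (a (1, w) d)) sums g (E J (1, \<zeta> * w))"
    using a[OF x \<open>\<zeta> \<noteq> 0\<close>] \<zeta>(1) by simp
  have "sm J (\<zeta> ^ d) (a (1, w) d) = sm J (1 ^ d) (a (1, w) d)" for d
  proof (cases "p dvd d")
    case True
    then have "\<zeta> ^ d = 1" using \<zeta>(1) by (auto simp: power_mult)
    then show ?thesis by simp
  qed (simp add: zero[OF w(1)] sm_simps(6)[OF J])
  then have "g (E J (1, \<zeta> * w)) = g (E J (1, w))" using sums_unique2[OF s\<zeta>] s by simp
  moreover have "(1, \<zeta> * w) \<in> ball (1, 0) \<epsilon>" "(1, w) \<in> ball (1, 0) \<epsilon>"
    using w(2) n\<zeta> by (auto simp: dist_Pair_Pair norm_mult)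
  ultimately have "(1, \<zeta> * w) = (1, w)" using \<epsilon>(2) by blast
  then show False using w(1) \<zeta>(2) by simp
qed

lemma inconsistent: False
proof -
  obtain c where c: "\<forall>K\<in>imag_units. \<forall>t. t \<noteq> 0 \<longrightarrow> (\<lambda>d. sm K (t ^ d) (c d)) sums g (E K (t, 0))"
    "\<forall>d\<ge>1. L (c d) = b ^ (p * d) *\<^sub>R c d" using axis_expansion by (elim exE conjE) (rule that, assumption+)
  have "\<exists>m\<ge>1. c m \<noteq> 0"
  proof (rule ccontr)
    assume "\<not> ?thesis"
    then have zero: "c d = 0" if "d \<ge> 1" for d using that by blast
    have const: "g (E J (t, 0)) = c 0" if "t \<noteq> 0" for t
    proof -
      have "(\<lambda>d. sm J (t ^ d) (c d)) sums (\<Sum>d\<in>{0}. sm J (t ^ d) (c d))"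
        by (rule sums_finite) (auto simp: zero sm_simps(6)[OF J])
      moreover have "(\<lambda>d. sm J (t ^ d) (c d)) sums g (E J (t, 0))" using c(1) J that by blast
      ultimately show ?thesis using sums_unique2 by (fastforce simp: sm_simps(2)[OF J])
    qed
    have "(1 :: complex, 0 :: complex) \<noteq> 0" by (simp add: zero_prod_def)
    from slice_injective[OF J this] obtain \<epsilon> where \<epsilon>: "\<epsilon> > 0"
      "\<forall>y\<in>ball (1, 0) \<epsilon>. \<forall>y'\<in>ball (1, 0) \<epsilon>. g (E J y) = g (E J y') \<longrightarrow> y = y'"
      by (elim exE conjE)
    define t :: complex where "t = of_real (1 + \<epsilon> / 2)"
    have t1: "t - 1 = of_real (\<epsilon> / 2)" by (simp add: t_def)
    have "t \<noteq> 0" using \<epsilon>(1) unfolding t_def of_real_eq_0_iff by simp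
    moreover have "dist t 1 < \<epsilon>" unfolding dist_norm t1 norm_of_real using \<epsilon>(1) by simp
    then have "dist 1 t < \<epsilon>" by (simp only: dist_commute)
    then have "(t, 0) \<in> ball (1, 0) \<epsilon>" by (simp add: dist_Pair_Pair)
    moreover have "(1, 0) \<in> ball (1 :: complex, 0 :: complex) \<epsilon>" using \<epsilon>(1) by simp
    ultimately have "(t, 0) = (1 :: complex, 0 :: complex)" using \<epsilon>(2) const[of t] const[of 1] by (metis one_neq_zero)
    then show False using \<epsilon>(1) t1 by simp
  qed
  then obtain m where m: "m \<ge> 1" "c m \<noteq> 0" by blast
  define A where "A = c m"
  define \<rho> where "\<rho> = b ^ (p * m)"
  have A: "A \<noteq> 0" "L A = \<rho> *\<^sub>R A" using m c(2) by (auto simp: A_def \<rho>_def)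
  obtain \<phi> \<psi> v0 where "(\<forall>u v. \<phi> (u + v) = \<phi> u + \<phi> v) \<and> (\<forall>q v. \<phi> (lmul q v) = q * \<phi> v) \<and> \<phi> A = 0 \<and>
    (\<forall>v. v = lmul (\<psi> v) A + lmul (\<phi> v) v0)" using left_functional_exists[OF A(1)] by (elim exE) (rule that)
  then have \<phi>_add: "\<And>u v. \<phi> (u + v) = \<phi> u + \<phi> v" and \<phi>_lmul: "\<And>q v. \<phi> (lmul q v) = q * \<phi> v"
    and \<phi>_A: "\<phi> A = 0" and decomp: "\<And>v. v = lmul (\<psi> v) A + lmul (\<phi> v) v0" by blast+
  have \<phi>_scale: "\<phi> (r *\<^sub>R v) = r *\<^sub>R \<phi> v" for r v
    using \<phi>_lmul[of "of_real r" v] by (simp add: lmul_simps scaleR_conv_of_real)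
  have bl\<phi>: "bounded_linear \<phi>"
    using linearI[of \<phi>, OF \<phi>_add \<phi>_scale] by (simp add: linear_conv_bounded_linear)
  \<comment> \<open>On the quotient by the line spanned by \<open>A\<close>, \<open>L\<close> is
    right multiplication by \<kappa>. This is the only other eigenvalue available.\<close>
  define \<kappa> where "\<kappa> = \<phi> (L v0)"
  have \<phi>_L: "\<phi> (L v) = \<phi> v * \<kappa>" for v
  proof -
    have "\<phi> (L v) = \<phi> (L (lmul (\<psi> v) A + lmul (\<phi> v) v0))" using decomp[of v] by simp
    also have "\<dots> = \<psi> v * \<phi> (\<rho> *\<^sub>R A) + \<phi> v * \<kappa>" by (simp add: L_simps \<phi>_add \<phi>_lmul A(2) \<kappa>_def)
    finally show ?thesis by (simp add: \<phi>_scale \<phi>_A)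
  qed
  \<comment> \<open>Since \<rho> is real it commutes with left multiples of \<open>A\<close>, so
    \<open>L\<close> is the scalar \<rho> on the whole line.\<close>
  have ker: "L v = \<rho> *\<^sub>R v" if "\<phi> v = 0" for v
  proof -
    have v: "v = lmul (\<psi> v) A" using decomp[of v] that by (simp add: lmul_simps)
    have "L (lmul (\<psi> v) A) = \<rho> *\<^sub>R lmul (\<psi> v) A"
      by (simp add: L_simps A(2) linear_scale[OF linear_lmul])
    then show ?thesis using v by simp
  qed
  have \<kappa>_norm: "norm \<kappa> = \<bar>b\<bar> ^ d" if "d \<ge> 1" "w \<noteq> 0" "\<phi> (a (z, w) d) \<noteq> 0" for d z w
  proof -
    have bd: "\<bar>b\<bar> ^ d > 0" using b by simp
    have "norm \<kappa> / \<bar>b\<bar> ^ d = 1"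
    proof (rule coefficient_dichotomy[OF that(2) bl\<phi> _ _ that(3)])
      fix z :: complex
      have "(z, w) \<noteq> 0" using that(2) by (simp add: zero_prod_def)
      from L_coefficient[OF this that(1)]
      have "\<phi> (a (z, w) d) * \<kappa> = b ^ d *\<^sub>R \<phi> (a (z + \<mu> * w ^ p, w) d)" by (simp flip: \<phi>_L \<phi>_scale)
      from arg_cong[OF this, of norm]
      show "norm (\<phi> (a (z + \<mu> * w ^ p, w) d)) = norm \<kappa> / \<bar>b\<bar> ^ d * norm (\<phi> (a (z, w) d))"
        using bd by (simp add: norm_mult power_abs field_simps)
    qed simp
    then show ?thesis using bd by (simp add: field_simps)
  qed
  obtain e z w where e: "\<not> p dvd e" "w \<noteq> 0" "a (z, w) e \<noteq> 0" using nondivisible_coefficient by blast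
  have e1: "e \<ge> 1" using e(1) by (cases e) auto
  \<comment> \<open>If the degree e coefficients all lay in the line spanned by \<open>A\<close>,
    the dichotomy with eigenvalue \<rho> would give e = p m, but p does not divide e. So they are
    visible modulo the line and fix the modulus of \<kappa>.\<close>
  have \<kappa>: "norm \<kappa> = \<bar>b\<bar> ^ e"
  proof (cases "\<exists>z. \<phi> (a (z, w) e) \<noteq> 0")
    case True
    then show ?thesis using \<kappa>_norm e1 e(2) by blast
  next
    case False
    have be: "\<bar>b\<bar> ^ e > 0" using b by simp
    have "\<bar>\<rho>\<bar> / \<bar>b\<bar> ^ e = 1"
    proof (rule coefficient_dichotomy[OF e(2) bounded_linear_ident _ _ e(3)])
      fix z :: complex
      have "(z, w) \<noteq> 0" using e(2) by (simp add: zero_prod_def)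
      from L_coefficient[OF this e1] ker[of "a (z, w) e"] False
      have "\<rho> *\<^sub>R a (z, w) e = b ^ e *\<^sub>R a (z + \<mu> * w ^ p, w) e" by simp
      from arg_cong[OF this, of norm]
      show "norm (a (z + \<mu> * w ^ p, w) e) = \<bar>\<rho>\<bar> / \<bar>b\<bar> ^ e * norm (a (z, w) e)"
        using be by (simp add: power_abs field_simps)
    qed simp
    then have "\<bar>b\<bar> ^ (p * m) = \<bar>b\<bar> ^ e" using be by (simp add: \<rho>_def power_abs field_simps)
    then have "e = p * m" by (simp only: powers_inj)
    then show ?thesis using e(1) by simp
  qed
  \<comment> \<open>Modulo the line, \<open>c d\<close> would have an eigenvalue of modulus |b|^(p
    d), different from that of \<kappa> because p does not divide e. So \<open>c d\<close> lies in
    the line, and its eigenvalue is \<rho>.\<close>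
  have unique: "d = m" if d: "d \<ge> 1" "c d \<noteq> 0" for d
  proof -
    have Ld: "L (c d) = b ^ (p * d) *\<^sub>R c d" using c(2) d(1) by blast
    have "\<phi> (c d) = 0"
    proof (rule ccontr)
      assume nz: "\<phi> (c d) \<noteq> 0"
      have "\<phi> (c d) * \<kappa> = b ^ (p * d) *\<^sub>R \<phi> (c d)" by (simp flip: \<phi>_L add: Ld \<phi>_scale)
      from arg_cong[OF this, of norm] have "norm \<kappa> = \<bar>b\<bar> ^ (p * d)"
        using nz by (simp add: norm_mult power_abs)
      then have "e = p * d" using \<kappa> by (simp only: powers_inj)
      then show False using e(1) by simp
    qed
    then have "(\<rho> - b ^ (p * d)) *\<^sub>R c d = 0" using ker[of "c d"] Ld by (auto simp: scaleR_diff_left)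
    then have "b ^ (p * m) = b ^ (p * d)" using d(2) by (simp add: \<rho>_def)
    then have "\<bar>b\<bar> ^ (p * m) = \<bar>b\<bar> ^ (p * d)" by (simp flip: power_abs)
    then have "p * m = p * d" by (simp only: powers_inj)
    then show ?thesis using p by simp
  qed
  have axis: "g (E K (t, 0)) = c 0 + sm K (t ^ m) A" if K: "K \<in> imag_units" and t: "t \<noteq> 0" for K t
  proof -
    have "(\<lambda>d. sm K (t ^ d) (c d)) sums (\<Sum>d\<in>{0, m}. sm K (t ^ d) (c d))"
    proof (rule sums_finite)
      fix d assume "d \<notin> {0, m}"
      then have "c d = 0" using unique[of d] by (cases d) auto
      then show "sm K (t ^ d) (c d) = 0" by (simp add: sm_simps(6)[OF K])
    qed simp
    moreover have "(\<lambda>d. sm K (t ^ d) (c d)) sums g (E K (t, 0))" using c(1) K t by blast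
    ultimately have "g (E K (t, 0)) = (\<Sum>d\<in>{0, m}. sm K (t ^ d) (c d))" by (rule sums_unique2[symmetric])
    then show ?thesis using m(1) by (simp add: sm_simps(2)[OF K] A_def)
  qed
  \<comment> \<open>otherwise the axis map takes the same value on the whole sphere \<open>{emb K \<omega>. K\<^sup>2 = -1}\<close>, \<open>\<omega>\<^sup>m = -1\<close>\<close>
  have "m = 1"
  proof (rule ccontr)
    assume "m \<noteq> 1"
    then have m2: "m \<ge> 2" using m(1) by simp
    define \<omega> where "\<omega> = cis (pi / m)"
    have "\<omega> ^ m = cis (real m * (pi / real m))" unfolding \<omega>_def by (rule Complex.DeMoivre)
    then have \<omega>: "\<omega> ^ m = -1" "\<omega> \<noteq> 0" using m(1) by (simp_all add: \<omega>_def cis_pi)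
    have im\<omega>: "Im \<omega> > 0" using m2 by (simp add: \<omega>_def sin_gt_zero field_simps)
    \<comment> \<open>A circle of imaginary units through \<open>Quat 0 1 0 0\<close>: moving
      \<theta> moves the point over \<omega> along its sphere, while g keeps its value, as
      \<omega>^m = -1 is real.\<close>
    define K where "K \<theta> = of_real (cos \<theta>) * Quat 0 1 0 0 + of_real (sin \<theta>) * Quat 0 0 1 0" for \<theta> :: real
    have K: "K \<theta> \<in> imag_units" for \<theta>
    proof -
      have "(norm (K \<theta>))\<^sup>2 = 1" unfolding norm_quat_sq by (simp add: K_def)
      then show ?thesis using norm_ge_zero[of "K \<theta>"]
        by (simp add: imag_units_iff power2_eq_1_iff) (simp add: K_def)
    qed
    have val: "g (E (K \<theta>) (\<omega>, 0)) = c 0 - A" for \<theta>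
      using axis[OF K \<omega>(2)] \<omega>(1) by (simp add: sm_def emb_simps lmul_simps)
    have "E (K 0) (\<omega>, 0) \<in> punctured" using \<omega>(2) by (simp add: E_punctured[OF K] zero_prod_def)
    then obtain M where M: "open M" "E (K 0) (\<omega>, 0) \<in> M" "inj_on g M" using locally_injective by blast
    have "continuous_on UNIV (\<lambda>\<theta>. E (K \<theta>) (\<omega>, 0))"
      unfolding E_def emb_def K_def by (intro continuous_intros)
    from open_vimage[OF M(1) this] M(2)
    obtain \<delta> where \<delta>: "\<delta> > 0" "ball 0 \<delta> \<subseteq> (\<lambda>\<theta>. E (K \<theta>) (\<omega>, 0)) -` M"
      unfolding open_contains_ball by blast
    define \<theta> where "\<theta> = min (\<delta> / 2) 1"
    have \<theta>: "0 < \<theta>" "\<theta> < \<delta>" "\<theta> < pi" using \<delta>(1) pi_gt3 by (auto simp: \<theta>_def)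
    have "\<theta> \<in> ball 0 \<delta>" using \<theta> by (simp add: dist_real_def)
    from subsetD[OF \<delta>(2) this] have "E (K \<theta>) (\<omega>, 0) \<in> M" by (simp only: vimage_eq)
    from inj_onD[OF M(3) _ this M(2)] have "E (K \<theta>) (\<omega>, 0) = E (K 0) (\<omega>, 0)" by (simp only: val)
    then have "qj (emb (K \<theta>) \<omega>) = qj (emb (K 0) \<omega>)" by (simp add: E_def)
    then have "Im \<omega> * sin \<theta> = 0" by (simp add: emb_def K_def)
    then show False using im\<omega> sin_gt_zero[OF \<theta>(1,3)] by simp
  qed
  have \<rho>p: "\<rho> = b ^ p" using \<open>m = 1\<close> by (simp add: \<rho>_def)
  have p1: "p \<ge> 1" using p by simp
  \<comment> \<open>Since e differs from p, the modulus of \<kappa> excludes a component outside the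
    line. There \<open>L\<close> is the scalar b^p, which cancels against the factor in
    \<open>L_coefficient\<close>.\<close>
  have shift: "a (z + \<mu>, 1) p = a (z, 1) p" for z
  proof -
    have "\<phi> (a (z, 1) p) = 0"
    proof (rule ccontr)
      assume "\<phi> (a (z, 1) p) \<noteq> 0"
      then have "\<bar>b\<bar> ^ p = \<bar>b\<bar> ^ e" using \<kappa>_norm[OF p1, of 1 z] \<kappa> by simp
      then have "p = e" by (simp only: powers_inj)
      then show False using e(1) by simp
    qed
    then have "L (a (z, 1) p) = b ^ p *\<^sub>R a (z, 1) p" using ker \<rho>p by simp
    moreover have "L (a (z, 1) p) = b ^ p *\<^sub>R a (z + \<mu>, 1) p"
      using L_coefficient[OF _ p1, of z 1] by (simp add: zero_prod_def)
    ultimately show ?thesis using b by simp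
  qed
  have shifts: "a (of_nat k * \<mu>, 1) p = a (0, 1) p" for k
  proof (induction k)
    case (Suc k)
    have "of_nat (Suc k) * \<mu> = of_nat k * \<mu> + \<mu>" by (simp add: algebra_simps)
    then show ?case using shift[of "of_nat k * \<mu>"] Suc by simp
  qed simp
  have "(\<lambda>k. (1 / root p (real k) ^ p) *\<^sub>R a (0 + of_nat k * \<mu>, 1) p) \<longlonglongrightarrow> a (\<mu>, 0) p"
    by (rule growth_limit[OF _ mu_nz]) simp
  then have "(\<lambda>k. (1 / real k) *\<^sub>R a (0, 1) p) \<longlonglongrightarrow> a (\<mu>, 0) p"
    using p by (simp add: shifts)
  moreover have "(\<lambda>k. (1 / real k) *\<^sub>R a (0, 1) p) \<longlonglongrightarrow> 0 *\<^sub>R a (0, 1) p"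
    by (intro tendsto_scaleR lim_1_over_n tendsto_const)
  ultimately have "a (\<mu>, 0) p = 0" using LIMSEQ_unique by fastforce
  \<comment> \<open>The axis formula with m = 1 at the point t^p \<mu> is a polynomial in t with
    terms in degrees 0 and p only. The conditional is its general coefficient, read off at degree
    p.\<close>
  moreover have "a (\<mu>, 0) p = (if p = 0 then c 0 else if p = p then sm J \<mu> A else 0)"
  proof (rule slice_series_unique[OF J, where a = "a (\<mu>, 0)" and d = p and
        h = "\<lambda>t. g (E J (of_real t ^ p * \<mu>, 0))" and b = "\<lambda>d. if d = 0 then c 0 else if d = p then sm J \<mu> A else 0"])
    fix t :: real assume t: "t \<noteq> 0"
    have x: "(\<mu>, 0) \<noteq> 0" using mu_nz by (simp add: zero_prod_def)
    show "(\<lambda>d. sm J (of_real t ^ d) (a (\<mu>, 0) d)) sums g (E J (of_real t ^ p * \<mu>, 0))"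
      using a[OF x, of "of_real t"] t by simp
    let ?c = "\<lambda>d. if d = 0 then c 0 else if d = p then sm J \<mu> A else 0"
    have "(\<lambda>d. sm J (of_real t ^ d) (?c d)) sums (\<Sum>d\<in>{0, p}. sm J (of_real t ^ d) (?c d))"
      by (rule sums_finite) (auto simp: sm_simps(6)[OF J])
    moreover have "(\<Sum>d\<in>{0, p}. sm J (of_real t ^ d) (?c d)) = c 0 + sm J (of_real t ^ p * \<mu>) A"
      using p by (simp add: sm_simps(1,2)[OF J])
    moreover have "g (E J (of_real t ^ p * \<mu>, 0)) = c 0 + sm J (of_real t ^ p * \<mu>) A"
      using axis[OF J, of "of_real t ^ p * \<mu>"] mu_nz t \<open>m = 1\<close> by simp
    ultimately show "(\<lambda>d. sm J (of_real t ^ d) (?c d)) sums g (E J (of_real t ^ p * \<mu>, 0))" by simp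
  qed
  ultimately have "sm J \<mu> A = 0" using p by simp
  then have "cmod \<mu> * norm A = 0" by (metis sm_simps(9)[OF J] norm_zero)
  then show False using mu_nz A(1) by simp
qed

end

lemma (in resonant_developing_map) contradiction: False
proof -
  obtain J l' where J: "J \<in> imag_units" "l = emb J l'" using quat_emb_exists by blast
  have "\<exists>a. x \<noteq> 0 \<longrightarrow> (\<forall>t. t \<noteq> 0 \<longrightarrow> (\<lambda>d. sm J (t ^ d) (a d)) sums g (E J (t ^ p * fst x, t * snd x)))" for x
    using weighted_series_exists[OF J(1), of x p] p by (cases "x = 0") auto
  then obtain a where a: "\<forall>x. x \<noteq> 0 \<longrightarrow> (\<forall>t. t \<noteq> 0 \<longrightarrow>
      (\<lambda>d. sm J (t ^ d) (a x d)) sums g (E J (t ^ p * fst x, t * snd x)))"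
    by (rule choice[OF allI, THEN exE])
  interpret resonant_coefficients g T p b l J l' a
    by unfold_locales (use J a in blast)+
  show False by (rule inconsistent)
qed

section \<open>Hopf maps, their inverses and iterates, and the two cases\<close>

lemma slice_regular_hopf_map: "slice_regular_map UNIV (hopf_map p a b c)"
proof -
  have "fst \<circ> hopf_map p a b c = (\<lambda>(z, w). z * a + w ^ p * c)"
    "snd \<circ> hopf_map p a b c = (\<lambda>(z, w). z * 0 + w ^ 1 * b)"
    by (auto simp: hopf_map_def)
  then show ?thesis
    unfolding slice_regular_map_def by (simp only: slice_regular_affine_monomial)
qed

lemma continuous_hopf_map: "continuous_on S (hopf_map p a b c)"
  unfolding hopf_map_def case_prod_unfold by (intro continuous_intros)

lemma affine_hopf_map: "p = 1 \<or> c = 0 \<Longrightarrow> affine_transformation (hopf_map p a b c)"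
  unfolding affine_transformation_def
  by (rule exI[of _ a], rule exI[of _ c], rule exI[of _ 0], rule exI[of _ 0], rule exI[of _ b], rule exI[of _ 0])
    (auto simp: hopf_map_def)

text \<open>The condition ensures \<open>(w b)\<^sup>p c' = w\<^sup>p b\<^sup>p c'\<close> for any two members, so that the family is closed
  under composition.\<close>

definition hopf_family :: "nat \<Rightarrow> quat \<Rightarrow> (quat \<times> quat \<Rightarrow> quat \<times> quat) set" where
  "hopf_family p l = {hopf_map p a b c | a b c. a \<noteq> 0 \<and> b \<noteq> 0 \<and> (p \<noteq> 1 \<longrightarrow> (if l = 0 then c = 0 else b \<in> \<real>))}"

lemma hopf_familyI:
  "a \<noteq> 0 \<Longrightarrow> b \<noteq> 0 \<Longrightarrow> p \<noteq> 1 \<longrightarrow> (if l = 0 then c = 0 else b \<in> \<real>) \<Longrightarrow> hopf_map p a b c \<in> hopf_family p l"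
  unfolding hopf_family_def by blast

lemma hopf_map_compose:
  assumes "c = 0 \<or> p = 1 \<or> b' \<in> \<real>"
  shows "hopf_map p a b c (hopf_map p a' b' c' x) = hopf_map p (a' * a) (b' * b) (c' * a + b' ^ p * c) x"
proof -
  obtain z w where x: "x = (z, w)" by (cases x)
  have "(w * b') ^ p * c = w ^ p * (b' ^ p * c)"
    using assms
  proof (elim disjE)
    assume "b' \<in> \<real>"
    then obtain r where r: "b' = of_real r" by (auto simp: Reals_def)
    have "w * b' = r *\<^sub>R w" by (simp only: r scaleR_conv_of_real quat_of_real_commute)
    then have "(w * b') ^ p = r ^ p *\<^sub>R w ^ p" by (simp only: scaleR_power)
    also have "\<dots> = w ^ p * b' ^ p"
      unfolding r of_real_power[symmetric] scaleR_conv_of_real by (rule quat_of_real_commute)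
    finally show ?thesis by (simp add: mult.assoc)
  qed (simp_all add: mult.assoc)
  then show ?thesis by (simp add: x hopf_map_def algebra_simps mult.assoc)
qed

lemma hopf_family_compose:
  assumes "g \<in> hopf_family p l" "h \<in> hopf_family p l"
  shows "g \<circ> h \<in> hopf_family p l"
proof -
  obtain a b c where g: "g = hopf_map p a b c" "a \<noteq> 0" "b \<noteq> 0" "p \<noteq> 1 \<longrightarrow> (if l = 0 then c = 0 else b \<in> \<real>)"
    using assms(1) unfolding hopf_family_def by blast
  obtain a' b' c' where h: "h = hopf_map p a' b' c'" "a' \<noteq> 0" "b' \<noteq> 0" "p \<noteq> 1 \<longrightarrow> (if l = 0 then c' = 0 else b' \<in> \<real>)"
    using assms(2) unfolding hopf_family_def by blast
  have "c = 0 \<or> p = 1 \<or> b' \<in> \<real>" using g(4) h(4) by (auto split: if_splits)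
  then have "g \<circ> h = hopf_map p (a' * a) (b' * b) (c' * a + b' ^ p * c)"
    unfolding g(1) h(1) by (intro ext) (simp only: o_apply hopf_map_compose)
  moreover have "p \<noteq> 1 \<longrightarrow> (if l = 0 then c' * a + b' ^ p * c = 0 else b' * b \<in> \<real>)"
    using g(4) h(4) by (auto intro: Reals_mult)
  ultimately show ?thesis using g(2,3) h(2,3) by (simp only:) (intro hopf_familyI, auto)
qed

lemma hopf_map_1: "hopf_map p 1 1 0 = id"
  by (auto simp: hopf_map_def)

lemma hopf_family_inverse:
  assumes "g \<in> hopf_family p l"
  shows "bij g" "inv_into UNIV g \<in> hopf_family p l"
proof -
  obtain a b c where g: "g = hopf_map p a b c" "a \<noteq> 0" "b \<noteq> 0" "p \<noteq> 1 \<longrightarrow> (if l = 0 then c = 0 else b \<in> \<real>)"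
    using assms unfolding hopf_family_def by blast
  \<comment> \<open>Obtained by solving the equations of g for w and then for z, with (w b')^p c =
    w^p b'^p c for b' the inverse of b.\<close>
  define h where "h = hopf_map p (inverse a) (inverse b) (- (inverse b ^ p * c * inverse a))"
  have R: "c = 0 \<or> p = 1 \<or> b \<in> \<real>" using g(4) by (auto split: if_splits)
  then have R': "c = 0 \<or> p = 1 \<or> inverse b \<in> \<real>" by (auto simp: Reals_inverse)
  have bp: "b ^ p * inverse b ^ p = 1" "inverse b ^ p * b ^ p = 1"
    using g(3) by (simp_all add: power_inverse)
  have gh: "g (h x) = x" for x
  proof -
    have "g (h x) = hopf_map p (inverse a * a) (inverse b * b)
        (- (inverse b ^ p * c * inverse a) * a + inverse b ^ p * c) x"
      unfolding g(1) h_def by (rule hopf_map_compose) (use R' in auto)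
    also have "- (inverse b ^ p * c * inverse a) * a + inverse b ^ p * c = 0"
      using g(2) by (simp add: mult.assoc)
    finally show ?thesis using g(2,3) by (simp add: hopf_map_1)
  qed
  have hg: "h (g x) = x" for x
  proof -
    have "h (g x) = hopf_map p (a * inverse a) (b * inverse b)
        (c * inverse a + b ^ p * - (inverse b ^ p * c * inverse a)) x"
      unfolding g(1) h_def by (rule hopf_map_compose) (use R in auto)
    also have "c * inverse a + b ^ p * - (inverse b ^ p * c * inverse a) = 0"
      using bp by (simp add: mult.assoc[symmetric])
    finally show ?thesis using g(2,3) by (simp add: hopf_map_1)
  qed
  show "bij g" by (rule bij_betw_byWitness[of _ h]) (auto simp: gh hg)
  have "inv_into UNIV g = h" by (rule inv_equality[OF hg gh])
  moreover have "h \<in> hopf_family p l"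
    unfolding h_def using g(2-4) by (intro hopf_familyI) (auto simp: Reals_inverse split: if_splits)
  ultimately show "inv_into UNIV g \<in> hopf_family p l" by simp
qed

lemma int_iterate_hopf_family:
  assumes "g \<in> hopf_family p l"
  shows "int_iterate g k \<in> hopf_family p l"
proof -
  have "id \<in> hopf_family p l"
    unfolding hopf_map_1[of p, symmetric] by (intro hopf_familyI) auto
  then have "h ^^ n \<in> hopf_family p l" if "h \<in> hopf_family p l" for h n
    using that by (induction n) (auto simp: hopf_family_compose)
  then show ?thesis
    using assms hopf_family_inverse(2)[OF assms] by (simp add: int_iterate_def)
qed

lemma hopf_family_regular: "g \<in> hopf_family p l \<Longrightarrow> slice_regular_map UNIV g"
  and hopf_family_continuous: "g \<in> hopf_family p l \<Longrightarrow> continuous_on S g"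
  and hopf_family_affine: "g \<in> hopf_family p l \<Longrightarrow> p = 1 \<or> l = 0 \<Longrightarrow> affine_transformation g"
  unfolding hopf_family_def
  by (auto simp: slice_regular_hopf_map continuous_hopf_map affine_hopf_map split: if_splits)

lemma hopf_slice_contraction:
  assumes p: "p \<noteq> 0" and \<alpha>: "0 < norm \<alpha>" "norm \<alpha> \<le> norm \<beta>" and \<beta>: "norm \<beta> < 1"
    and f: "hopf_map p \<alpha> \<beta> l \<in> hopf_family p l"
  shows "\<exists>N c. slice_contraction (hopf_map p \<alpha> \<beta> l) N c"
proof -
  define s where "s = norm \<beta> ^ p"
  have s: "0 \<le> s" "s < 1" using p \<beta> by (auto simp: s_def power_less_one_iff)
  \<comment> \<open>Large enough that |l| is at most M (1 - s)/2. The mixed term is then absorbed: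
    |l| + M s is at most M (1 + s)/2, which explains the second entry of \<open>c\<close>. The
    summand 1 keeps \<open>M\<close> positive for l = 0.\<close>
  define M where "M = 2 * (norm l + 1) / (1 - s)"
  have M: "M > 0" using s by (simp add: M_def add_nonneg_pos)
  define c where "c = max (norm \<alpha>) ((1 + s) / 2)"
  have c: "0 < c" "c < 1" using \<alpha> \<beta> s by (auto simp: c_def less_max_iff_disj)
  define N where "N x = norm (fst x) + M * norm (snd x) ^ p" for x :: "quat \<times> quat"
  have lM: "norm l + M * s \<le> c * M"
  proof -
    have "norm l \<le> M * ((1 - s) / 2)" using s by (simp add: M_def)
    then have "norm l + M * s \<le> M * ((1 + s) / 2)" by (simp add: field_simps)
    also have "\<dots> \<le> M * c" using M by (intro mult_left_mono) (auto simp: c_def)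
    finally show ?thesis by (simp add: mult.commute)
  qed
  interpret contraction "hopf_map p \<alpha> \<beta> l" N c
  proof
    show "bij (hopf_map p \<alpha> \<beta> l)" by (rule hopf_family_inverse[OF f])
    show "continuous_on UNIV (hopf_map p \<alpha> \<beta> l)" "continuous_on UNIV (inv_into UNIV (hopf_map p \<alpha> \<beta> l))"
      using f hopf_family_inverse(2)[OF f] by (auto intro: hopf_family_continuous)
    show "hopf_map p \<alpha> \<beta> l (0, 0) = (0, 0)" using p by (simp add: hopf_map_def power_0_left)
    show "continuous_on UNIV N" unfolding N_def by (intro continuous_intros)
    show "0 < N x" if "x \<noteq> (0, 0)" for x
      using that M by (cases x) (auto simp: N_def intro: add_pos_nonneg add_nonneg_pos)
    show "0 < c" "c < 1" using c by auto
    fix x :: "quat \<times> quat"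
    obtain z w where x: "x = (z, w)" by (cases x)
    have "N (hopf_map p \<alpha> \<beta> l x) = norm (z * \<alpha> + w ^ p * l) + M * (norm w ^ p * s)"
      by (simp add: N_def hopf_map_def x norm_mult power_mult_distrib s_def)
    also have "\<dots> \<le> norm z * norm \<alpha> + norm w ^ p * norm l + M * (norm w ^ p * s)"
      using norm_triangle_ineq[of "z * \<alpha>" "w ^ p * l"] by (simp add: norm_mult norm_power)
    also have "\<dots> = norm \<alpha> * norm z + (norm l + M * s) * norm w ^ p" by (simp add: algebra_simps)
    also have "\<dots> \<le> c * norm z + (c * M) * norm w ^ p"
      using lM by (intro add_mono mult_right_mono) (auto simp: c_def)
    finally show "N (hopf_map p \<alpha> \<beta> l x) \<le> c * N x" by (simp add: N_def x algebra_simps)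
  qed
  have "slice_contraction (hopf_map p \<alpha> \<beta> l) N c"
  proof
    show "slice_regular_map UNIV (int_iterate (hopf_map p \<alpha> \<beta> l) k)" for k
      by (rule hopf_family_regular[OF int_iterate_hopf_family[OF f]])
    fix r R
    have "open {(z1 :: complex, z2 :: complex). r < cmod z1 + M * cmod z2 ^ p \<and> cmod z1 + M * cmod z2 ^ p < R}"
      unfolding case_prod_unfold by (intro open_Collect_conj open_Collect_less continuous_intros)
    from circular_of_norms[of "\<lambda>s t. r < s + M * t ^ p \<and> s + M * t ^ p < R", OF this]
    show "circular (shell r R)" by (simp add: shell_def N_def case_prod_unfold)
  qed
  then show ?thesis by blast
qed

theorem theorem2p1:
  fixes p :: nat and \<alpha> \<beta> l :: quat
  defines "\<Gamma> \<equiv> hopf_group p \<alpha> \<beta> l"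
  defines "X \<equiv> orbit_space \<Gamma>" and "A \<equiv> orbit_atlas \<Gamma>"
  assumes "p \<noteq> 0"
    and "0 < norm \<alpha>" and "norm \<alpha> \<le> norm \<beta>" and "norm \<beta> < 1"
    and "(\<alpha> - \<beta> ^ p) * l = 0"
    and "case_A p \<alpha> \<beta> l \<or> case_B p \<alpha> \<beta> l"
  shows "\<Gamma> \<subseteq> slice_Aut punctured_top punctured_atlas \<and>
    slice_map punctured_top punctured_atlas X A (orbit_proj \<Gamma>) \<and>
    slice_Hopf_surface X A \<and>
    (admits_affine_structure X A \<longleftrightarrow> case_A p \<alpha> \<beta> l)"
proof -
  let ?f = "hopf_map p \<alpha> \<beta> l"
  have nz: "\<alpha> \<noteq> 0" "\<beta> \<noteq> 0" using assms(5,6) by auto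
  have cases: "p = 1 \<or> l = 0" if "case_A p \<alpha> \<beta> l"
    using that by (auto simp: case_A_def case_A1_def case_A2_def case_A3_def)
  \<comment> \<open>Case A means p = 1 or l = 0, Case B has \<beta> real: in each of them f lies in
    the family that is closed under composition and inversion.\<close>
  have "p \<noteq> 1 \<longrightarrow> (if l = 0 then l = 0 else \<beta> \<in> \<real>)" using assms(9) cases by (auto simp: case_B_def)
  then have f: "?f \<in> hopf_family p l"
    using nz by (intro hopf_familyI) auto
  obtain N c where "slice_contraction ?f N c"
    using hopf_slice_contraction[OF assms(4-7) f] by blast
  then interpret slice_contraction ?f N c .
  have \<Gamma>: "\<Gamma> = range (int_iterate ?f)" by (simp add: \<Gamma>_def hopf_group_def)
  have "slice_Hopf_surface X A"
    unfolding slice_Hopf_surface_def X_def A_def \<Gamma>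
    using slice_manifold_X simply_connected_punctured slice_covering_X
      fundamental_group_iso[OF simply_connected_punctured] by blast
  moreover have "\<Gamma> \<subseteq> slice_Aut punctured_top punctured_atlas" using fk_in_Aut unfolding \<Gamma> by blast
  moreover have "slice_map punctured_top punctured_atlas X A (orbit_proj \<Gamma>)"
    unfolding X_def A_def \<Gamma> by (rule proj_slice_map)
  moreover have "admits_affine_structure X A" if "case_A p \<alpha> \<beta> l"
    unfolding admits_affine_structure_def X_def A_def \<Gamma>
    using affine_atlas_X[OF hopf_family_affine[OF int_iterate_hopf_family[OF f] cases[OF that]]]
      same_structure_X by blast
  moreover have False if adm: "admits_affine_structure X A" and B: "case_B p \<alpha> \<beta> l"
  proof -
    obtain B where B': "affine_atlas (orbit_space (range (int_iterate ?f))) B"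
      "same_slice_structure (orbit_space (range (int_iterate ?f))) (orbit_atlas (range (int_iterate ?f))) B"
      using adm unfolding admits_affine_structure_def X_def A_def \<Gamma> by blast
    interpret affine_contraction ?f N c B by unfold_locales (rule B')+
    obtain g T where g: "develops punctured g" "affine_transformation T" "\<forall>x\<in>punctured. g (?f x) = T (g x)"
      using developing_map_exists by blast
    obtain b where b: "\<beta> = of_real b" using B by (auto simp: case_B_def Reals_def)
    have "\<bar>b\<bar> < 1" "b \<noteq> 0" using assms(7) nz b by auto
    interpret resonant_developing_map g T p b l
    proof
      show "p > 1" "l \<noteq> 0" using B by (auto simp: case_B_def)
      show "b \<noteq> 0" "\<bar>b\<bar> < 1" by fact+
      show "affine_transformation T" by fact
      show "g (hopf_map p (of_real b ^ p) (of_real b) l x) = T (g x)" if "x \<in> punctured" for x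
        using g(3) that B b by (auto simp: case_B_def)
      show "\<exists>M. open M \<and> x \<in> M \<and> inj_on g M" if "x \<in> punctured" for x
        by (rule develops_locally_injective[OF g(1) that])
      show "\<exists>L. ((\<lambda>z. g (E J z)) has_derivative L) (at z) \<and> (\<forall>v. L (\<i> * fst v, \<i> * snd v) = lmul J (L v))"
        if J: "J \<in> imag_units" and z: "z \<noteq> 0" for J z
        using develops_slice_holomorphic[OF g(1) J, of z] E_punctured[OF J, of z] z by (simp add: E_def)
    qed
    show False by (rule contradiction)
  qed
  ultimately show ?thesis using assms(9) by blast
qed

end
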